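(* Let $\Bbbk$ be a field with $\mathrm{char}\,\Bbbk=0$, let $\Omega,\Xi$ be languages, let $\pi:\mathcal F_\Omega\to\mathcal P$ and $\rho:\mathcal F_\Xi\to\mathcal R$ be quotient morphisms onto operads $\mathcal P,\mathcal R$ governing varieties of algebras, and let $\omega:\mathcal F_\Omega\to\mathcal F_\Xi$ be a morphism of operads inducing a morphism $\mathcal P\to\mathcal R$, also denoted $\omega$. Suppose $f\in\mathcal F_{\Omega^{(2)}}\langle X\rangle$, $X=\{x_1,x_2,\dots\}$, is a polynomial of type $\Omega^{(2)}$. Denote by $L(f)$ the complete linearization of $f$; we may suppose $L(f)\in\mathcal F_{\Omega^{(2)}}(n)$. Then the following conditions are equivalent. (S1) $f=0$ is an identity on all $(\omega\otimes\mathrm{id})$-special $\mathrm{di}\mathcal P$-algebras, but is not an identity on the class of all $\mathrm{di}\mathcal P$-algebras. (S2) $\zeta_\Omega(n)(L(f))=\sum_{k=1}^n f_k\otimes e_k^{(n)}$ with $f_k\in\mathcal F_\Omega(n)$, where all $f_k$ are identities on the class of all $\omega$-special $\mathcal P$-algebras and at least one of them is not an identity on the class of all $\mathcal P$-algebras.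
   Context: Operads are symmetric operads in $\Bbbk$-vector spaces, $\mathcal P=\{\mathcal P(n)\}_{n\ge 1}$, with compositions $\gamma_{m_1,\dots,m_n}$, an identity in $\mathcal P(1)$ and $S_n$-actions. A morphism is a family of $S_n$-linear maps preserving compositions and identity; quotient operads are taken by operad ideals. A language $\Omega=\{f_i\mid i\in I\}$ is a set of symbols with arities $\nu(f_i)=n_i\ge 2$. An algebra of type $\Omega$ is a vector space with $n_i$-linear operations $f_i$. $\mathcal F_\Omega\langle X\rangle$ is the free algebra of type $\Omega$ on $X$; its elements are called polynomials of type $\Omega$. $\mathcal F_\Omega(n)$ is the space of its polylinear elements of degree $n$ in $x_1,\dots,x_n$; with composition by substitution, identity $x_1$, and $f^\sigma=f(x_{\sigma(1)},\dots,x_{\sigma(n)})$, these form the free operad $\mathcal F_\Omega$. For a vector space $A$, $\mathcal E(A)(n)=\mathrm{Hom}(A^{\otimes n},A)$ is the endomorphism operad. A $\mathcal P$-algebra is a pair $(A,\alpha)$ with $\alpha:\mathcal P\to\mathcal E(A)$ a morphism of operads. The operad governing a variety of algebras of type $\Omega$ defined by polylinear identities is $\mathcal P(n)=\mathcal F_\Omega(n)/(T\cap\mathcal F_\Omega(n))$, where $T$ is the ideal of identities of the variety. $\omega:\mathcal F_\Omega\to\mathcal F_\Xi$ induces a morphism $\mathcal P\to\mathcal R$ if $\omega(n)(\mathrm{Ker}\,\pi(n))\subseteq\mathrm{Ker}\,\rho(n)$ for all $n$. Given a morphism of operads $\omega:\mathcal P\to\mathcal R$, a $\mathcal P$-algebra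 $(A,\alpha)$ is $\omega$-special if there is an $\mathcal R$-algebra structure $\beta:\mathcal R\to\mathcal E(A)$ on the same space with $\alpha(n)(f)=\beta(n)(\omega(n)(f))$ for all $n$ and $f\in\mathcal P(n)$. The same definition is applied to $\omega\otimes\mathrm{id}:\mathrm{di}\mathcal P\to\mathrm{di}\mathcal R$. $\mathrm{Perm}(n)=\Bbbk^n$ with standard basis $e^{(n)}_1,\dots,e^{(n)}_n$, composition $\gamma_{m_1,\dots,m_n}(e_k^{(n)};e_{j_1}^{(m_1)},\dots,e_{j_n}^{(m_n)})=e^{(m_1+\dots+m_n)}_{m_1+\dots+m_{k-1}+j_k}$, and action $(e_k^{(n)})^\sigma=e^{(n)}_{\sigma(k)}$. $\mathrm{di}\mathcal P=\mathcal P\otimes\mathrm{Perm}$ is the Hadamard product: $\mathrm{di}\mathcal P(n)=\mathcal P(n)\otimes\mathrm{Perm}(n)$ with componentwise structure. $\Omega^{(2)}=\{f_i^k\mid i\in I,\ k=1,\dots,n_i\}$ with $\nu(f_i^k)=n_i$. The morphism $\zeta_\Omega:\mathcal F_{\Omega^{(2)}}\to\mathrm{di}\mathcal F_\Omega$ sends $f_i^k(x_1,\dots,x_{n_i})$ to $f_i(x_1,\dots,x_{n_i})\otimes e_k^{(n_i)}$. A $\mathrm{di}\mathcal P$-algebra is regarded as an algebra of type $\Omega^{(2)}$ with $f_i^k$ acting as $\pi(n_i)(f_i)\otimes e_k^{(n_i)}$. The complete linearization $L(f)$ is understood in the usual sense: the polylinear polynomial obtained from $f$ by the full linearization process (variables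 are replaced by sums of new distinct variables and the part linear in each of the new variables is taken, the new variables being renamed $x_1,\dots,x_n$); over a field of characteristic zero, passing from $f$ to $L(f)$ is used as an equivalence of identities.
   Formalization: The polynomial f is taken multihomogeneous (for other f, e.g. x + f^1(x,x), a single L(f) is not equivalent to f and the claim fails), and the algebras range over those on subsets of one arbitrary set at least as large as the field and both languages, which decide the same identities. *)

theory Defs
  imports
    "HOL-Algebra.Algebraic_Closure_Type"
    "HOL-Library.Poly_Mapping"
    "HOL-Library.Equipollence"
begin

text \<open>
  Vector spaces over the field \<open>'k\<close> are modules in the sense of HOL-Algebra over the ring
  record of \<open>'k\<close>; the ring multiplication and unit of the module record play no role.
  All numbering is from 0: the variables \<open>x\<^sub>1, x\<^sub>2, \<dots>\<close> are \<open>pvar 0, pvar 1, \<dots>\<close>, the basis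
  vectors \<open>e\<^sub>1, \<dots>, e\<^sub>n\<close> are indexed by \<open>{..<n}\<close>, and elements of the symmetric group are the
  \<open>\<sigma>\<close> with \<open>\<sigma> permutes {..<n}\<close>.
\<close>

section \<open>Vector spaces and linear maps\<close>

abbreviation vector_space_over :: "'k::field itself \<Rightarrow> ('k, 'v) module \<Rightarrow> bool" where
  "vector_space_over _ V \<equiv> Module.module (ring_of_type_algebra :: 'k ring) V"

definition mk_module ::
  "'v set \<Rightarrow> 'v \<Rightarrow> ('v \<Rightarrow> 'v \<Rightarrow> 'v) \<Rightarrow> ('k \<Rightarrow> 'v \<Rightarrow> 'v) \<Rightarrow> ('k, 'v) module" where
  "mk_module C z a s =
     \<lparr>carrier = C, monoid.mult = (\<lambda>_ _. undefined), one = undefined, ring.zero = z, add = a, module.smult = s\<rparr>"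

definition linear_map :: "('k, 'v) module \<Rightarrow> ('k, 'w) module \<Rightarrow> ('v \<Rightarrow> 'w) \<Rightarrow> bool" where
  "linear_map V W h \<longleftrightarrow>
     h \<in> carrier V \<rightarrow> carrier W \<and>
     (\<forall>x\<in>carrier V. \<forall>y\<in>carrier V. h (x \<oplus>\<^bsub>V\<^esub> y) = h x \<oplus>\<^bsub>W\<^esub> h y) \<and>
     (\<forall>c. \<forall>x\<in>carrier V. h (c \<odot>\<^bsub>V\<^esub> x) = c \<odot>\<^bsub>W\<^esub> h x)"

lemma mk_module_simps [simp]:
  "carrier (mk_module C z a s) = C" "zero (mk_module C z a s) = z"
  "add (mk_module C z a s) = a" "module.smult (mk_module C z a s) = s"
  by (simp_all add: mk_module_def)

lemma vector_space_overI:
  fixes V :: "('k::field, 'v) module"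
  assumes "abelian_group V"
    and "\<And>c x. x \<in> carrier V \<Longrightarrow> c \<odot>\<^bsub>V\<^esub> x \<in> carrier V"
    and "\<And>c d x. x \<in> carrier V \<Longrightarrow> (c + d) \<odot>\<^bsub>V\<^esub> x = c \<odot>\<^bsub>V\<^esub> x \<oplus>\<^bsub>V\<^esub> d \<odot>\<^bsub>V\<^esub> x"
    and "\<And>c x y. \<lbrakk>x \<in> carrier V; y \<in> carrier V\<rbrakk> \<Longrightarrow>
      c \<odot>\<^bsub>V\<^esub> (x \<oplus>\<^bsub>V\<^esub> y) = c \<odot>\<^bsub>V\<^esub> x \<oplus>\<^bsub>V\<^esub> c \<odot>\<^bsub>V\<^esub> y"
    and "\<And>c d x. x \<in> carrier V \<Longrightarrow> (c * d) \<odot>\<^bsub>V\<^esub> x = c \<odot>\<^bsub>V\<^esub> (d \<odot>\<^bsub>V\<^esub> x)"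
    and "\<And>x. x \<in> carrier V \<Longrightarrow> 1 \<odot>\<^bsub>V\<^esub> x = x"
  shows "vector_space_over TYPE('k) V"
proof (rule moduleI)
  show "cring (ring_of_type_algebra :: 'k ring)"
    by (rule cring_from_type_algebra)
qed (use assms in \<open>auto simp: ring_of_type_algebra_def\<close>)

lemma vector_space_overD:
  fixes V :: "('k::field, 'v) module"
  assumes "vector_space_over TYPE('k) V"
  shows "abelian_group V"
    and "\<And>c x. x \<in> carrier V \<Longrightarrow> c \<odot>\<^bsub>V\<^esub> x \<in> carrier V"
    and "\<And>c d x. x \<in> carrier V \<Longrightarrow> (c + d) \<odot>\<^bsub>V\<^esub> x = c \<odot>\<^bsub>V\<^esub> x \<oplus>\<^bsub>V\<^esub> d \<odot>\<^bsub>V\<^esub> x"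
    and "\<And>c x y. \<lbrakk>x \<in> carrier V; y \<in> carrier V\<rbrakk> \<Longrightarrow>
      c \<odot>\<^bsub>V\<^esub> (x \<oplus>\<^bsub>V\<^esub> y) = c \<odot>\<^bsub>V\<^esub> x \<oplus>\<^bsub>V\<^esub> c \<odot>\<^bsub>V\<^esub> y"
    and "\<And>c d x. x \<in> carrier V \<Longrightarrow> (c * d) \<odot>\<^bsub>V\<^esub> x = c \<odot>\<^bsub>V\<^esub> (d \<odot>\<^bsub>V\<^esub> x)"
    and "\<And>x. x \<in> carrier V \<Longrightarrow> 1 \<odot>\<^bsub>V\<^esub> x = x"
    and "\<And>x. x \<in> carrier V \<Longrightarrow> 0 \<odot>\<^bsub>V\<^esub> x = \<zero>\<^bsub>V\<^esub>"
proof -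
  interpret Module.module "ring_of_type_algebra :: 'k ring" V by fact
  show "abelian_group V" ..
  show "c \<odot>\<^bsub>V\<^esub> x \<in> carrier V" if "x \<in> carrier V" for c x
    using smult_closed[of c x] that by (simp add: ring_of_type_algebra_def)
  show "(c + d) \<odot>\<^bsub>V\<^esub> x = c \<odot>\<^bsub>V\<^esub> x \<oplus>\<^bsub>V\<^esub> d \<odot>\<^bsub>V\<^esub> x" if "x \<in> carrier V" for c d x
    using smult_l_distr[of c d x] that by (simp add: ring_of_type_algebra_def)
  show "c \<odot>\<^bsub>V\<^esub> (x \<oplus>\<^bsub>V\<^esub> y) = c \<odot>\<^bsub>V\<^esub> x \<oplus>\<^bsub>V\<^esub> c \<odot>\<^bsub>V\<^esub> y"
    if "x \<in> carrier V" "y \<in> carrier V" for c x y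
    using smult_r_distr[of c x y] that by (simp add: ring_of_type_algebra_def)
  show "(c * d) \<odot>\<^bsub>V\<^esub> x = c \<odot>\<^bsub>V\<^esub> (d \<odot>\<^bsub>V\<^esub> x)" if "x \<in> carrier V" for c d x
    using smult_assoc1[of c d x] that by (simp add: ring_of_type_algebra_def)
  show "1 \<odot>\<^bsub>V\<^esub> x = x" if "x \<in> carrier V" for x
    using smult_one[of x] that by (simp add: ring_of_type_algebra_def)
  show "0 \<odot>\<^bsub>V\<^esub> x = \<zero>\<^bsub>V\<^esub>" if "x \<in> carrier V" for x
    using smult_l_null[of x] that by (simp add: ring_of_type_algebra_def)
qed

lemma linear_map_finsum:
  fixes V :: "('k::field, 'v) module" and W :: "('k, 'w) module"
  assumes V: "vector_space_over TYPE('k) V" and W: "vector_space_over TYPE('k) W"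
    and h: "linear_map V W h" and "finite I" and G: "G \<in> I \<rightarrow> carrier V"
  shows "h (\<Oplus>\<^bsub>V\<^esub>i\<in>I. G i) = (\<Oplus>\<^bsub>W\<^esub>i\<in>I. h (G i))"
proof -
  interpret V: abelian_group V using vector_space_overD(1)[OF V] .
  interpret W: abelian_group W using vector_space_overD(1)[OF W] .
  have hc: "h x \<in> carrier W" if "x \<in> carrier V" for x
    using h that by (auto simp: linear_map_def)
  have "h \<zero>\<^bsub>V\<^esub> = h (0 \<odot>\<^bsub>V\<^esub> \<zero>\<^bsub>V\<^esub>)" using vector_space_overD(7)[OF V] by simp
  also have "\<dots> = 0 \<odot>\<^bsub>W\<^esub> h \<zero>\<^bsub>V\<^esub>" using h by (simp add: linear_map_def)
  also have "\<dots> = \<zero>\<^bsub>W\<^esub>" using vector_space_overD(7)[OF W] hc by simp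
  finally have h0: "h \<zero>\<^bsub>V\<^esub> = \<zero>\<^bsub>W\<^esub>" .
  show ?thesis using \<open>finite I\<close> G
  proof (induction I)
    case empty
    then show ?case by (simp add: h0)
  next
    case (insert j J)
    have "h (\<Oplus>\<^bsub>V\<^esub>i\<in>insert j J. G i) = h (G j \<oplus>\<^bsub>V\<^esub> (\<Oplus>\<^bsub>V\<^esub>i\<in>J. G i))"
      using insert by (subst V.finsum_insert) auto
    also have "\<dots> = h (G j) \<oplus>\<^bsub>W\<^esub> h (\<Oplus>\<^bsub>V\<^esub>i\<in>J. G i)"
      using h insert by (auto simp: linear_map_def intro!: V.finsum_closed)
    also have "\<dots> = h (G j) \<oplus>\<^bsub>W\<^esub> (\<Oplus>\<^bsub>W\<^esub>i\<in>J. h (G i))"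
      using insert by auto
    also have "\<dots> = (\<Oplus>\<^bsub>W\<^esub>i\<in>insert j J. h (G i))"
      using insert by (subst W.finsum_insert) (auto intro: hc)
    finally show ?case .
  qed
qed

definition tuples :: "('k, 'v) module \<Rightarrow> nat \<Rightarrow> 'v list set" where
  "tuples A n = {as. length as = n \<and> set as \<subseteq> carrier A}"

definition multilinear :: "('k, 'v) module \<Rightarrow> nat \<Rightarrow> ('v list \<Rightarrow> 'v) \<Rightarrow> bool" where
  "multilinear A n \<phi> \<longleftrightarrow>
     (\<forall>as\<in>tuples A n. \<phi> as \<in> carrier A) \<and>
     (\<forall>as\<in>tuples A n. \<forall>i<n. linear_map A A (\<lambda>a. \<phi> (as[i := a])))"

section \<open>Symmetric operads\<close>

text \<open>
  \<open>ocomp P [m\<^sub>1, \<dots>, m\<^sub>n]\<close> is the composition \<open>\<gamma>\<close> with lower indices \<open>m\<^sub>1, \<dots>, m\<^sub>n\<close>; only the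
  components \<open>ospace P n\<close> with \<open>n \<ge> 1\<close> are part of the operad.
\<close>

record ('k, 'p) operad =
  ospace :: "nat \<Rightarrow> ('k, 'p) module"
  ocomp :: "nat list \<Rightarrow> 'p \<Rightarrow> 'p list \<Rightarrow> 'p"
  oid :: 'p
  oact :: "nat \<Rightarrow> (nat \<Rightarrow> nat) \<Rightarrow> 'p \<Rightarrow> 'p"

abbreviation ocarrier :: "('k, 'p) operad \<Rightarrow> nat \<Rightarrow> 'p set" where
  "ocarrier P n \<equiv> carrier (ospace P n)"

definition valid_arities :: "nat list \<Rightarrow> bool" where
  "valid_arities ms \<longleftrightarrow> ms \<noteq> [] \<and> 0 \<notin> set ms"

definition oargs :: "('k, 'p) operad \<Rightarrow> nat list \<Rightarrow> 'p list set" where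
  "oargs P ms = {gs. list_all2 (\<lambda>m g. g \<in> ocarrier P m) ms gs}"

text \<open>The first position of the \<open>i\<close>-th of consecutive blocks of lengths \<open>ms\<close>.\<close>

definition offset :: "nat list \<Rightarrow> nat \<Rightarrow> nat" where
  "offset ms i = sum_list (take i ms)"

text \<open>
  The action is normalised by \<open>f\<^sup>\<sigma> = f(x\<^bsub>\<sigma>(1)\<^esub>, \<dots>, x\<^bsub>\<sigma>(n)\<^esub>)\<close>, hence \<open>(f\<^sup>\<sigma>)\<^sup>\<tau>\<close> is the result
  of acting by \<open>\<tau> \<circ> \<sigma>\<close>. In the equivariance axioms, \<open>\<tau>\<close> is respectively the permutation of blocks
  induced by \<open>\<sigma>\<close> and the block sum of the \<open>\<sigma>s i\<close>.
\<close>

locale operad =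
  fixes P :: "('k::field, 'p) operad"
  assumes ospace: "1 \<le> n \<Longrightarrow> vector_space_over TYPE('k) (ospace P n)"
    and oid_closed: "oid P \<in> ocarrier P 1"
    and ocomp_linear: "\<lbrakk>valid_arities ms; gs \<in> oargs P ms\<rbrakk> \<Longrightarrow>
      linear_map (ospace P (length ms)) (ospace P (sum_list ms)) (\<lambda>f. ocomp P ms f gs)"
    and ocomp_linear_arg:
      "\<lbrakk>valid_arities ms; f \<in> ocarrier P (length ms); gs \<in> oargs P ms; i < length ms\<rbrakk> \<Longrightarrow>
      linear_map (ospace P (ms ! i)) (ospace P (sum_list ms)) (\<lambda>g. ocomp P ms f (gs[i := g]))"
    and ocomp_oid_left: "\<lbrakk>1 \<le> m; g \<in> ocarrier P m\<rbrakk> \<Longrightarrow> ocomp P [m] (oid P) [g] = g"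
    and ocomp_oid_right: "\<lbrakk>1 \<le> n; f \<in> ocarrier P n\<rbrakk> \<Longrightarrow>
      ocomp P (replicate n 1) f (replicate n (oid P)) = f"
    and ocomp_assoc:
      "\<lbrakk>kss \<noteq> []; \<forall>ks\<in>set kss. valid_arities ks; f \<in> ocarrier P (length kss);
        gs \<in> oargs P (map length kss); list_all2 (\<lambda>ks hs. hs \<in> oargs P ks) kss hss\<rbrakk> \<Longrightarrow>
      ocomp P (concat kss) (ocomp P (map length kss) f gs) (concat hss) =
      ocomp P (map sum_list kss) f
        (map (\<lambda>i. ocomp P (kss ! i) (gs ! i) (hss ! i)) [0..<length kss])"
    and oact_linear: "\<lbrakk>1 \<le> n; \<sigma> permutes {..<n}\<rbrakk> \<Longrightarrow>
      linear_map (ospace P n) (ospace P n) (oact P n \<sigma>)"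
    and oact_id: "\<lbrakk>1 \<le> n; f \<in> ocarrier P n\<rbrakk> \<Longrightarrow> oact P n id f = f"
    and oact_oact:
      "\<lbrakk>1 \<le> n; f \<in> ocarrier P n; \<sigma> permutes {..<n}; \<tau> permutes {..<n}\<rbrakk> \<Longrightarrow>
      oact P n \<tau> (oact P n \<sigma> f) = oact P n (\<tau> \<circ> \<sigma>) f"
    and ocomp_oact:
      "\<lbrakk>valid_arities ms; n = length ms; f \<in> ocarrier P n; gs \<in> oargs P ms; \<sigma> permutes {..<n};
        ms' = map (\<lambda>i. ms ! \<sigma> i) [0..<n];
        \<tau> permutes {..<sum_list ms};
        \<And>i j. \<lbrakk>i < n; j < ms ! \<sigma> i\<rbrakk> \<Longrightarrow> \<tau> (offset ms' i + j) = offset ms (\<sigma> i) + j\<rbrakk> \<Longrightarrow>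
      ocomp P ms (oact P n \<sigma> f) gs =
      oact P (sum_list ms) \<tau> (ocomp P ms' f (map (\<lambda>i. gs ! \<sigma> i) [0..<n]))"
    and ocomp_oact_arg:
      "\<lbrakk>valid_arities ms; n = length ms; f \<in> ocarrier P n; gs \<in> oargs P ms;
        \<And>i. i < n \<Longrightarrow> \<sigma>s i permutes {..<ms ! i};
        \<tau> permutes {..<sum_list ms};
        \<And>i j. \<lbrakk>i < n; j < ms ! i\<rbrakk> \<Longrightarrow> \<tau> (offset ms i + j) = offset ms i + \<sigma>s i j\<rbrakk> \<Longrightarrow>
      ocomp P ms f (map (\<lambda>i. oact P (ms ! i) (\<sigma>s i) (gs ! i)) [0..<n]) =
      oact P (sum_list ms) \<tau> (ocomp P ms f gs)"

definition operad_hom ::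
  "('k, 'p) operad \<Rightarrow> ('k, 'q) operad \<Rightarrow> (nat \<Rightarrow> 'p \<Rightarrow> 'q) \<Rightarrow> bool" where
  "operad_hom P Q h \<longleftrightarrow>
     (\<forall>n\<ge>1. linear_map (ospace P n) (ospace Q n) (h n)) \<and>
     h 1 (oid P) = oid Q \<and>
     (\<forall>ms f gs. valid_arities ms \<and> f \<in> ocarrier P (length ms) \<and> gs \<in> oargs P ms \<longrightarrow>
        h (sum_list ms) (ocomp P ms f gs) = ocomp Q ms (h (length ms) f) (map2 h ms gs)) \<and>
     (\<forall>n\<ge>1. \<forall>\<sigma> f. \<sigma> permutes {..<n} \<and> f \<in> ocarrier P n \<longrightarrow>
        h n (oact P n \<sigma> f) = oact Q n \<sigma> (h n f))"

text \<open>
  \<open>Hom(A\<^sup>\<otimes>\<^sup>n, A)\<close> is represented by the \<open>n\<close>-linear maps on \<open>A\<close>, taken \<open>undefined\<close> outside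
  \<open>A\<^sup>n\<close> so that two of them are equal iff they agree on \<open>A\<^sup>n\<close>.
\<close>

definition endo :: "('k, 'u) module \<Rightarrow> ('k, 'u list \<Rightarrow> 'u) operad" where
  "endo A =
    \<lparr>ospace = (\<lambda>n. mk_module {\<phi> \<in> extensional (tuples A n). multilinear A n \<phi>}
        (\<lambda>as\<in>tuples A n. \<zero>\<^bsub>A\<^esub>)
        (\<lambda>\<phi> \<psi>. \<lambda>as\<in>tuples A n. \<phi> as \<oplus>\<^bsub>A\<^esub> \<psi> as)
        (\<lambda>c \<phi>. \<lambda>as\<in>tuples A n. c \<odot>\<^bsub>A\<^esub> \<phi> as)),
     ocomp = (\<lambda>ms \<phi> \<psi>s. \<lambda>as\<in>tuples A (sum_list ms).
        \<phi> (map (\<lambda>i. (\<psi>s ! i) (take (ms ! i) (drop (offset ms i) as))) [0..<length ms])),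
     oid = (\<lambda>as\<in>tuples A 1. hd as),
     oact = (\<lambda>n \<sigma> \<phi>. \<lambda>as\<in>tuples A n. \<phi> (map (\<lambda>i. as ! \<sigma> i) [0..<n]))\<rparr>"

section \<open>Algebras of type \<open>\<Omega>\<close> and free algebras\<close>

record 'o language =
  symb :: "'o set"
  ar :: "'o \<Rightarrow> nat"

definition is_language :: "'o language \<Rightarrow> bool" where
  "is_language \<Omega> \<longleftrightarrow> (\<forall>s\<in>symb \<Omega>. 2 \<le> ar \<Omega> s)"

datatype 'o tm = Var nat | Op 'o "'o tm list"

fun leaves :: "'o tm \<Rightarrow> nat list" where
  "leaves (Var i) = [i]"
| "leaves (Op s ts) = concat (map leaves ts)"

inductive_set terms :: "'o language \<Rightarrow> 'o tm set" for \<Omega> where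
  Var: "Var i \<in> terms \<Omega>"
| Op: "\<lbrakk>s \<in> symb \<Omega>; length ts = ar \<Omega> s; \<And>t. t \<in> set ts \<Longrightarrow> t \<in> terms \<Omega>\<rbrakk> \<Longrightarrow> Op s ts \<in> terms \<Omega>"

type_synonym ('k, 'o, 'u) alg = "('k, 'u) module \<times> ('o \<Rightarrow> 'u list \<Rightarrow> 'u)"

definition algebra_of_type :: "'o language \<Rightarrow> ('k::field, 'o, 'u) alg \<Rightarrow> bool" where
  "algebra_of_type \<Omega> = (\<lambda>(A, ops).
     vector_space_over TYPE('k) A \<and> (\<forall>s\<in>symb \<Omega>. multilinear A (ar \<Omega> s) (ops s)))"

text \<open>The elements of the free algebra are linear combinations of terms.\<close>

type_synonym ('k, 'o) npoly = "'o tm \<Rightarrow>\<^sub>0 'k"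

definition free_module :: "'o language \<Rightarrow> ('k::field, ('k, 'o) npoly) module" where
  "free_module \<Omega> =
     mk_module {p. Poly_Mapping.keys p \<subseteq> terms \<Omega>} 0 (+) (\<lambda>c. Poly_Mapping.map ((*) c))"

definition free_op :: "'o \<Rightarrow> ('k::field, 'o) npoly list \<Rightarrow> ('k, 'o) npoly" where
  "free_op s ps = (\<Sum>ts\<in>listset (map Poly_Mapping.keys ps).
     Poly_Mapping.single (Op s ts) (\<Prod>i<length ps. Poly_Mapping.lookup (ps ! i) (ts ! i)))"

definition free_alg :: "'o language \<Rightarrow> ('k::field, 'o, ('k, 'o) npoly) alg" where
  "free_alg \<Omega> = (free_module \<Omega>, free_op)"

definition pvar :: "nat \<Rightarrow> ('k::field, 'o) npoly" where
  "pvar i = Poly_Mapping.single (Var i) 1"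

fun term_eval :: "('o \<Rightarrow> 'u list \<Rightarrow> 'u) \<Rightarrow> (nat \<Rightarrow> 'u) \<Rightarrow> 'o tm \<Rightarrow> 'u" where
  "term_eval ops v (Var i) = v i"
| "term_eval ops v (Op s ts) = ops s (map (term_eval ops v) ts)"

definition poly_eval :: "('k::field, 'o, 'u) alg \<Rightarrow> (nat \<Rightarrow> 'u) \<Rightarrow> ('k, 'o) npoly \<Rightarrow> 'u" where
  "poly_eval = (\<lambda>(A, ops) v p.
     \<Oplus>\<^bsub>A\<^esub>t\<in>Poly_Mapping.keys p. Poly_Mapping.lookup p t \<odot>\<^bsub>A\<^esub> term_eval ops v t)"

definition is_identity :: "('k::field, 'o, 'u) alg \<Rightarrow> ('k, 'o) npoly \<Rightarrow> bool" where
  "is_identity A p \<longleftrightarrow>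
     (\<forall>v. (\<forall>i. v i \<in> carrier (fst A)) \<longrightarrow> poly_eval A v p = \<zero>\<^bsub>fst A\<^esub>)"

abbreviation subst_poly ::
  "'o language \<Rightarrow> (nat \<Rightarrow> ('k::field, 'o) npoly) \<Rightarrow> ('k, 'o) npoly \<Rightarrow> ('k, 'o) npoly" where
  "subst_poly \<Omega> \<equiv> poly_eval (free_alg \<Omega>)"

section \<open>Free operads\<close>

definition polylinear_term :: "nat \<Rightarrow> 'o tm \<Rightarrow> bool" where
  "polylinear_term n t \<longleftrightarrow> distinct (leaves t) \<and> set (leaves t) = {..<n}"

definition free_operad :: "'o language \<Rightarrow> ('k::field, ('k, 'o) npoly) operad" where
  "free_operad \<Omega> =
    \<lparr>ospace = (\<lambda>n. free_module \<Omega>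
        \<lparr>carrier := {p \<in> carrier (free_module \<Omega>). \<forall>t\<in>Poly_Mapping.keys p. polylinear_term n t}\<rparr>),
     ocomp = (\<lambda>ms f gs.
        subst_poly \<Omega> (\<lambda>i. subst_poly \<Omega> (\<lambda>j. pvar (offset ms i + j)) (gs ! i)) f),
     oid = pvar 0,
     oact = (\<lambda>n \<sigma> f. subst_poly \<Omega> (\<lambda>i. pvar (\<sigma> i)) f)\<rparr>"

definition generator :: "'o language \<Rightarrow> 'o \<Rightarrow> ('k::field, 'o) npoly" where
  "generator \<Omega> s = Poly_Mapping.single (Op s (map Var [0..<ar \<Omega> s])) 1"

section \<open>Operads governing varieties\<close>

definition variety ::
  "'o language \<Rightarrow> ('k::field, 'o) npoly set \<Rightarrow> ('k, 'o, 'u) alg set" where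
  "variety \<Omega> S = {A. algebra_of_type \<Omega> A \<and> (\<forall>p\<in>S. is_identity A p)}"

definition identities ::
  "'o language \<Rightarrow> ('k::field, 'o, 'u) alg set \<Rightarrow> ('k, 'o) npoly set" where
  "identities \<Omega> V = {p \<in> carrier (free_module \<Omega>). \<forall>A\<in>V. is_identity A p}"

text \<open>
  \<open>P\<close> is the quotient of the free operad by the polylinear identities of the class \<open>V\<close>, with
  quotient morphism \<open>\<pi>\<close>.
\<close>

definition governs ::
  "'o language \<Rightarrow> ('k::field, 'o, 'u) alg set \<Rightarrow> ('k, 'p) operad \<Rightarrow>
   (nat \<Rightarrow> ('k, 'o) npoly \<Rightarrow> 'p) \<Rightarrow> bool" where
  "governs \<Omega> V P \<pi> \<longleftrightarrow>
     operad P \<and> operad_hom (free_operad \<Omega>) P \<pi> \<and>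
     (\<forall>n\<ge>1. \<pi> n ` ocarrier (free_operad \<Omega>) n = ocarrier P n) \<and>
     (\<forall>n\<ge>1. {f \<in> ocarrier (free_operad \<Omega>) n. \<pi> n f = \<zero>\<^bsub>ospace P n\<^esub>} =
       ocarrier (free_operad \<Omega>) n \<inter> identities \<Omega> V)"

text \<open>
  Classes of algebras are formed within a carrier type \<open>'u\<close>. They decide the same identities as the
  classes of algebras of arbitrary size as soon as \<open>'u\<close> is at least as large as the field and
  the sets of symbols: if an identity fails in some (special) algebra, it fails in the
  subalgebra generated by finitely many elements (under the operations of the ambient type when
  the algebra is special), and that subalgebra is isomorphic to one carried by a subset of \<open>'u\<close>.
\<close>

definition algebras ::
  "('k::field, 'p) operad \<Rightarrow> (('k, 'u) module \<times> (nat \<Rightarrow> 'p \<Rightarrow> 'u list \<Rightarrow> 'u)) set" where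
  "algebras P = {(A, \<alpha>). vector_space_over TYPE('k) A \<and> operad_hom P (endo A) \<alpha>}"

definition special_algebras ::
  "('k::field, 'p) operad \<Rightarrow> ('k, 'r) operad \<Rightarrow> (nat \<Rightarrow> 'p \<Rightarrow> 'r) \<Rightarrow>
   (('k, 'u) module \<times> (nat \<Rightarrow> 'p \<Rightarrow> 'u list \<Rightarrow> 'u)) set" where
  "special_algebras P R \<omega> = {(A, \<alpha>) \<in> algebras P.
     \<exists>\<beta>. (A, \<beta>) \<in> algebras R \<and> (\<forall>n\<ge>1. \<forall>f\<in>ocarrier P n. \<alpha> n f = \<beta> n (\<omega> n f))}"

definition induces ::
  "'o language \<Rightarrow> ('k::field, 'p) operad \<Rightarrow> (nat \<Rightarrow> ('k, 'o) npoly \<Rightarrow> 'p) \<Rightarrow>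
   ('k, 'r) operad \<Rightarrow> (nat \<Rightarrow> ('k, 'x) npoly \<Rightarrow> 'r) \<Rightarrow>
   (nat \<Rightarrow> ('k, 'o) npoly \<Rightarrow> ('k, 'x) npoly) \<Rightarrow> bool" where
  "induces \<Omega> P \<pi> R \<rho> \<omega> \<longleftrightarrow>
     (\<forall>n\<ge>1. \<forall>f\<in>ocarrier (free_operad \<Omega>) n.
        \<pi> n f = \<zero>\<^bsub>ospace P n\<^esub> \<longrightarrow> \<rho> n (\<omega> n f) = \<zero>\<^bsub>ospace R n\<^esub>)"

definition induced_hom ::
  "'o language \<Rightarrow> (nat \<Rightarrow> ('k::field, 'o) npoly \<Rightarrow> 'p) \<Rightarrow> (nat \<Rightarrow> ('k, 'x) npoly \<Rightarrow> 'r) \<Rightarrow>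
   (nat \<Rightarrow> ('k, 'o) npoly \<Rightarrow> ('k, 'x) npoly) \<Rightarrow> nat \<Rightarrow> 'p \<Rightarrow> 'r" where
  "induced_hom \<Omega> \<pi> \<rho> \<omega> n x =
     \<rho> n (\<omega> n (inv_into (ocarrier (free_operad \<Omega>) n) (\<pi> n) x))"

definition operad_alg ::
  "'o language \<Rightarrow> (nat \<Rightarrow> ('k::field, 'o) npoly \<Rightarrow> 'p) \<Rightarrow>
   ('k, 'u) module \<times> (nat \<Rightarrow> 'p \<Rightarrow> 'u list \<Rightarrow> 'u) \<Rightarrow> ('k, 'o, 'u) alg" where
  "operad_alg \<Omega> \<pi> = (\<lambda>(A, \<alpha>). (A, \<lambda>s. \<alpha> (ar \<Omega> s) (\<pi> (ar \<Omega> s) (generator \<Omega> s))))"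

section \<open>The operad Perm and the Hadamard product with it\<close>

definition basis_vec :: "nat \<Rightarrow> nat \<Rightarrow> nat \<Rightarrow> 'k::field" where
  "basis_vec n k = (\<lambda>i\<in>{..<n}. if i = k then 1 else 0)"

text \<open>\<open>choices ms\<close> consists of the lists \<open>[j\<^sub>1, \<dots>, j\<^sub>n]\<close> with \<open>j\<^sub>i < m\<^sub>i\<close>.\<close>

definition choices :: "nat list \<Rightarrow> nat list set" where
  "choices ms = listset (map (\<lambda>m. {..<m}) ms)"

definition perm_space :: "nat \<Rightarrow> ('k::field, nat \<Rightarrow> 'k) module" where
  "perm_space n = mk_module ({..<n} \<rightarrow>\<^sub>E UNIV) (\<lambda>i\<in>{..<n}. 0)
     (\<lambda>u v. \<lambda>i\<in>{..<n}. u i + v i) (\<lambda>c u. \<lambda>i\<in>{..<n}. c * u i)"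

text \<open>Composition and action are the multilinear extensions of the rules for basis vectors.\<close>

definition perm :: "('k::field, nat \<Rightarrow> 'k) operad" where
  "perm =
    \<lparr>ospace = perm_space,
     ocomp = (\<lambda>ms u vs.
        \<Oplus>\<^bsub>perm_space (sum_list ms)\<^esub>k\<in>{..<length ms}.
        \<Oplus>\<^bsub>perm_space (sum_list ms)\<^esub>js\<in>choices ms.
        (u k * (\<Prod>i<length ms. (vs ! i) (js ! i))) \<odot>\<^bsub>perm_space (sum_list ms)\<^esub>
          basis_vec (sum_list ms) (offset ms k + js ! k)),
     oid = basis_vec 1 0,
     oact = (\<lambda>n \<sigma> u. \<Oplus>\<^bsub>perm_space n\<^esub>k\<in>{..<n}. u k \<odot>\<^bsub>perm_space n\<^esub> basis_vec n (\<sigma> k))\<rparr>"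

text \<open>
  The tensor product \<open>V \<otimes> \<bbbk>\<^sup>n\<close> is realised as \<open>V\<^sup>n\<close>, the tensor \<open>x \<otimes> u\<close> being the tuple
  \<open>(u\<^sub>1 x, \<dots>, u\<^sub>n x)\<close>; in particular the element \<open>F\<close> equals the sum of the \<open>F k \<otimes> e\<^sub>k\<close>.
  Lemma \<open>tensor_universal\<close> is the universal property.
\<close>

definition tensor_space :: "('k, 'p) module \<Rightarrow> nat \<Rightarrow> ('k, nat \<Rightarrow> 'p) module" where
  "tensor_space V n = mk_module ({..<n} \<rightarrow>\<^sub>E carrier V) (\<lambda>i\<in>{..<n}. \<zero>\<^bsub>V\<^esub>)
     (\<lambda>F G. \<lambda>i\<in>{..<n}. F i \<oplus>\<^bsub>V\<^esub> G i) (\<lambda>c F. \<lambda>i\<in>{..<n}. c \<odot>\<^bsub>V\<^esub> F i)"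

definition tensor :: "('k, 'p) module \<Rightarrow> nat \<Rightarrow> 'p \<Rightarrow> (nat \<Rightarrow> 'k) \<Rightarrow> nat \<Rightarrow> 'p" where
  "tensor V n x u = (\<lambda>i\<in>{..<n}. u i \<odot>\<^bsub>V\<^esub> x)"

lemma vector_space_tensor_space:
  fixes V :: "('k::field, 'v) module"
  assumes V: "vector_space_over TYPE('k) V"
  shows "vector_space_over TYPE('k) (tensor_space V n)"
proof -
  interpret V: abelian_group V using vector_space_overD(1)[OF V] .
  note D = vector_space_overD[OF V]
  show ?thesis
  proof (rule vector_space_overI)
    show "abelian_group (tensor_space V n)"
    proof (rule abelian_groupI)
      fix F assume "F \<in> carrier (tensor_space V n)"
      then show "\<exists>G\<in>carrier (tensor_space V n). G \<oplus>\<^bsub>tensor_space V n\<^esub> F = \<zero>\<^bsub>tensor_space V n\<^esub>"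
        by (intro bexI[of _ "\<lambda>i\<in>{..<n}. \<ominus>\<^bsub>V\<^esub> F i"])
          (auto simp: tensor_space_def V.l_neg PiE_iff intro!: restrict_ext)
    qed (auto simp: tensor_space_def fun_eq_iff PiE_iff extensional_def
        V.a_ac)
  qed (auto simp: tensor_space_def fun_eq_iff PiE_iff extensional_def D(2-6))
qed

lemma tensor_expansion:
  fixes V :: "('k::field, 'v) module"
  assumes V: "vector_space_over TYPE('k) V" and F: "F \<in> carrier (tensor_space V n)"
  shows "F = (\<Oplus>\<^bsub>tensor_space V n\<^esub>k\<in>{..<n}. tensor V n (F k) (basis_vec n k))"
    (is "F = ?S")
proof -
  interpret V: abelian_group V using vector_space_overD(1)[OF V] .
  note D = vector_space_overD[OF V]
  let ?T = "tensor_space V n"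
  have T: "vector_space_over TYPE('k) ?T" by (rule vector_space_tensor_space[OF V])
  interpret T: abelian_group ?T using vector_space_overD(1)[OF T] .
  have c: "(\<lambda>k. tensor V n (F k) (basis_vec n k)) \<in> {..<n} \<rightarrow> carrier ?T"
    using F by (auto simp: tensor_space_def tensor_def PiE_iff split: if_splits intro!: D(2))
  have S: "?S \<in> carrier ?T" by (rule T.finsum_closed[OF c])
  show ?thesis
  proof
    fix i
    show "F i = ?S i"
    proof (cases "i < n")
      case False
      then show ?thesis using F S by (auto simp: tensor_space_def PiE_iff extensional_def)
    next
      case True
      have "linear_map ?T V (\<lambda>G. G i)"
        using True by (auto simp: linear_map_def tensor_space_def)
      then have "?S i = (\<Oplus>\<^bsub>V\<^esub>k\<in>{..<n}. tensor V n (F k) (basis_vec n k) i)"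
        using linear_map_finsum[OF T V _ _ c] by simp
      also have "\<dots> = (\<Oplus>\<^bsub>V\<^esub>k\<in>{..<n}. if i = k then F k else \<zero>\<^bsub>V\<^esub>)"
        using F True D(2,6,7)
        by (intro V.finsum_cong') (auto simp: tensor_def basis_vec_def tensor_space_def PiE_iff)
      also have "\<dots> = F i"
        using V.finsum_singleton[of i "{..<n}" F] F True by (auto simp: tensor_space_def)
      finally show ?thesis by simp
    qed
  qed
qed

lemma tensor_universal:
  fixes V :: "('k::field, 'v) module" and W :: "('k, 'w) module"
  assumes V: "vector_space_over TYPE('k) V" and W: "vector_space_over TYPE('k) W"
    and b1: "\<And>u. u \<in> carrier (perm_space n) \<Longrightarrow> linear_map V W (\<lambda>x. b x u)"
    and b2: "\<And>x. x \<in> carrier V \<Longrightarrow> linear_map (perm_space n) W (b x)"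
  shows "\<exists>h. (linear_map (tensor_space V n) W h \<and>
        (\<forall>x\<in>carrier V. \<forall>u\<in>carrier (perm_space n). h (tensor V n x u) = b x u)) \<and>
      (\<forall>h'. linear_map (tensor_space V n) W h' \<and>
          (\<forall>x\<in>carrier V. \<forall>u\<in>carrier (perm_space n). h' (tensor V n x u) = b x u) \<longrightarrow>
        (\<forall>F\<in>carrier (tensor_space V n). h' F = h F))"
proof -
  interpret V: abelian_group V using vector_space_overD(1)[OF V] .
  interpret W: abelian_group W using vector_space_overD(1)[OF W] .
  note D = vector_space_overD[OF V] and E = vector_space_overD[OF W]
  let ?T = "tensor_space V n"
  have T: "vector_space_over TYPE('k) ?T" by (rule vector_space_tensor_space[OF V])
  define h where "h F = (\<Oplus>\<^bsub>W\<^esub>k\<in>{..<n}. b (F k) (basis_vec n k))" for F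
  have e: "basis_vec n k \<in> carrier (perm_space n)" for k
    by (auto simp: basis_vec_def perm_space_def)
  have bc: "b x u \<in> carrier W" if "x \<in> carrier V" "u \<in> carrier (perm_space n)" for x u
    using b1[OF that(2)] that by (auto simp: linear_map_def)
  have add: "b (x \<oplus>\<^bsub>V\<^esub> y) u = b x u \<oplus>\<^bsub>W\<^esub> b y u"
    if "x \<in> carrier V" "y \<in> carrier V" "u \<in> carrier (perm_space n)" for x y u
    using b1[OF that(3)] that by (auto simp: linear_map_def)
  have scal: "b (c \<odot>\<^bsub>V\<^esub> x) u = c \<odot>\<^bsub>W\<^esub> b x u"
    if "x \<in> carrier V" "u \<in> carrier (perm_space n)" for c x u
    using b1[OF that(2)] that by (auto simp: linear_map_def)
  have scal2: "b x (c \<odot>\<^bsub>perm_space n\<^esub> u) = c \<odot>\<^bsub>W\<^esub> b x u"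
    if "x \<in> carrier V" "u \<in> carrier (perm_space n)" for c x u
    using b2[OF that(1)] that by (auto simp: linear_map_def)
  have Fk: "F k \<in> carrier V" if "F \<in> carrier ?T" "k < n" for F k
    using that by (auto simp: tensor_space_def)
  have smult_W: "linear_map W W (\<lambda>x. c \<odot>\<^bsub>W\<^esub> x)" for c
    using E by (auto simp: linear_map_def simp flip: E(5)) (simp add: mult.commute)
  have lin: "linear_map ?T W h"
    unfolding linear_map_def
  proof (intro conjI ballI allI)
    show "h \<in> carrier ?T \<rightarrow> carrier W"
      unfolding h_def by (auto intro!: W.finsum_closed bc e Fk)
    show "h (F \<oplus>\<^bsub>?T\<^esub> G) = h F \<oplus>\<^bsub>W\<^esub> h G" if FG: "F \<in> carrier ?T" "G \<in> carrier ?T" for F G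
    proof -
      have "h (F \<oplus>\<^bsub>?T\<^esub> G) = (\<Oplus>\<^bsub>W\<^esub>k\<in>{..<n}. b (F k) (basis_vec n k) \<oplus>\<^bsub>W\<^esub> b (G k) (basis_vec n k))"
        unfolding h_def
      proof (rule W.finsum_cong')
        show "b ((F \<oplus>\<^bsub>?T\<^esub> G) k) (basis_vec n k) =
            b (F k) (basis_vec n k) \<oplus>\<^bsub>W\<^esub> b (G k) (basis_vec n k)" if "k \<in> {..<n}" for k
          using that FG by (simp add: tensor_space_def add[symmetric] e PiE_iff)
      qed (auto intro!: bc e Fk FG)
      also have "\<dots> = h F \<oplus>\<^bsub>W\<^esub> h G"
        unfolding h_def by (rule W.finsum_addf) (auto intro!: bc e Fk FG)
      finally show ?thesis .
    qed
    show "h (c \<odot>\<^bsub>?T\<^esub> F) = c \<odot>\<^bsub>W\<^esub> h F" if F: "F \<in> carrier ?T" for c F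
    proof -
      have "h (c \<odot>\<^bsub>?T\<^esub> F) = (\<Oplus>\<^bsub>W\<^esub>k\<in>{..<n}. c \<odot>\<^bsub>W\<^esub> b (F k) (basis_vec n k))"
        unfolding h_def
      proof (rule W.finsum_cong')
        show "b ((c \<odot>\<^bsub>?T\<^esub> F) k) (basis_vec n k) = c \<odot>\<^bsub>W\<^esub> b (F k) (basis_vec n k)"
          if "k \<in> {..<n}" for k
          using that F by (simp add: tensor_space_def scal[symmetric] e PiE_iff)
      qed (auto intro!: bc e Fk F E(2))
      also have "\<dots> = c \<odot>\<^bsub>W\<^esub> h F"
        unfolding h_def by (rule linear_map_finsum[OF W W smult_W, symmetric])
          (auto intro!: bc e Fk F)
      finally show ?thesis .
    qed
  qed
  have u_exp: "u = (\<Oplus>\<^bsub>perm_space n\<^esub>k\<in>{..<n}. u k \<odot>\<^bsub>perm_space n\<^esub> basis_vec n k)"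
    and P: "vector_space_over TYPE('k) (perm_space n :: ('k, nat \<Rightarrow> 'k) module)"
    if u: "u \<in> carrier (perm_space n)" for u :: "nat \<Rightarrow> 'k"
  proof -
    let ?K = "mk_module UNIV 0 (+) (*) :: ('k, 'k) module"
    have K: "vector_space_over TYPE('k) ?K"
    proof (rule vector_space_overI)
      show "abelian_group ?K"
      proof (rule abelian_groupI)
        fix x assume "x \<in> carrier ?K"
        show "\<exists>y\<in>carrier ?K. y \<oplus>\<^bsub>?K\<^esub> x = \<zero>\<^bsub>?K\<^esub>"
          by (rule bexI[of _ "- x"]) auto
      qed auto
    qed (auto simp: algebra_simps)
    have eq: "perm_space n = tensor_space ?K n"
      by (simp add: perm_space_def tensor_space_def)
    show "vector_space_over TYPE('k) (perm_space n :: ('k, nat \<Rightarrow> 'k) module)"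
      unfolding eq by (rule vector_space_tensor_space[OF K])
    have "tensor ?K n (u k) (basis_vec n k) = u k \<odot>\<^bsub>perm_space n\<^esub> basis_vec n k" for k
      by (auto simp: tensor_def perm_space_def)
    with tensor_expansion[OF K, of u n] u
    show "u = (\<Oplus>\<^bsub>perm_space n\<^esub>k\<in>{..<n}. u k \<odot>\<^bsub>perm_space n\<^esub> basis_vec n k)"
      by (simp add: eq)
  qed
  have ext: "h (tensor V n x u) = b x u" if x: "x \<in> carrier V" and u: "u \<in> carrier (perm_space n)" for x u
  proof -
    have "b x u = b x (\<Oplus>\<^bsub>perm_space n\<^esub>k\<in>{..<n}. u k \<odot>\<^bsub>perm_space n\<^esub> basis_vec n k)"
      using u_exp[OF u] by simp
    also have "\<dots> = (\<Oplus>\<^bsub>W\<^esub>k\<in>{..<n}. b x (u k \<odot>\<^bsub>perm_space n\<^esub> basis_vec n k))"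
      by (rule linear_map_finsum[OF P[OF u] W b2[OF x]])
        (auto intro!: vector_space_overD(2)[OF P[OF u]] e)
    also have "\<dots> = h (tensor V n x u)"
      unfolding h_def using x
      by (intro W.finsum_cong') (auto simp: tensor_def scal scal2 e intro!: bc E(2) D(2))
    finally show ?thesis by simp
  qed
  have uniq: "h' F = h F"
    if h': "linear_map ?T W h'" "\<forall>x\<in>carrier V. \<forall>u\<in>carrier (perm_space n). h' (tensor V n x u) = b x u"
      and F: "F \<in> carrier ?T" for h' F
  proof -
    have "h' F = h' (\<Oplus>\<^bsub>?T\<^esub>k\<in>{..<n}. tensor V n (F k) (basis_vec n k))"
      using tensor_expansion[OF V F] by simp
    also have "\<dots> = (\<Oplus>\<^bsub>W\<^esub>k\<in>{..<n}. h' (tensor V n (F k) (basis_vec n k)))"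
      by (rule linear_map_finsum[OF T W h'(1)])
        (use F in \<open>auto simp: tensor_def tensor_space_def PiE_iff split: if_splits intro!: D(2)\<close>)
    also have "\<dots> = h F"
      unfolding h_def using h'(2) by (intro W.finsum_cong') (auto intro!: bc e Fk F)
    finally show ?thesis .
  qed
  show ?thesis using lin ext uniq by blast
qed

abbreviation di_tensor :: "('k, 'p) operad \<Rightarrow> nat \<Rightarrow> 'p \<Rightarrow> (nat \<Rightarrow> 'k) \<Rightarrow> nat \<Rightarrow> 'p" where
  "di_tensor P n \<equiv> tensor (ospace P n) n"

text \<open>
  The componentwise structure: with \<open>F\<close> the sum of the \<open>F k \<otimes> e\<^sub>k\<close>, and likewise for the
  arguments, \<open>\<gamma>(x \<otimes> u; y\<^sub>i \<otimes> v\<^sub>i) = \<gamma>(x; y\<^sub>i) \<otimes> \<gamma>(u; v\<^sub>i)\<close> and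
  \<open>(x \<otimes> u)\<^sup>\<sigma> = x\<^sup>\<sigma> \<otimes> u\<^sup>\<sigma>\<close> are extended multilinearly.
\<close>

definition di :: "('k::field, 'p) operad \<Rightarrow> ('k, nat \<Rightarrow> 'p) operad" where
  "di P =
    \<lparr>ospace = (\<lambda>n. tensor_space (ospace P n) n),
     ocomp = (\<lambda>ms F Gs.
        \<Oplus>\<^bsub>tensor_space (ospace P (sum_list ms)) (sum_list ms)\<^esub>k\<in>{..<length ms}.
        \<Oplus>\<^bsub>tensor_space (ospace P (sum_list ms)) (sum_list ms)\<^esub>js\<in>choices ms.
          di_tensor P (sum_list ms)
            (ocomp P ms (F k) (map2 (\<lambda>G j. G j) Gs js))
            (ocomp perm ms (basis_vec (length ms) k) (map2 basis_vec ms js))),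
     oid = di_tensor P 1 (oid P) (oid perm),
     oact = (\<lambda>n \<sigma> F. \<Oplus>\<^bsub>tensor_space (ospace P n) n\<^esub>k\<in>{..<n}.
        di_tensor P n (oact P n \<sigma> (F k)) (oact perm n \<sigma> (basis_vec n k)))\<rparr>"

definition di_hom :: "(nat \<Rightarrow> 'p \<Rightarrow> 'r) \<Rightarrow> nat \<Rightarrow> (nat \<Rightarrow> 'p) \<Rightarrow> nat \<Rightarrow> 'r" where
  "di_hom \<omega> n F = (\<lambda>k\<in>{..<n}. \<omega> n (F k))"

definition doubled :: "'o language \<Rightarrow> ('o \<times> nat) language" where
  "doubled \<Omega> =
     \<lparr>symb = {(s, k). s \<in> symb \<Omega> \<and> k < ar \<Omega> s}, ar = (\<lambda>(s, k). ar \<Omega> s)\<rparr>"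

definition is_zeta ::
  "'o language \<Rightarrow> (nat \<Rightarrow> ('k::field, 'o \<times> nat) npoly \<Rightarrow> nat \<Rightarrow> ('k, 'o) npoly) \<Rightarrow> bool" where
  "is_zeta \<Omega> \<zeta> \<longleftrightarrow>
     operad_hom (free_operad (doubled \<Omega>)) (di (free_operad \<Omega>)) \<zeta> \<and>
     (\<forall>s\<in>symb \<Omega>. \<forall>k<ar \<Omega> s.
        \<zeta> (ar \<Omega> s) (generator (doubled \<Omega>) (s, k)) =
        di_tensor (free_operad \<Omega>) (ar \<Omega> s) (generator \<Omega> s) (basis_vec (ar \<Omega> s) k))"

definition di_operad_alg ::
  "'o language \<Rightarrow> ('k::field, 'p) operad \<Rightarrow> (nat \<Rightarrow> ('k, 'o) npoly \<Rightarrow> 'p) \<Rightarrow>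
   ('k, 'u) module \<times> (nat \<Rightarrow> (nat \<Rightarrow> 'p) \<Rightarrow> 'u list \<Rightarrow> 'u) \<Rightarrow> ('k, 'o \<times> nat, 'u) alg" where
  "di_operad_alg \<Omega> P \<pi> = (\<lambda>(A, \<alpha>). (A, \<lambda>(s, k). \<alpha> (ar \<Omega> s)
     (di_tensor P (ar \<Omega> s) (\<pi> (ar \<Omega> s) (generator \<Omega> s)) (basis_vec (ar \<Omega> s) k))))"

section \<open>Complete linearization\<close>

definition polylinear_part :: "nat \<Rightarrow> ('k::field, 'o) npoly \<Rightarrow> ('k, 'o) npoly" where
  "polylinear_part n p = (\<Sum>t\<in>{t \<in> Poly_Mapping.keys p. polylinear_term n t}.
     Poly_Mapping.single t (Poly_Mapping.lookup p t))"

text \<open>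
  The \<open>n\<close> new variables \<open>pvar 0, \<dots>, pvar (n - 1)\<close> are distributed among the old ones by \<open>c\<close>: the
  old variable \<open>pvar i\<close> is replaced by the sum of those \<open>pvar j\<close> with \<open>c j = i\<close>. A polynomial has a
  complete linearization only if it is multihomogeneous, i.e. every \<open>pvar i\<close> has the same degree
  in all its terms; the number of new variables replacing \<open>pvar i\<close> is that degree. The order in
  which the new variables are numbered is left arbitrary.
\<close>

definition complete_linearization ::
  "'o language \<Rightarrow> nat \<Rightarrow> ('k::field, 'o) npoly \<Rightarrow> ('k, 'o) npoly \<Rightarrow> bool" where
  "complete_linearization \<Omega> n f L \<longleftrightarrow>
     (\<exists>c. (\<forall>t\<in>Poly_Mapping.keys f. \<forall>i. count_list (leaves t) i = card {j. j < n \<and> c j = i}) \<and>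
        L = polylinear_part n (subst_poly \<Omega> (\<lambda>i. \<Sum>j\<in>{j. j < n \<and> c j = i}. pvar j) f))"

end

theory Submission
  imports Defs
begin

text \<open>
  An identity of type \<open>\<Omega>\<^sup>(\<^sup>2\<^sup>)\<close> may be linearized: \<open>L(f)\<close> is an alternating sum of substitution
  instances of \<open>f\<close>, and identifying variables in \<open>L(f)\<close> gives a nonzero multiple of \<open>f\<close>. For a
  polylinear \<open>L(f)\<close> with \<open>\<zeta>(L(f)) = \<Sum>\<^sub>k f\<^sub>k \<otimes> e\<^sub>k\<close>, the value of \<open>L(f)\<close> on a \<open>di P\<close>-algebra is that of
  \<open>\<Sum>\<^sub>k \<pi>(f\<^sub>k) \<otimes> e\<^sub>k\<close>, because two morphisms out of a free operad agreeing on generators are equal.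
  So \<open>f\<close> holds on all (special) \<open>di P\<close>-algebras as soon as all \<open>f\<^sub>k\<close> hold on all (special)
  \<open>P\<close>-algebras. Conversely, a \<open>P\<close>-algebra \<open>A\<close> makes \<open>A \<oplus> A\<close> a \<open>di P\<close>-algebra, with \<open>x \<otimes> e\<^sub>k\<close> sending
  \<open>(a\<^sub>i, b\<^sub>i)\<close> to \<open>(x(a\<^sub>1, \<dots>, a\<^sub>n), x(a\<^sub>1, \<dots>, b\<^sub>k, \<dots>, a\<^sub>n))\<close>; it is special if \<open>A\<close> is, and an
  identity of \<open>A \<oplus> A\<close> forces every \<open>f\<^sub>k\<close> to be an identity of \<open>A\<close>. As \<open>'u\<close> is infinite, \<open>A \<oplus> A\<close> fits
  into \<open>'u\<close>.
\<close>

section \<open>Vector spaces\<close>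

text \<open>Everything is pulled down to vanishing in the quotient operads: with \<open>Z\<close>
  the value of \<zeta> at \<open>L\<close>, the polynomial \<open>f\<close> holds on all di-algebras
  iff every \<open>\<pi> n (Z k)\<close> is zero, and on the special ones iff every
  \<open>\<rho> n (\<omega> n (Z k))\<close> is zero; identities of \<open>P\<close>-algebras and of
  special \<open>P\<close>-algebras reduce to the same two conditions, component by component. No
  free \<open>P\<close>-algebra is built: \<open>governs\<close> defines the kernel of \<pi> by the
  identities of a variety carried by \<open>'u\<close>, so it is enough to make every algebra of
  that variety a \<open>P\<close>-algebra on the same carrier. The obstacle is to separate the
  components. A \<open>P\<close>-algebra is a di-algebra in the cheap way in which the tensor of x
  with any basis vector acts as x, but this sees only the sum of the components. The second summand
  of the doubled algebra is A as a module over itself, and e_k says which argument is taken from the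
  module.\<close>

locale vec_space =
  fixes V :: "('k::field, 'v) module"
  assumes vec_space: "vector_space_over TYPE('k) V"

sublocale vec_space \<subseteq> abelian_group V
  by (rule vector_space_overD(1)[OF vec_space])

context vec_space
begin

lemmas smult_closed [simp, intro] = vector_space_overD(2)[OF vec_space]
lemmas smult_l_distr = vector_space_overD(3)[OF vec_space]
lemmas smult_r_distr = vector_space_overD(4)[OF vec_space]
lemmas smult_assoc = vector_space_overD(5)[OF vec_space]
lemmas smult_one [simp] = vector_space_overD(6)[OF vec_space]
lemmas smult_l_null [simp] = vector_space_overD(7)[OF vec_space]

lemma smult_r_null [simp]: "c \<odot>\<^bsub>V\<^esub> \<zero>\<^bsub>V\<^esub> = \<zero>\<^bsub>V\<^esub>"
proof -
  have "c \<odot>\<^bsub>V\<^esub> (0 \<odot>\<^bsub>V\<^esub> \<zero>\<^bsub>V\<^esub>) = (c * 0) \<odot>\<^bsub>V\<^esub> \<zero>\<^bsub>V\<^esub>"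
    by (subst smult_assoc) auto
  then show ?thesis by simp
qed

lemma minus_eq_smult: "x \<in> carrier V \<Longrightarrow> \<ominus>\<^bsub>V\<^esub> x = (-1) \<odot>\<^bsub>V\<^esub> x"
proof (rule minus_equality)
  assume x: "x \<in> carrier V"
  have "(-1) \<odot>\<^bsub>V\<^esub> x \<oplus>\<^bsub>V\<^esub> x = ((-1) + 1) \<odot>\<^bsub>V\<^esub> x"
    using x by (simp only: smult_l_distr smult_one)
  then show "(-1) \<odot>\<^bsub>V\<^esub> x \<oplus>\<^bsub>V\<^esub> x = \<zero>\<^bsub>V\<^esub>" using x by simp
qed auto

lemma smult_eq_zeroD:
  assumes "c \<odot>\<^bsub>V\<^esub> x = \<zero>\<^bsub>V\<^esub>" "c \<noteq> 0" "x \<in> carrier V"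
  shows "x = \<zero>\<^bsub>V\<^esub>"
proof -
  have "x = (inverse c * c) \<odot>\<^bsub>V\<^esub> x" using assms by simp
  also have "\<dots> = \<zero>\<^bsub>V\<^esub>" using assms by (simp only: smult_assoc) simp
  finally show ?thesis .
qed

lemma linear_map_smult: "linear_map V V (\<lambda>x. c \<odot>\<^bsub>V\<^esub> x)"
  by (auto simp: linear_map_def smult_r_distr simp flip: smult_assoc) (simp add: mult.commute)

lemma finsum_all_zero: "(\<And>i. i \<in> I \<Longrightarrow> g i = \<zero>\<^bsub>V\<^esub>) \<Longrightarrow> (\<Oplus>\<^bsub>V\<^esub>i\<in>I. g i) = \<zero>\<^bsub>V\<^esub>"
  by (rule add.finprod_one_eqI)

text \<open>\<open>listset\<close> is built with \<open>set_Cons\<close>, so this is the induction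
  step that turns a sum over lists of choices into iterated sums.\<close>

lemma finsum_set_Cons:
  assumes "finite C" "finite Y" "\<And>x y. x \<in> C \<Longrightarrow> y \<in> Y \<Longrightarrow> g (x # y) \<in> carrier V"
  shows "(\<Oplus>\<^bsub>V\<^esub>z\<in>set_Cons C Y. g z) = (\<Oplus>\<^bsub>V\<^esub>x\<in>C. \<Oplus>\<^bsub>V\<^esub>y\<in>Y. g (x # y))"
  using assms(1,3)
proof (induction C)
  case empty
  then show ?case by (simp add: set_Cons_def)
next
  case (insert a C)
  have eq: "set_Cons (insert a C) Y = (#) a ` Y \<union> set_Cons C Y"
    by (auto simp: set_Cons_def)
  have fin: "finite (set_Cons C Y)"
  proof -
    have "set_Cons C Y = (\<lambda>(x, y). x # y) ` (C \<times> Y)" by (auto simp: set_Cons_def)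
    then show ?thesis using insert assms(2) by simp
  qed
  have "(\<Oplus>\<^bsub>V\<^esub>z\<in>set_Cons (insert a C) Y. g z) =
      (\<Oplus>\<^bsub>V\<^esub>z\<in>(#) a ` Y. g z) \<oplus>\<^bsub>V\<^esub> (\<Oplus>\<^bsub>V\<^esub>z\<in>set_Cons C Y. g z)"
    unfolding eq using insert fin assms(2)
    by (intro finsum_Un_disjoint) (auto simp: set_Cons_def)
  also have "(\<Oplus>\<^bsub>V\<^esub>z\<in>(#) a ` Y. g z) = (\<Oplus>\<^bsub>V\<^esub>y\<in>Y. g (a # y))"
    using insert by (intro finsum_reindex) (auto simp: inj_on_def)
  finally show ?case using insert
    by (subst finsum_insert) (auto intro!: finsum_closed)
qed

end

section \<open>Closure properties of linear maps\<close>

lemma linear_mapD: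
  assumes "linear_map V W h"
  shows "x \<in> carrier V \<Longrightarrow> h x \<in> carrier W"
    and "x \<in> carrier V \<Longrightarrow> y \<in> carrier V \<Longrightarrow> h (x \<oplus>\<^bsub>V\<^esub> y) = h x \<oplus>\<^bsub>W\<^esub> h y"
    and "x \<in> carrier V \<Longrightarrow> h (c \<odot>\<^bsub>V\<^esub> x) = c \<odot>\<^bsub>W\<^esub> h x"
  using assms by (auto simp: linear_map_def)

lemma linear_mapI:
  assumes "\<And>x. x \<in> carrier V \<Longrightarrow> h x \<in> carrier W"
    and "\<And>x y. x \<in> carrier V \<Longrightarrow> y \<in> carrier V \<Longrightarrow> h (x \<oplus>\<^bsub>V\<^esub> y) = h x \<oplus>\<^bsub>W\<^esub> h y"
    and "\<And>c x. x \<in> carrier V \<Longrightarrow> h (c \<odot>\<^bsub>V\<^esub> x) = c \<odot>\<^bsub>W\<^esub> h x"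
  shows "linear_map V W h"
  using assms by (auto simp: linear_map_def)

text \<open>\<open>h\<close> and \<open>h'\<close> are compared only on the carrier, so the source
  has to be closed under its operations before the agreement can be used at sums and
  multiples.\<close>

lemma linear_map_cong:
  assumes "linear_map V W h" "\<And>x. x \<in> carrier V \<Longrightarrow> h x = h' x" "vector_space_over TYPE('k::field) V"
  shows "linear_map V W h'"
proof -
  interpret vec_space V by (rule vec_space.intro) fact
  show ?thesis
    by (rule linear_mapI) (use assms(2) linear_mapD[OF assms(1)] in \<open>simp_all flip: assms(2)\<close>)
qed

lemma linear_map_comp:
  assumes "linear_map U V g" "linear_map V W h"
  shows "linear_map U W (\<lambda>x. h (g x))"
  by (rule linear_mapI) (simp_all add: linear_mapD[OF assms(1)] linear_mapD[OF assms(2)])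

lemma linear_map_zero:
  fixes V :: "('k::field, 'v) module"
  assumes "vector_space_over TYPE('k) V" "vector_space_over TYPE('k) W" "linear_map V W h"
  shows "h \<zero>\<^bsub>V\<^esub> = \<zero>\<^bsub>W\<^esub>"
proof -
  interpret V: vec_space V by (rule vec_space.intro) fact
  interpret W: vec_space W by (rule vec_space.intro) fact
  show ?thesis
    using linear_map_finsum[OF assms, of "{}" "\<lambda>_. \<zero>\<^bsub>V\<^esub>"] by simp
qed

lemma linear_map_add_fun:
  fixes V :: "('k::field, 'v) module"
  assumes "vector_space_over TYPE('k) W" "linear_map V W g" "linear_map V W h"
  shows "linear_map V W (\<lambda>x. g x \<oplus>\<^bsub>W\<^esub> h x)"
proof -
  interpret W: vec_space W by (rule vec_space.intro) fact
  note D = linear_mapD[OF assms(2)] linear_mapD[OF assms(3)]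
  show ?thesis
    by (rule linear_mapI) (simp_all add: D W.a_ac W.smult_r_distr)
qed

lemma linear_map_zero_fun:
  fixes V :: "('k::field, 'v) module"
  assumes "vector_space_over TYPE('k) W"
  shows "linear_map V W (\<lambda>_. \<zero>\<^bsub>W\<^esub>)"
proof -
  interpret W: vec_space W by (rule vec_space.intro) fact
  show ?thesis by (rule linear_mapI) auto
qed

lemma linear_map_smult_fun:
  fixes V :: "('k::field, 'v) module"
  assumes "vector_space_over TYPE('k) W" "linear_map V W h"
  shows "linear_map V W (\<lambda>x. c \<odot>\<^bsub>W\<^esub> h x)"
proof -
  interpret W: vec_space W by (rule vec_space.intro) fact
  show ?thesis using linear_map_comp[OF assms(2) W.linear_map_smult] .
qed

lemma linear_map_finsum_fun:
  fixes V :: "('k::field, 'v) module"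
  assumes W: "vector_space_over TYPE('k) W" and "finite I"
    and h: "\<And>i. i \<in> I \<Longrightarrow> linear_map V W (h i)" and V: "vector_space_over TYPE('k) V"
  shows "linear_map V W (\<lambda>x. \<Oplus>\<^bsub>W\<^esub>i\<in>I. h i x)"
  using \<open>finite I\<close> h
proof (induction I)
  interpret W: vec_space W by (rule vec_space.intro) fact
  {
    case empty
    then show ?case by (simp add: linear_map_zero_fun[OF W])
  next
    case (insert j J)
    have "linear_map V W (\<lambda>x. h j x \<oplus>\<^bsub>W\<^esub> (\<Oplus>\<^bsub>W\<^esub>i\<in>J. h i x))"
      using insert by (intro linear_map_add_fun[OF W]) auto
    then show ?case
    proof (rule linear_map_cong[OF _ _ V])
      fix x assume "x \<in> carrier V"
      then show "h j x \<oplus>\<^bsub>W\<^esub> (\<Oplus>\<^bsub>W\<^esub>i\<in>J. h i x) = (\<Oplus>\<^bsub>W\<^esub>i\<in>insert j J. h i x)"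
        using insert by (subst W.finsum_insert) (auto intro: linear_mapD(1))
    qed
  }
qed

section \<open>Multilinear maps\<close>

lemma tuples_update: "as \<in> tuples A n \<Longrightarrow> a \<in> carrier A \<Longrightarrow> as[i := a] \<in> tuples A n"
  by (auto simp: tuples_def dest: set_update_subset_insert[THEN subsetD])

lemma multilinearD:
  assumes "multilinear A n \<phi>" "as \<in> tuples A n"
  shows "\<phi> as \<in> carrier A" "i < n \<Longrightarrow> linear_map A A (\<lambda>a. \<phi> (as[i := a]))"
  using assms by (auto simp: multilinear_def)

lemma listset_length: "xs \<in> listset Cs \<Longrightarrow> length xs = length Cs"
  by (induction Cs arbitrary: xs) (auto simp: set_Cons_def)

lemma in_listset_iff: "xs \<in> listset Cs \<longleftrightarrow> list_all2 (\<in>) xs Cs"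
  by (induction Cs arbitrary: xs) (auto simp: set_Cons_def list_all2_Cons2)

lemma finite_listset: "(\<And>C. C \<in> set Cs \<Longrightarrow> finite C) \<Longrightarrow> finite (listset Cs)"
proof (induction Cs)
  case (Cons C Cs)
  have "listset (C # Cs) = (\<lambda>(x, y). x # y) ` (C \<times> listset Cs)" by (auto simp: set_Cons_def)
  then show ?case using Cons by simp
qed simp

text \<open>The prefix \<open>as\<close> holds arguments already reduced to a single summand. It
  makes an induction on the remaining slots possible: each step expands the first of them by
  linearity and moves the chosen summand into the prefix.\<close>

lemma multilinear_expand_aux:
  fixes A :: "('k::field, 'u) module"
  assumes A: "vector_space_over TYPE('k) A" and \<phi>: "multilinear A n \<phi>"
    and "set as \<subseteq> carrier A" "length as + length Cgs = n"
    and "\<And>C g. (C, g) \<in> set Cgs \<Longrightarrow> finite C \<and> g \<in> C \<rightarrow> carrier A"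
  shows "\<phi> (as @ map (\<lambda>(C, g). \<Oplus>\<^bsub>A\<^esub>x\<in>C. g x) Cgs) =
    (\<Oplus>\<^bsub>A\<^esub>xs\<in>listset (map fst Cgs). \<phi> (as @ map2 (\<lambda>Cg x. snd Cg x) Cgs xs))"
  using assms(3-)
proof (induction Cgs arbitrary: as)
  interpret A: vec_space A by (rule vec_space.intro) fact
  {
    case Nil
    then have "\<phi> as \<in> carrier A" using multilinearD(1)[OF \<phi>, of as] by (simp add: tuples_def)
    then show ?case using A.finsum_singleton[of "[]" "{[]}" "\<lambda>_. \<phi> as"] by simp
  next
    case (Cons Cg Cgs)
    obtain C g where [simp]: "Cg = (C, g)" by (cases Cg)
    have C: "finite C" "g \<in> C \<rightarrow> carrier A" using Cons.prems(3) by auto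
    have sum_closed: "(\<Oplus>\<^bsub>A\<^esub>x\<in>Y. h x) \<in> carrier A" if "(Y, h) \<in> set (Cg # Cgs)" for Y h
      using Cons.prems(3)[OF that] by (auto intro!: A.finsum_closed)
    let ?rest = "map (\<lambda>(C, g). \<Oplus>\<^bsub>A\<^esub>x\<in>C. g x) Cgs"
    have rest: "set ?rest \<subseteq> carrier A"
      using sum_closed by fastforce
    \<comment> \<open>\<open>multilinear\<close> speaks of overwriting an entry of a tuple, so the
      slot is filled with zero for the moment.\<close>
    have upd: "(as @ \<zero>\<^bsub>A\<^esub> # ?rest)[length as := a] = as @ a # ?rest" for a
      by simp
    have lin: "linear_map A A (\<lambda>a. \<phi> (as @ a # ?rest))"
      using multilinearD(2)[OF \<phi>, of "as @ \<zero>\<^bsub>A\<^esub> # ?rest" "length as"] Cons.prems rest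
      by (simp add: tuples_def upd)
    have in_tuples: "as @ g x # map2 (\<lambda>Cg x. snd Cg x) Cgs xs \<in> tuples A n"
      if "x \<in> C" "xs \<in> listset (map fst Cgs)" for x xs
    proof -
      have "length xs = length Cgs" using listset_length[OF that(2)] by simp
      moreover have "snd Cg' x' \<in> carrier A" if "(Cg', x') \<in> set (zip Cgs xs)" for Cg' x'
      proof -
        have "x' \<in> fst Cg'" using that \<open>xs \<in> _\<close>
          by (auto simp: in_listset_iff list_all2_conv_all_nth set_zip)
        moreover have "Cg' \<in> set Cgs" using that by (auto dest: set_zip_leftD)
        ultimately show ?thesis using Cons.prems(3)[of "fst Cg'" "snd Cg'"] by auto
      qed
      ultimately show ?thesis using C that Cons.prems(1,2) by (auto simp: tuples_def)
    qed
    have fin: "finite (listset (map fst Cgs))"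
      using Cons.prems(3) by (intro finite_listset) fastforce
    have "\<phi> (as @ map (\<lambda>(C, g). \<Oplus>\<^bsub>A\<^esub>x\<in>C. g x) (Cg # Cgs)) =
        (\<Oplus>\<^bsub>A\<^esub>x\<in>C. \<phi> (as @ g x # ?rest))"
      using linear_map_finsum[OF A A lin C] by simp
    also have "\<dots> = (\<Oplus>\<^bsub>A\<^esub>x\<in>C. \<Oplus>\<^bsub>A\<^esub>xs\<in>listset (map fst Cgs).
        \<phi> (as @ g x # map2 (\<lambda>Cg x. snd Cg x) Cgs xs))"
    proof (rule A.finsum_cong')
      fix x assume x: "x \<in> C"
      have "\<phi> ((as @ [g x]) @ ?rest) = (\<Oplus>\<^bsub>A\<^esub>xs\<in>listset (map fst Cgs).
          \<phi> ((as @ [g x]) @ map2 (\<lambda>Cg x. snd Cg x) Cgs xs))"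
        using Cons.prems C x by (intro Cons.IH) auto
      then show "\<phi> (as @ g x # ?rest) = (\<Oplus>\<^bsub>A\<^esub>xs\<in>listset (map fst Cgs).
          \<phi> (as @ g x # map2 (\<lambda>Cg x. snd Cg x) Cgs xs))" by simp
    qed (use in_tuples multilinearD(1)[OF \<phi>] in \<open>auto intro!: A.finsum_closed\<close>)
    also have "\<dots> = (\<Oplus>\<^bsub>A\<^esub>xs\<in>listset (map fst (Cg # Cgs)).
        \<phi> (as @ map2 (\<lambda>Cg x. snd Cg x) (Cg # Cgs) xs))"
      using in_tuples multilinearD(1)[OF \<phi>] C fin
      by (simp add: A.finsum_set_Cons)
    finally show ?case .
  }
qed

lemma multilinear_expand:
  fixes A :: "('k::field, 'u) module"
  assumes A: "vector_space_over TYPE('k) A" and \<phi>: "multilinear A n \<phi>"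
    and C: "\<And>i. i < n \<Longrightarrow> finite (C i)" "\<And>i x. i < n \<Longrightarrow> x \<in> C i \<Longrightarrow> g i x \<in> carrier A"
  shows "\<phi> (map (\<lambda>i. \<Oplus>\<^bsub>A\<^esub>x\<in>C i. g i x) [0..<n]) =
    (\<Oplus>\<^bsub>A\<^esub>xs\<in>listset (map C [0..<n]). \<phi> (map (\<lambda>i. g i (xs ! i)) [0..<n]))"
proof -
  interpret A: vec_space A by (rule vec_space.intro) fact
  let ?L = "map (\<lambda>i. (C i, g i)) [0..<n]"
  have "map2 (\<lambda>Cg x. snd Cg x) ?L xs = map (\<lambda>i. g i (xs ! i)) [0..<n]" if "length xs = n" for xs
    using that by (auto intro!: nth_equalityI)
  moreover have "map (\<lambda>i. g i (xs ! i)) [0..<n] \<in> tuples A n"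
    if "xs \<in> listset (map C [0..<n])" for xs
    using that C by (auto simp: tuples_def in_listset_iff list_all2_conv_all_nth)
  ultimately have "(\<Oplus>\<^bsub>A\<^esub>xs\<in>listset (map C [0..<n]). \<phi> (map2 (\<lambda>Cg x. snd Cg x) ?L xs)) =
      (\<Oplus>\<^bsub>A\<^esub>xs\<in>listset (map C [0..<n]). \<phi> (map (\<lambda>i. g i (xs ! i)) [0..<n]))"
    using multilinearD(1)[OF \<phi>] by (intro A.finsum_cong') (auto dest!: listset_length)
  moreover have "finite C' \<and> g' \<in> C' \<rightarrow> carrier A" if "(C', g') \<in> set ?L" for C' g'
    using that C by auto
  ultimately show ?thesis
    using multilinear_expand_aux[OF A \<phi>, of "[]" ?L] by (simp add: comp_def)
qed

lemma multilinear_scale: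
  assumes \<phi>: "multilinear A n \<phi>" and "vector_space_over TYPE('k::field) (A :: ('k, 'u) module)"
    and "\<And>i. i < n \<Longrightarrow> x i \<in> carrier A"
  shows "\<phi> (map (\<lambda>i. c i \<odot>\<^bsub>A\<^esub> x i) [0..<n]) = (\<Prod>i<n. c i) \<odot>\<^bsub>A\<^esub> \<phi> (map x [0..<n])"
proof -
  interpret A: vec_space A by (rule vec_space.intro) fact
  \<comment> \<open>Only the first \<open>m\<close> arguments are scaled, which lets the scalars be
    pulled out one at a time by induction on \<open>m\<close>.\<close>
  have "\<phi> (map (\<lambda>i. if i < m then c i \<odot>\<^bsub>A\<^esub> x i else x i) [0..<n]) =
      (\<Prod>i<m. c i) \<odot>\<^bsub>A\<^esub> \<phi> (map x [0..<n])" if "m \<le> n" for m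
    using that
  proof (induction m)
    case 0
    have "map x [0..<n] \<in> tuples A n" using assms(3) by (auto simp: tuples_def)
    from multilinearD(1)[OF \<phi> this] show ?case by simp
  next
    case (Suc m)
    let ?as = "map (\<lambda>i. if i < m then c i \<odot>\<^bsub>A\<^esub> x i else x i) [0..<n]"
    have as: "?as \<in> tuples A n" using assms(3) by (auto simp: tuples_def)
    have 1: "map (\<lambda>i. if i < Suc m then c i \<odot>\<^bsub>A\<^esub> x i else x i) [0..<n] = ?as[m := c m \<odot>\<^bsub>A\<^esub> x m]"
      and 2: "?as[m := x m] = ?as"
      using Suc.prems by (auto intro!: nth_equalityI simp: nth_list_update less_Suc_eq)
    have "\<phi> (?as[m := c m \<odot>\<^bsub>A\<^esub> x m]) = c m \<odot>\<^bsub>A\<^esub> \<phi> (?as[m := x m])"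
      using linear_mapD(3)[OF multilinearD(2)[OF \<phi> as]] Suc.prems assms(3) by auto
    moreover have "map x [0..<n] \<in> tuples A n" using assms(3) by (auto simp: tuples_def)
    ultimately show ?case unfolding 1 2 using Suc multilinearD(1)[OF \<phi>]
      by (simp add: A.smult_assoc[symmetric] mult.commute)
  qed
  moreover have "map (\<lambda>i. if i < n then c i \<odot>\<^bsub>A\<^esub> x i else x i) [0..<n] = map (\<lambda>i. c i \<odot>\<^bsub>A\<^esub> x i) [0..<n]"
    by simp
  ultimately show ?thesis by (metis order_refl)
qed

section \<open>Spaces of polynomials\<close>

abbreviation keys :: "('a \<Rightarrow>\<^sub>0 'b::zero) \<Rightarrow> 'a set" where
  "keys \<equiv> Poly_Mapping.keys"

abbreviation lookup :: "('a \<Rightarrow>\<^sub>0 'b::zero) \<Rightarrow> 'a \<Rightarrow> 'b" where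
  "lookup \<equiv> Poly_Mapping.lookup"

abbreviation single :: "'a \<Rightarrow> 'b \<Rightarrow> 'a \<Rightarrow>\<^sub>0 'b::zero" where
  "single \<equiv> Poly_Mapping.single"

text \<open>One family covers the free algebra, with \<open>T\<close> all terms, and the components
  of the free operad, with \<open>T\<close> the polylinear terms of a given degree; linear maps then
  restrict from the former to the latter.\<close>

definition poly_module :: "'a set \<Rightarrow> ('k::field, 'a \<Rightarrow>\<^sub>0 'k) module" where
  "poly_module T = mk_module {p. keys p \<subseteq> T} 0 (+) (\<lambda>c. Poly_Mapping.map ((*) c))"

lemma poly_module_simps [simp]:
  "p \<in> carrier (poly_module T) \<longleftrightarrow> keys p \<subseteq> T"
  "zero (poly_module T) = 0" "add (poly_module T) = (+)"
  "module.smult (poly_module T) = (\<lambda>c. Poly_Mapping.map ((*) c))"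
  by (simp_all add: poly_module_def)

lemma lookup_map_times [simp]:
  fixes c :: "'k::field"
  shows "lookup (Poly_Mapping.map ((*) c) p) t = c * lookup p t"
  by (simp add: map.rep_eq when_def)

lemma map_times_single [simp]:
  fixes c :: "'k::field"
  shows "Poly_Mapping.map ((*) c) (single t d) = single t (c * d)"
  by (rule poly_mapping_eqI) (simp add: lookup_single when_def)

lemma map_times_one [simp]: "Poly_Mapping.map ((*) (1::'k::field)) p = p"
  by (rule poly_mapping_eqI) simp

lemma keys_map_times: "keys (Poly_Mapping.map ((*) (c::'k::field)) p) \<subseteq> keys p"
  by (auto simp: in_keys_iff)

lemma vector_space_poly_module: "vector_space_over TYPE('k::field) (poly_module T :: ('k, 'a \<Rightarrow>\<^sub>0 'k) module)"
proof (rule vector_space_overI)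
  show "abelian_group (poly_module T :: ('k, 'a \<Rightarrow>\<^sub>0 'k) module)"
  proof (rule abelian_groupI)
    fix p :: "'a \<Rightarrow>\<^sub>0 'k" assume "p \<in> carrier (poly_module T)"
    then show "\<exists>q\<in>carrier (poly_module T). q \<oplus>\<^bsub>poly_module T\<^esub> p = \<zero>\<^bsub>poly_module T\<^esub>"
      by (intro bexI[of _ "- p"]) auto
  qed (auto simp: algebra_simps dest: keys_add[THEN subsetD])
qed (auto simp: algebra_simps lookup_add dest!: keys_map_times[THEN subsetD] intro!: poly_mapping_eqI)

lemma finsum_poly_module:
  assumes "\<And>i. i \<in> I \<Longrightarrow> keys (g i) \<subseteq> T" "finite I"
  shows "(\<Oplus>\<^bsub>poly_module T\<^esub>i\<in>I. g i) = (\<Sum>i\<in>I. g i :: 'a \<Rightarrow>\<^sub>0 'k::field)"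
proof -
  interpret P: vec_space "poly_module T :: ('k, 'a \<Rightarrow>\<^sub>0 'k) module"
    by (rule vec_space.intro[OF vector_space_poly_module])
  show ?thesis
    using assms(2,1)
  proof (induction I)
    case (insert i I)
    then show ?case by (subst P.finsum_insert) auto
  qed simp
qed

lemma poly_mapping_expansion: "p = (\<Sum>t\<in>keys p. single t (lookup p t))"
  by (rule poly_mapping_eqI) (simp add: lookup_sum lookup_single when_def in_keys_iff sum.delta')

lemma linear_map_sum:
  assumes W: "vector_space_over TYPE('k::field) W" and h: "linear_map (poly_module T) W h"
    and "finite I" "\<And>i. i \<in> I \<Longrightarrow> keys (g i) \<subseteq> T"
  shows "h (\<Sum>i\<in>I. g i) = (\<Oplus>\<^bsub>W\<^esub>i\<in>I. h (g i))"
  using linear_map_finsum[OF vector_space_poly_module W h, of I g] finsum_poly_module[of I g T] assms(3,4)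
  by (simp add: Pi_def)

lemma linear_map_poly_subset:
  fixes h :: "('a \<Rightarrow>\<^sub>0 'k::field) \<Rightarrow> 'w"
  assumes "linear_map (poly_module T) W h" "T' \<subseteq> T"
  shows "linear_map (poly_module T') W h"
proof (rule linear_mapI)
  note h = linear_mapD[OF assms(1)]
  fix x :: "'a \<Rightarrow>\<^sub>0 'k" and c assume "x \<in> carrier (poly_module T')"
  then have x: "x \<in> carrier (poly_module T)" using assms(2) by auto
  show "h x \<in> carrier W" using h(1)[OF x] .
  show "h (c \<odot>\<^bsub>poly_module T'\<^esub> x) = c \<odot>\<^bsub>W\<^esub> h x" using h(3)[OF x, of c] by simp
  fix y :: "'a \<Rightarrow>\<^sub>0 'k" assume "y \<in> carrier (poly_module T')"
  then have y: "y \<in> carrier (poly_module T)" using assms(2) by auto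
  show "h (x \<oplus>\<^bsub>poly_module T'\<^esub> y) = h x \<oplus>\<^bsub>W\<^esub> h y" using h(2)[OF x y] by simp
qed

text \<open>The monomials \<open>single t 1\<close> with \<open>t\<close> in \<open>T\<close> form a
  basis of \<open>poly_module T\<close>.\<close>

lemma linear_map_poly_eqI:
  assumes W: "vector_space_over TYPE('k::field) W"
    and h: "linear_map (poly_module T) W h" and h': "linear_map (poly_module T) W h'"
    and eq: "\<And>t. t \<in> T \<Longrightarrow> h (single t 1) = h' (single t (1::'k))"
    and p: "keys p \<subseteq> T"
  shows "h p = h' p"
proof -
  interpret W: vec_space W by (rule vec_space.intro) fact
  have *: "g p = (\<Oplus>\<^bsub>W\<^esub>t\<in>keys p. lookup p t \<odot>\<^bsub>W\<^esub> g (single t 1))"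
    if g: "linear_map (poly_module T) W g" for g
  proof -
    have "g p = g (\<Sum>t\<in>keys p. single t (lookup p t))"
      by (subst poly_mapping_expansion) simp
    also have "\<dots> = (\<Oplus>\<^bsub>W\<^esub>t\<in>keys p. g (single t (lookup p t)))"
      by (rule linear_map_sum[OF W g]) (use p in auto)
    also have "\<dots> = (\<Oplus>\<^bsub>W\<^esub>t\<in>keys p. lookup p t \<odot>\<^bsub>W\<^esub> g (single t 1))"
    proof (rule W.finsum_cong')
      fix t assume t: "t \<in> keys p"
      then have "single t 1 \<in> carrier (poly_module T)" using p by auto
      from linear_mapD(3)[OF g this, of "lookup p t"]
      show "g (single t (lookup p t)) = lookup p t \<odot>\<^bsub>W\<^esub> g (single t 1)"
        by simp
    qed (use p linear_mapD(1)[OF g] in auto)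
    finally show ?thesis .
  qed
  have "(\<Oplus>\<^bsub>W\<^esub>t\<in>keys p. lookup p t \<odot>\<^bsub>W\<^esub> h (single t 1)) =
    (\<Oplus>\<^bsub>W\<^esub>t\<in>keys p. lookup p t \<odot>\<^bsub>W\<^esub> h' (single t 1))"
    using p eq linear_mapD(1)[OF h'] by (intro W.finsum_cong') auto
  then show ?thesis using *[OF h] *[OF h'] by simp
qed

lemma free_module_eq: "free_module \<Omega> = poly_module (terms \<Omega>)"
  by (simp add: free_module_def poly_module_def)

abbreviation polylinear_terms :: "'o language \<Rightarrow> nat \<Rightarrow> 'o tm set" where
  "polylinear_terms \<Omega> n \<equiv> {t \<in> terms \<Omega>. polylinear_term n t}"

lemma ospace_free_operad: "ospace (free_operad \<Omega>) n = poly_module (polylinear_terms \<Omega> n)"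
  by (auto simp: free_operad_def free_module_def poly_module_def mk_module_def)

section \<open>Evaluation of polynomials\<close>

lemma terms_Op_iff: "Op s ts \<in> terms \<Omega> \<longleftrightarrow> s \<in> symb \<Omega> \<and> length ts = ar \<Omega> s \<and> (\<forall>t\<in>set ts. t \<in> terms \<Omega>)"
  by (auto intro: terms.Op elim: terms.cases)

lemma terms_Var [simp]: "Var i \<in> terms \<Omega>"
  by (rule terms.Var)

lemma term_eval_cong: "(\<And>i. i \<in> set (leaves t) \<Longrightarrow> v i = w i) \<Longrightarrow> term_eval ops v t = term_eval ops w t"
proof (induction t)
  case (Op s ts)
  then have "map (term_eval ops v) ts = map (term_eval ops w) ts" by auto
  then show ?case by (simp only: term_eval.simps)
qed simp

locale algebra_of =
  fixes \<Omega> :: "'o language" and A :: "('k::field, 'u) module" and ops :: "'o \<Rightarrow> 'u list \<Rightarrow> 'u"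
  assumes algebra_of: "algebra_of_type \<Omega> (A, ops)"

sublocale algebra_of \<subseteq> vec_space A
  by (rule vec_space.intro) (use algebra_of in \<open>auto simp: algebra_of_type_def\<close>)

context algebra_of
begin

lemma multilinear_ops: "s \<in> symb \<Omega> \<Longrightarrow> multilinear A (ar \<Omega> s) (ops s)"
  using algebra_of by (auto simp: algebra_of_type_def)

lemma ops_closed: "s \<in> symb \<Omega> \<Longrightarrow> length as = ar \<Omega> s \<Longrightarrow> set as \<subseteq> carrier A \<Longrightarrow> ops s as \<in> carrier A"
  using multilinearD(1)[OF multilinear_ops] by (auto simp: tuples_def)

lemma term_eval_closed: "t \<in> terms \<Omega> \<Longrightarrow> (\<And>i. v i \<in> carrier A) \<Longrightarrow> term_eval ops v t \<in> carrier A"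
  by (induction rule: terms.induct) (auto intro!: ops_closed)

text \<open>The index set \<open>keys p\<close> depends on \<open>p\<close>. Comparing values at
  \<open>p\<close>, \<open>q\<close> and \<open>p + q\<close> needs one finite index set for all
  three, the extra terms having coefficient zero.\<close>

lemma poly_eval_superset:
  assumes "keys p \<subseteq> T" "finite T" "T \<subseteq> terms \<Omega>" "\<And>i. v i \<in> carrier A"
  shows "poly_eval (A, ops) v p = (\<Oplus>\<^bsub>A\<^esub>t\<in>T. lookup p t \<odot>\<^bsub>A\<^esub> term_eval ops v t)"
  unfolding poly_eval_def prod.case using assms
  by (intro add.finprod_mono_neutral_cong_left)
    (auto simp: in_keys_iff intro!: term_eval_closed smult_l_null)

lemma linear_poly_eval:
  assumes v: "\<And>i. v i \<in> carrier A"
  shows "linear_map (poly_module (terms \<Omega>)) A (poly_eval (A, ops) v)"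
proof (rule linear_mapI)
  fix p :: "('k, 'o) npoly" assume p: "p \<in> carrier (poly_module (terms \<Omega>))"
  show "poly_eval (A, ops) v p \<in> carrier A"
    unfolding poly_eval_def prod.case using p v by (auto intro!: finsum_closed term_eval_closed)
  show "poly_eval (A, ops) v (c \<odot>\<^bsub>poly_module (terms \<Omega>)\<^esub> p) = c \<odot>\<^bsub>A\<^esub> poly_eval (A, ops) v p" for c
  proof -
    have "poly_eval (A, ops) v (c \<odot>\<^bsub>poly_module (terms \<Omega>)\<^esub> p) =
      (\<Oplus>\<^bsub>A\<^esub>t\<in>keys p. c \<odot>\<^bsub>A\<^esub> (lookup p t \<odot>\<^bsub>A\<^esub> term_eval ops v t))"
      using p v keys_map_times[of c p]
      by (subst poly_eval_superset[of _ "keys p"])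
        (auto intro!: finsum_cong' term_eval_closed smult_assoc)
    also have "\<dots> = c \<odot>\<^bsub>A\<^esub> poly_eval (A, ops) v p"
      unfolding poly_eval_def prod.case using p v
      by (intro linear_map_finsum[OF vec_space vec_space linear_map_smult, symmetric])
        (auto intro!: term_eval_closed)
    finally show ?thesis .
  qed
  fix q :: "('k, 'o) npoly" assume q: "q \<in> carrier (poly_module (terms \<Omega>))"
  let ?T = "keys p \<union> keys q"
  have "poly_eval (A, ops) v (p + q) = (\<Oplus>\<^bsub>A\<^esub>t\<in>?T. lookup p t \<odot>\<^bsub>A\<^esub> term_eval ops v t
       \<oplus>\<^bsub>A\<^esub> lookup q t \<odot>\<^bsub>A\<^esub> term_eval ops v t)"
    using p q v keys_add[of p q]
    by (subst poly_eval_superset[of _ ?T])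
      (auto simp: lookup_add intro!: finsum_cong' term_eval_closed smult_l_distr add.m_closed smult_closed)
  also have "\<dots> = (\<Oplus>\<^bsub>A\<^esub>t\<in>?T. lookup p t \<odot>\<^bsub>A\<^esub> term_eval ops v t)
       \<oplus>\<^bsub>A\<^esub> (\<Oplus>\<^bsub>A\<^esub>t\<in>?T. lookup q t \<odot>\<^bsub>A\<^esub> term_eval ops v t)"
    using p q v by (intro finsum_addf) (auto intro!: term_eval_closed)
  also have "\<dots> = poly_eval (A, ops) v p \<oplus>\<^bsub>A\<^esub> poly_eval (A, ops) v q"
    using p q v by (subst (1 2) poly_eval_superset[of _ ?T]) auto
  finally show "poly_eval (A, ops) v (p \<oplus>\<^bsub>poly_module (terms \<Omega>)\<^esub> q) =
      poly_eval (A, ops) v p \<oplus>\<^bsub>A\<^esub> poly_eval (A, ops) v q" by simp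
qed

text \<open>Only \<open>w\<close> has to take values in the carrier: \<open>v\<close> may be
  arbitrary at variables that do not occur in \<open>p\<close>. This is what handles substitutions
  that are specified on finitely many variables only.\<close>

lemma poly_eval_cong:
  assumes "keys p \<subseteq> terms \<Omega>" "\<And>i. w i \<in> carrier A"
    and eq: "\<And>t i. t \<in> keys p \<Longrightarrow> i \<in> set (leaves t) \<Longrightarrow> v i = w i"
  shows "poly_eval (A, ops) v p = poly_eval (A, ops) w p"
proof -
  have "term_eval ops v t = term_eval ops w t" if "t \<in> keys p" for t
    using eq[OF that] by (rule term_eval_cong)
  then show ?thesis
    unfolding poly_eval_def prod.case using assms(1,2)
    by (intro finsum_cong') (auto intro!: term_eval_closed)
qed

lemma poly_eval_closed:
  "keys p \<subseteq> terms \<Omega> \<Longrightarrow> (\<And>i. v i \<in> carrier A) \<Longrightarrow> poly_eval (A, ops) v p \<in> carrier A"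
  using linear_mapD(1)[OF linear_poly_eval, of v p] by simp

lemma poly_eval_single:
  assumes "t \<in> terms \<Omega>" "\<And>i. v i \<in> carrier A"
  shows "poly_eval (A, ops) v (single t c) = c \<odot>\<^bsub>A\<^esub> term_eval ops v t"
proof -
  have "term_eval ops v t \<in> carrier A" using assms by (rule term_eval_closed)
  then show ?thesis
    using assms finsum_singleton[of t "{t}" "\<lambda>t. c \<odot>\<^bsub>A\<^esub> term_eval ops v t"]
    by (subst poly_eval_superset[of _ "{t}"]) (auto simp: Pi_def)
qed

lemma poly_eval_sum:
  assumes "finite I" "\<And>i. i \<in> I \<Longrightarrow> keys (g i) \<subseteq> terms \<Omega>" "\<And>i. v i \<in> carrier A"
  shows "poly_eval (A, ops) v (\<Sum>i\<in>I. g i) = (\<Oplus>\<^bsub>A\<^esub>i\<in>I. poly_eval (A, ops) v (g i))"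
  by (rule linear_map_sum[OF vec_space linear_poly_eval]) (use assms in auto)

text \<open>Evaluation is a homomorphism out of the free algebra. Multilinearity of
  \<open>ops s\<close> spreads the value over tuples of monomials, one from each
  \<open>ps ! i\<close>, and \<open>free_op\<close> is defined by the same sum.\<close>

lemma poly_eval_free_op:
  assumes s: "s \<in> symb \<Omega>" "length ps = ar \<Omega> s"
    and ps: "\<And>p. p \<in> set ps \<Longrightarrow> keys p \<subseteq> terms \<Omega>" and v: "\<And>i. v i \<in> carrier A"
  shows "poly_eval (A, ops) v (free_op s ps) = ops s (map (poly_eval (A, ops) v) ps)"
proof -
  let ?n = "ar \<Omega> s"
  let ?K = "listset (map keys ps)"
  let ?c = "\<lambda>ts i. lookup (ps ! i) (ts ! i)"
  have map_ps: "map f ps = map (\<lambda>i. f (ps ! i)) [0..<?n]" for f :: "('k, 'o) npoly \<Rightarrow> 'b"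
    using s(2) by (auto intro!: nth_equalityI)
  have fin: "finite ?K" by (rule finite_listset) auto
  have K: "length ts = ?n" "i < ?n \<Longrightarrow> ts ! i \<in> terms \<Omega>" if "ts \<in> ?K" for ts i
  proof -
    show "length ts = ?n" using listset_length[OF that] s(2) by simp
    show "ts ! i \<in> terms \<Omega>" if "i < ?n"
      using \<open>ts \<in> ?K\<close> ps[of "ps ! i"] that s(2) by (auto simp: in_listset_iff list_all2_conv_all_nth)
  qed
  have tm: "Op s ts \<in> terms \<Omega>" if "ts \<in> ?K" for ts
    using K[OF that] s(1) by (auto simp: terms_Op_iff in_set_conv_nth)
  have "ops s (map (poly_eval (A, ops) v) ps) =
      ops s (map (\<lambda>i. \<Oplus>\<^bsub>A\<^esub>t\<in>keys (ps ! i). lookup (ps ! i) t \<odot>\<^bsub>A\<^esub> term_eval ops v t) [0..<?n])"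
    by (simp only: map_ps poly_eval_def prod.case)
  also have "\<dots> = (\<Oplus>\<^bsub>A\<^esub>ts\<in>listset (map (\<lambda>i. keys (ps ! i)) [0..<?n]).
      ops s (map (\<lambda>i. ?c ts i \<odot>\<^bsub>A\<^esub> term_eval ops v (ts ! i)) [0..<?n]))"
    using ps s v
    by (intro multilinear_expand[OF vec_space multilinear_ops]) (auto intro!: term_eval_closed smult_closed subsetD[OF ps])
  also have "\<dots> = (\<Oplus>\<^bsub>A\<^esub>ts\<in>?K. (\<Prod>i<?n. ?c ts i) \<odot>\<^bsub>A\<^esub> term_eval ops v (Op s ts))"
  proof (rule finsum_cong')
    fix ts assume ts: "ts \<in> ?K"
    have "ops s (map (\<lambda>i. ?c ts i \<odot>\<^bsub>A\<^esub> term_eval ops v (ts ! i)) [0..<?n]) =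
        (\<Prod>i<?n. ?c ts i) \<odot>\<^bsub>A\<^esub> ops s (map (\<lambda>i. term_eval ops v (ts ! i)) [0..<?n])"
      using K[OF ts] s v by (intro multilinear_scale[OF multilinear_ops vec_space]) (auto intro!: term_eval_closed)
    also have "map (\<lambda>i. term_eval ops v (ts ! i)) [0..<?n] = map (term_eval ops v) ts"
      using K(1)[OF ts] by (auto intro!: nth_equalityI)
    finally show "ops s (map (\<lambda>i. ?c ts i \<odot>\<^bsub>A\<^esub> term_eval ops v (ts ! i)) [0..<?n]) =
       (\<Prod>i<?n. ?c ts i) \<odot>\<^bsub>A\<^esub> term_eval ops v (Op s ts)" by simp
  next
    show "listset (map (\<lambda>i. keys (ps ! i)) [0..<?n]) = ?K"
      by (simp only: map_ps)
  qed (use tm v in \<open>auto simp del: term_eval.simps intro!: smult_closed term_eval_closed\<close>)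
  also have "\<dots> = (\<Oplus>\<^bsub>A\<^esub>ts\<in>?K. poly_eval (A, ops) v (single (Op s ts) (\<Prod>i<?n. ?c ts i)))"
    using tm v by (intro finsum_cong')
      (auto simp: poly_eval_single simp del: term_eval.simps intro!: smult_closed term_eval_closed)
  also have "\<dots> = poly_eval (A, ops) v (free_op s ps)"
    unfolding free_op_def s(2) using fin tm v by (subst poly_eval_sum) auto
  finally show ?thesis ..
qed

end

text \<open>A tree determines its subtrees, so at most one tuple of monomials contributes to a given
  term and no cancellation occurs. If that tuple leaves the supports, the product has a zero factor,
  which is why membership in \<open>listset\<close> disappears from the formula.\<close>

lemma lookup_free_op:
  "lookup (free_op s ps) (Op s' ts) =
    (if s' = s \<and> length ts = length ps then \<Prod>i<length ps. lookup (ps ! i) (ts ! i) else 0)"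
  "lookup (free_op s ps) (Var j) = 0"
proof -
  let ?K = "listset (map keys ps)"
  let ?c = "\<lambda>ts. \<Prod>i<length ps. lookup (ps ! i) (ts ! i)"
  have fin: "finite ?K" by (rule finite_listset) auto
  have "lookup (free_op s ps) (Op s' ts) = (\<Sum>us\<in>?K. ?c us when Op s us = Op s' ts)"
    by (simp add: free_op_def lookup_sum lookup_single)
  also have "\<dots> = (if s' = s \<and> ts \<in> ?K then ?c ts else 0)"
  proof (cases "s' = s")
    case True
    then show ?thesis using fin by (simp add: when_def sum.delta')
  qed (auto simp: when_def)
  also have "\<dots> = (if s' = s \<and> length ts = length ps then ?c ts else 0)"
    using listset_length[of ts "map keys ps"]
    by (auto simp: in_listset_iff list_all2_conv_all_nth in_keys_iff)
  finally show "lookup (free_op s ps) (Op s' ts) =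
    (if s' = s \<and> length ts = length ps then ?c ts else 0)" .
  show "lookup (free_op s ps) (Var j) = 0"
    by (simp add: free_op_def lookup_sum lookup_single)
qed

lemma keys_free_op_iff:
  "t \<in> keys (free_op s ps) \<longleftrightarrow>
     (\<exists>ts. t = Op s ts \<and> list_all2 (\<lambda>t p. t \<in> keys p) ts ps)"
  by (cases t) (auto simp: in_keys_iff lookup_free_op list_all2_conv_all_nth)

lemma algebra_of_type_free_alg:
  fixes \<Omega> :: "'o language"
  shows "algebra_of_type \<Omega> (free_alg \<Omega> :: ('k::field, 'o, ('k, 'o) npoly) alg)"
  unfolding free_alg_def algebra_of_type_def prod.case free_module_eq
proof (intro conjI ballI vector_space_poly_module)
  fix s assume s: "s \<in> symb \<Omega>"
  let ?F = "poly_module (terms \<Omega>) :: ('k, ('k, 'o) npoly) module"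
  show "multilinear ?F (ar \<Omega> s) (free_op s)"
    unfolding multilinear_def
  proof (intro conjI ballI allI impI)
    have closed: "free_op s ps \<in> carrier ?F" if "ps \<in> tuples ?F (ar \<Omega> s)" for ps
    proof -
      have "ts ! i \<in> terms \<Omega>" if "list_all2 (\<lambda>t p. t \<in> keys p) ts ps" "i < length ts" for ts i
      proof -
        have "ps ! i \<in> set ps" "ts ! i \<in> keys (ps ! i)"
          using that by (auto simp: list_all2_conv_all_nth)
        then show ?thesis using \<open>ps \<in> _\<close> by (force simp: tuples_def)
      qed
      moreover have "length ts = ar \<Omega> s" if "list_all2 (\<lambda>t p. t \<in> keys p) ts ps" for ts
        using list_all2_lengthD[OF that] \<open>ps \<in> _\<close> by (simp add: tuples_def)
      ultimately show ?thesis using that s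
        by (auto simp: keys_free_op_iff terms_Op_iff in_set_conv_nth)
    qed
    then show "free_op s ps \<in> carrier ?F" if "ps \<in> tuples ?F (ar \<Omega> s)" for ps using that .
    fix ps i assume ps: "ps \<in> tuples ?F (ar \<Omega> s)" and i: "i < ar \<Omega> s"
    have len: "length ps = ar \<Omega> s" using ps by (simp add: tuples_def)
    have split: "(\<Prod>j<length ps. lookup (ps[i := p] ! j) (ts ! j)) =
        lookup p (ts ! i) * (\<Prod>j\<in>{..<length ps} - {i}. lookup (ps ! j) (ts ! j))" for p ts
      using i len by (subst prod.remove[of _ i]) auto
    show "linear_map ?F ?F (\<lambda>p. free_op s (ps[i := p]))"
    proof (rule linear_mapI)
      show "free_op s (ps[i := p]) \<in> carrier ?F" if "p \<in> carrier ?F" for p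
        using tuples_update[OF ps that] by (rule closed)
      show "free_op s (ps[i := p \<oplus>\<^bsub>?F\<^esub> q]) = free_op s (ps[i := p]) \<oplus>\<^bsub>?F\<^esub> free_op s (ps[i := q])" for p q
      proof (rule poly_mapping_eqI)
        show "lookup (free_op s (ps[i := p \<oplus>\<^bsub>?F\<^esub> q])) t =
          lookup (free_op s (ps[i := p]) \<oplus>\<^bsub>?F\<^esub> free_op s (ps[i := q])) t" for t
          by (cases t) (simp_all add: lookup_free_op lookup_add split ring_distribs)
      qed
      show "free_op s (ps[i := c \<odot>\<^bsub>?F\<^esub> p]) = c \<odot>\<^bsub>?F\<^esub> free_op s (ps[i := p])" for c p
      proof (rule poly_mapping_eqI)
        show "lookup (free_op s (ps[i := c \<odot>\<^bsub>?F\<^esub> p])) t =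
          lookup (c \<odot>\<^bsub>?F\<^esub> free_op s (ps[i := p])) t" for t
          by (cases t) (simp_all add: lookup_free_op split)
      qed
    qed
  qed
qed

lemma algebra_of_free: "algebra_of \<Omega> (poly_module (terms \<Omega>)) free_op"
  using algebra_of_type_free_alg[of \<Omega>] by (simp add: algebra_of_def free_alg_def free_module_eq)

lemma free_alg_eq: "free_alg \<Omega> = (poly_module (terms \<Omega>), free_op)"
  by (simp add: free_alg_def free_module_eq)

text \<open>Evaluation in the free algebra is substitution, so all facts on \<open>poly_eval\<close>
  hold for \<open>subst_poly\<close>. The rewrite folds the pair back into \<open>free_alg\<close>,
  the form in which \<open>subst_poly\<close> is written.\<close>

interpretation free: algebra_of \<Omega> "poly_module (terms \<Omega>)" free_op
  rewrites "(poly_module (terms \<Omega>), free_op) = free_alg \<Omega>"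
  for \<Omega>
  by (rule algebra_of_free) (simp add: free_alg_eq)

lemma keys_pvar [simp]: "keys (pvar i) = {Var i}"
  by (simp add: pvar_def)

lemma free_op_single:
  fixes ts :: "'o tm list"
  shows "free_op s (map (\<lambda>t. single t 1) ts) = single (Op s ts) (1::'k::field)"
proof (rule poly_mapping_eqI)
  have "(\<Prod>i<length ts. lookup (single (ts ! i) 1) (us ! i)) = (if ts = us then 1 else (0::'k))"
    if "length us = length ts" for us
    using that by (auto simp: lookup_single when_def list_eq_iff_nth_eq)
  then show "lookup (free_op s (map (\<lambda>t. single t 1) ts)) t =
      lookup (single (Op s ts) 1) t" for t
    by (cases t) (auto simp: lookup_free_op lookup_single when_def list_eq_iff_nth_eq)
qed

context algebra_of
begin

lemma poly_eval_term_eval: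
  assumes "t \<in> terms \<Omega>" "\<And>i. keys (w i) \<subseteq> terms \<Omega>" "\<And>i. v i \<in> carrier A"
  shows "poly_eval (A, ops) v (term_eval free_op w t) = term_eval ops (\<lambda>i. poly_eval (A, ops) v (w i)) t"
  using assms(1)
proof (induction rule: terms.induct)
  case (Op s ts)
  have "keys (term_eval free_op w t) \<subseteq> terms \<Omega>" if "t \<in> set ts" for t
    using free.term_eval_closed[of t \<Omega> w] Op that assms(2) by auto
  then have "poly_eval (A, ops) v (term_eval free_op w (Op s ts)) =
      ops s (map (poly_eval (A, ops) v) (map (term_eval free_op w) ts))"
    using Op assms(3) by (subst term_eval.simps, intro poly_eval_free_op) auto
  also have "map (poly_eval (A, ops) v) (map (term_eval free_op w) ts) =
      map (term_eval ops (\<lambda>i. poly_eval (A, ops) v (w i))) ts"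
    using Op by simp
  finally show ?case by simp
qed simp

text \<open>Both sides are linear in \<open>p\<close>, so monomials suffice, and there it is the
  homomorphism property of evaluation. Compositions and actions in the free operad, as well as the
  identification of variables, are evaluated with it.\<close>

lemma poly_eval_subst:
  assumes p: "keys p \<subseteq> terms \<Omega>"
    and w: "\<And>i. keys (w i) \<subseteq> terms \<Omega>" and v: "\<And>i. v i \<in> carrier A"
  shows "poly_eval (A, ops) v (subst_poly \<Omega> w p) = poly_eval (A, ops) (\<lambda>i. poly_eval (A, ops) v (w i)) p"
proof -
  have lin1: "linear_map (poly_module (terms \<Omega>)) A (\<lambda>p. poly_eval (A, ops) v (subst_poly \<Omega> w p))"
    using w v by (intro linear_map_comp[OF free.linear_poly_eval linear_poly_eval]) auto
  have lin2: "linear_map (poly_module (terms \<Omega>)) A (poly_eval (A, ops) (\<lambda>i. poly_eval (A, ops) v (w i)))"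
    using w v by (intro linear_poly_eval poly_eval_closed)
  show ?thesis
  proof (rule linear_map_poly_eqI[OF vec_space lin1 lin2 _ p])
    fix t assume t: "t \<in> terms \<Omega>"
    have "term_eval ops (\<lambda>i. poly_eval (A, ops) v (w i)) t \<in> carrier A"
      using t w v by (intro term_eval_closed poly_eval_closed)
    then show "poly_eval (A, ops) v (subst_poly \<Omega> w (single t 1)) =
        poly_eval (A, ops) (\<lambda>i. poly_eval (A, ops) v (w i)) (single t 1)"
      using t w v by (simp add: free.poly_eval_single poly_eval_single poly_eval_closed poly_eval_term_eval)
  qed
qed

end

section \<open>Endomorphism operads\<close>

lemma endo_simps [simp]:
  "\<phi> \<in> ocarrier (endo A) n \<longleftrightarrow> \<phi> \<in> extensional (tuples A n) \<and> multilinear A n \<phi>"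
  "zero (ospace (endo A) n) = (\<lambda>as\<in>tuples A n. \<zero>\<^bsub>A\<^esub>)"
  "add (ospace (endo A) n) = (\<lambda>\<phi> \<psi>. \<lambda>as\<in>tuples A n. \<phi> as \<oplus>\<^bsub>A\<^esub> \<psi> as)"
  "module.smult (ospace (endo A) n) = (\<lambda>c \<phi>. \<lambda>as\<in>tuples A n. c \<odot>\<^bsub>A\<^esub> \<phi> as)"
  "ocomp (endo A) ms \<phi> \<psi>s = (\<lambda>as\<in>tuples A (sum_list ms).
        \<phi> (map (\<lambda>i. (\<psi>s ! i) (take (ms ! i) (drop (offset ms i) as))) [0..<length ms]))"
  "oid (endo A) = (\<lambda>as\<in>tuples A 1. hd as)"
  "oact (endo A) n \<sigma> \<phi> = (\<lambda>as\<in>tuples A n. \<phi> (map (\<lambda>i. as ! \<sigma> i) [0..<n]))"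
  by (auto simp: endo_def)

lemma multilinearI:
  assumes "\<And>as. as \<in> tuples A n \<Longrightarrow> \<phi> as \<in> carrier A"
    and "\<And>as i. as \<in> tuples A n \<Longrightarrow> i < n \<Longrightarrow> linear_map A A (\<lambda>a. \<phi> (as[i := a]))"
  shows "multilinear A n \<phi>"
  using assms by (auto simp: multilinear_def)

lemma multilinear_restrict:
  assumes "vector_space_over TYPE('k::field) (A :: ('k, 'u) module)"
    and \<phi>: "multilinear A n \<phi>" and eq: "\<And>as. as \<in> tuples A n \<Longrightarrow> \<phi> as = \<psi> as"
  shows "multilinear A n \<psi>"
proof (rule multilinearI)
  show "\<psi> as \<in> carrier A" if "as \<in> tuples A n" for as
    using multilinearD(1)[OF \<phi> that] eq[OF that] by simp
  show "linear_map A A (\<lambda>a. \<psi> (as[i := a]))" if "as \<in> tuples A n" "i < n" for as i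
    using multilinearD(2)[OF \<phi> that]
    by (rule linear_map_cong) (use that eq assms(1) in \<open>auto intro!: tuples_update\<close>)
qed

lemma multilinear_add:
  assumes A: "vector_space_over TYPE('k::field) (A :: ('k, 'u) module)"
    and \<phi>: "multilinear A n \<phi>" and \<psi>: "multilinear A n \<psi>"
  shows "multilinear A n (\<lambda>as. \<phi> as \<oplus>\<^bsub>A\<^esub> \<psi> as)"
proof -
  interpret vec_space A by (rule vec_space.intro) fact
  show ?thesis
    by (rule multilinearI) (auto intro!: linear_map_add_fun[OF A] multilinearD[OF \<phi>] multilinearD[OF \<psi>])
qed

lemma multilinear_smult:
  assumes A: "vector_space_over TYPE('k::field) (A :: ('k, 'u) module)" and \<phi>: "multilinear A n \<phi>"
  shows "multilinear A n (\<lambda>as. c \<odot>\<^bsub>A\<^esub> \<phi> as)"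
proof -
  interpret vec_space A by (rule vec_space.intro) fact
  show ?thesis
    by (rule multilinearI) (auto intro!: linear_map_smult_fun[OF A] multilinearD[OF \<phi>])
qed

lemma vector_space_endo:
  assumes A: "vector_space_over TYPE('k::field) (A :: ('k, 'u) module)"
  shows "vector_space_over TYPE('k) (ospace (endo A) n)"
proof -
  interpret vec_space A by (rule vec_space.intro) fact
  have zero: "multilinear A n (\<lambda>as. \<zero>\<^bsub>A\<^esub>)"
    by (rule multilinearI) (auto intro: linear_map_zero_fun[OF A])
  have add: "(\<lambda>as\<in>tuples A n. \<phi> as \<oplus>\<^bsub>A\<^esub> \<psi> as) \<in> ocarrier (endo A) n"
    if "\<phi> \<in> ocarrier (endo A) n" "\<psi> \<in> ocarrier (endo A) n" for \<phi> \<psi>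
    using multilinear_restrict[OF A multilinear_add[OF A, of n \<phi> \<psi>]] that by simp
  have smult: "(\<lambda>as\<in>tuples A n. c \<odot>\<^bsub>A\<^esub> \<phi> as) \<in> ocarrier (endo A) n"
    if "\<phi> \<in> ocarrier (endo A) n" for c \<phi>
    using multilinear_restrict[OF A multilinear_smult[OF A, of n \<phi>]] that by simp
  have zero: "(\<lambda>as\<in>tuples A n. \<zero>\<^bsub>A\<^esub>) \<in> ocarrier (endo A) n"
    using multilinear_restrict[OF A zero] by simp
  have c: "\<phi> as \<in> carrier A" if "\<phi> \<in> ocarrier (endo A) n" "as \<in> tuples A n" for \<phi> as
    using that by (auto intro: multilinearD(1))
  have eqI: "\<phi> = \<psi>" if "\<phi> \<in> ocarrier (endo A) n" "\<psi> \<in> ocarrier (endo A) n"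
    "\<And>as. as \<in> tuples A n \<Longrightarrow> \<phi> as = \<psi> as" for \<phi> \<psi>
    using that by (auto intro: extensionalityI)
  show ?thesis
  proof (rule vector_space_overI)
    show "abelian_group (ospace (endo A) n)"
    proof (rule abelian_groupI; unfold endo_simps(2-4))
      fix \<phi> assume \<phi>: "\<phi> \<in> ocarrier (endo A) n"
      show "(\<lambda>as\<in>tuples A n. (\<lambda>as\<in>tuples A n. \<zero>\<^bsub>A\<^esub>) as \<oplus>\<^bsub>A\<^esub> \<phi> as) = \<phi>"
        by (rule eqI) (simp_all only: add zero \<phi>, simp add: c[OF \<phi>])
      show "\<exists>\<psi>\<in>ocarrier (endo A) n. (\<lambda>as\<in>tuples A n. \<psi> as \<oplus>\<^bsub>A\<^esub> \<phi> as) = (\<lambda>as\<in>tuples A n. \<zero>\<^bsub>A\<^esub>)"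
      proof (rule bexI[OF _ smult[OF \<phi>, of "-1"]], rule restrict_ext)
        fix as assume as: "as \<in> tuples A n"
        show "(\<lambda>as\<in>tuples A n. (-1) \<odot>\<^bsub>A\<^esub> \<phi> as) as \<oplus>\<^bsub>A\<^esub> \<phi> as = \<zero>\<^bsub>A\<^esub>"
          using as c[OF \<phi> as] l_neg[of "\<phi> as"] by (simp add: minus_eq_smult)
      qed
      fix \<psi> assume \<psi>: "\<psi> \<in> ocarrier (endo A) n"
      show "(\<lambda>as\<in>tuples A n. \<phi> as \<oplus>\<^bsub>A\<^esub> \<psi> as) = (\<lambda>as\<in>tuples A n. \<psi> as \<oplus>\<^bsub>A\<^esub> \<phi> as)"
        using c[OF \<phi>] c[OF \<psi>] by (intro restrict_ext) (rule a_comm)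
      fix \<chi> assume \<chi>: "\<chi> \<in> ocarrier (endo A) n"
      show "(\<lambda>as\<in>tuples A n. (\<lambda>as\<in>tuples A n. \<phi> as \<oplus>\<^bsub>A\<^esub> \<psi> as) as \<oplus>\<^bsub>A\<^esub> \<chi> as) =
          (\<lambda>as\<in>tuples A n. \<phi> as \<oplus>\<^bsub>A\<^esub> (\<lambda>as\<in>tuples A n. \<psi> as \<oplus>\<^bsub>A\<^esub> \<chi> as) as)"
        using c[OF \<phi>] c[OF \<psi>] c[OF \<chi>] by (intro restrict_ext) (simp add: a_assoc)
    qed (fact add zero)+
    fix c d \<phi> assume \<phi>: "\<phi> \<in> ocarrier (endo A) n"
    show "c \<odot>\<^bsub>ospace (endo A) n\<^esub> \<phi> \<in> ocarrier (endo A) n"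
      unfolding endo_simps(2-4) by (fact smult[OF \<phi>])
    show "1 \<odot>\<^bsub>ospace (endo A) n\<^esub> \<phi> = \<phi>" unfolding endo_simps(2-4)
      by (rule eqI) (simp_all only: smult \<phi>, simp add: c[OF \<phi>])
    show "(c * d) \<odot>\<^bsub>ospace (endo A) n\<^esub> \<phi> = c \<odot>\<^bsub>ospace (endo A) n\<^esub> (d \<odot>\<^bsub>ospace (endo A) n\<^esub> \<phi>)"
      using c[OF \<phi>] by (auto simp: smult_assoc intro!: restrict_ext)
    show "(c + d) \<odot>\<^bsub>ospace (endo A) n\<^esub> \<phi> = c \<odot>\<^bsub>ospace (endo A) n\<^esub> \<phi> \<oplus>\<^bsub>ospace (endo A) n\<^esub> d \<odot>\<^bsub>ospace (endo A) n\<^esub> \<phi>"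
      using c[OF \<phi>] by (auto simp: smult_l_distr intro!: restrict_ext)
    fix \<psi> assume \<psi>: "\<psi> \<in> ocarrier (endo A) n"
    show "c \<odot>\<^bsub>ospace (endo A) n\<^esub> (\<phi> \<oplus>\<^bsub>ospace (endo A) n\<^esub> \<psi>) =
        c \<odot>\<^bsub>ospace (endo A) n\<^esub> \<phi> \<oplus>\<^bsub>ospace (endo A) n\<^esub> c \<odot>\<^bsub>ospace (endo A) n\<^esub> \<psi>"
      using c[OF \<phi>] c[OF \<psi>] by (auto simp: smult_r_distr intro!: restrict_ext)
  qed
qed

lemma linear_map_endo_apply:
  "as \<in> tuples A n \<Longrightarrow> linear_map (ospace (endo A) n) A (\<lambda>\<phi>. \<phi> as)"
  by (rule linear_mapI) (auto simp: multilinearD(1))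


lemma linear_map_endoI:
  assumes h: "\<And>x. x \<in> carrier V \<Longrightarrow> h x \<in> ocarrier (endo A) n"
    and lin: "\<And>as. as \<in> tuples A n \<Longrightarrow> linear_map V A (\<lambda>x. h x as)"
    and V: "vector_space_over TYPE('k::field) V" and A: "vector_space_over TYPE('k) A"
  shows "linear_map V (ospace (endo A) n) h"
proof -
  interpret V: vec_space V by (rule vec_space.intro) fact
  interpret E: vec_space "ospace (endo A) n" by (rule vec_space.intro[OF vector_space_endo[OF A]])
  have eqI: "\<phi> = \<psi>" if "\<phi> \<in> ocarrier (endo A) n" "\<psi> \<in> ocarrier (endo A) n"
    "\<And>as. as \<in> tuples A n \<Longrightarrow> \<phi> as = \<psi> as" for \<phi> \<psi>
    using that by (auto intro: extensionalityI)
  show ?thesis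
  proof (rule linear_mapI)
    fix x c assume x: "x \<in> carrier V"
    show "h x \<in> ocarrier (endo A) n" by (rule h[OF x])
    show "h (c \<odot>\<^bsub>V\<^esub> x) = c \<odot>\<^bsub>ospace (endo A) n\<^esub> h x"
      by (rule eqI[OF h[OF V.smult_closed[OF x]] E.smult_closed[OF h[OF x]]])
        (simp add: linear_mapD(3)[OF lin x])
    fix y assume y: "y \<in> carrier V"
    show "h (x \<oplus>\<^bsub>V\<^esub> y) = h x \<oplus>\<^bsub>ospace (endo A) n\<^esub> h y"
      by (rule eqI[OF h[OF V.add.m_closed[OF x y]] E.add.m_closed[OF h[OF x] h[OF y]]])
        (simp add: linear_mapD(2)[OF lin x y])
  qed
qed

section \<open>Terms and relabelling\<close>

fun relabel :: "(nat \<Rightarrow> nat) \<Rightarrow> 'o tm \<Rightarrow> 'o tm" where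
  "relabel g (Var i) = Var (g i)"
| "relabel g (Op s ts) = Op s (map (relabel g) ts)"

lemma leaves_relabel [simp]: "leaves (relabel g t) = map g (leaves t)"
proof (induction t)
  case (Op s ts)
  then have eq: "map (leaves \<circ> relabel g) ts = map (map g \<circ> leaves) ts" by auto
  show ?case by (simp only: leaves.simps relabel.simps map_map map_concat eq)
qed simp

lemma relabel_relabel: "relabel g (relabel g' t) = relabel (g \<circ> g') t"
  by (induction t) auto

lemma relabel_cong: "(\<And>i. i \<in> set (leaves t) \<Longrightarrow> g i = g' i) \<Longrightarrow> relabel g t = relabel g' t"
  by (induction t) auto

lemma relabel_ident: "(\<And>i. i \<in> set (leaves t) \<Longrightarrow> g i = i) \<Longrightarrow> relabel g t = t"
  by (induction t) (auto intro!: map_idI)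

lemma relabel_in_terms [simp]: "relabel g t \<in> terms \<Omega> \<longleftrightarrow> t \<in> terms \<Omega>"
  by (induction t) (auto simp: terms_Op_iff)

lemma term_eval_free_relabel:
  "term_eval free_op (\<lambda>i. pvar (g i)) t = single (relabel g t) (1::'k::field)"
proof (induction t)
  case (Op s ts)
  then have "map (term_eval free_op (\<lambda>i. pvar (g i))) ts =
      map (\<lambda>t. single t (1::'k)) (map (relabel g) ts)" by auto
  then show ?case by (simp only: term_eval.simps relabel.simps free_op_single)
qed (simp add: pvar_def)

lemma subst_poly_single:
  assumes "t \<in> terms \<Omega>" "\<And>i. keys (w i) \<subseteq> terms \<Omega>"
  shows "subst_poly \<Omega> w (single t (1::'k::field)) = term_eval free_op w t"
  using free.poly_eval_single[OF assms(1), of w 1] assms(2) by simp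

lemma relabel_single:
  assumes "t \<in> terms \<Omega>"
  shows "subst_poly \<Omega> (\<lambda>i. pvar (g i)) (single t (1::'k::field)) = single (relabel g t) 1"
  using assms by (simp add: subst_poly_single term_eval_free_relabel)

lemma mset_eq_mset_set_iff:
  assumes "finite S"
  shows "mset xs = mset_set S \<longleftrightarrow> distinct xs \<and> set xs = S"
proof
  assume *: "mset xs = mset_set S"
  have "distinct xs"
    unfolding distinct_count_atmost_1 * using assms
    by (metis * count_mset_set(1,3) finite_set_mset_mset_set set_mset_mset)
  moreover have "set xs = S" using * assms by (metis finite_set_mset_mset_set set_mset_mset)
  ultimately show "distinct xs \<and> set xs = S" ..
qed (auto simp: mset_set_set)

text \<open>The multiset of leaves is additive under grafting of trees, unlike the pair of
  conditions in the definition; in this form polylinearity of a composite becomes a count.\<close>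

lemma polylinear_term_iff: "polylinear_term n t \<longleftrightarrow> mset (leaves t) = mset_set {..<n}"
  by (simp add: polylinear_term_def mset_eq_mset_set_iff)

text \<open>If all monomials of \<open>w i\<close> use the same multiset \<open>M i\<close> of
  variables, it does not matter which of them is grafted at a leaf labelled
  \<open>i\<close>.\<close>

lemma mset_leaves_term_eval:
  assumes "\<And>i u. i \<in> set (leaves t) \<Longrightarrow> u \<in> keys (w i) \<Longrightarrow> mset (leaves u) = M i"
    and "u \<in> keys (term_eval free_op w t)"
  shows "mset (leaves u) = (\<Sum>i\<leftarrow>leaves t. M i)"
  using assms
proof (induction t arbitrary: u)
  case (Op s ts)
  obtain us where u: "u = Op s us"
    and us: "list_all2 (\<lambda>u p. u \<in> keys p) us (map (term_eval free_op w) ts)"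
    using Op.prems(2) by (auto simp: keys_free_op_iff)
  have "map (\<lambda>u. mset (leaves u)) us = map (\<lambda>t. \<Sum>i\<leftarrow>leaves t. M i) ts"
  proof (rule nth_equalityI)
    fix j assume "j < length (map (\<lambda>u. mset (leaves u)) us)"
    then have j: "j < length us" "j < length ts" using us by (auto dest: list_all2_lengthD)
    then have *: "us ! j \<in> keys (term_eval free_op w (ts ! j))" "ts ! j \<in> set ts"
      using us by (auto simp: list_all2_conv_all_nth)
    have "mset (leaves (us ! j)) = (\<Sum>i\<leftarrow>leaves (ts ! j). M i)"
      by (rule Op.IH[OF *(2) _ *(1)]) (use *(2) in \<open>auto intro!: Op.prems(1)\<close>)
    then show "map (\<lambda>u. mset (leaves u)) us ! j = map (\<lambda>t. \<Sum>i\<leftarrow>leaves t. M i) ts ! j"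
      using j by simp
  qed (use us in \<open>auto dest: list_all2_lengthD\<close>)
  moreover have "mset (concat (map leaves us)) = sum_list (map (\<lambda>u. mset (leaves u)) us)"
    by (induction us) auto
  moreover have "(\<Sum>i\<leftarrow>concat (map leaves ts). M i) = sum_list (map (\<lambda>t. \<Sum>i\<leftarrow>leaves t. M i) ts)"
    by (induction ts) auto
  ultimately show ?case by (simp add: u)
qed simp

lemma subst_poly_eq_sum:
  assumes p: "keys p \<subseteq> terms \<Omega>" and w: "\<And>i. keys (w i) \<subseteq> terms \<Omega>"
  shows "subst_poly \<Omega> w p = (\<Sum>t\<in>keys p.
      Poly_Mapping.map ((*) (lookup p t)) (term_eval free_op w t))"
proof -
  have c: "keys (term_eval free_op w t) \<subseteq> terms \<Omega>" if "t \<in> keys p" for t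
    using free.term_eval_closed[of t \<Omega> w] that p w by auto
  show ?thesis
    unfolding free_alg_eq poly_eval_def prod.case poly_module_simps
    by (rule finsum_poly_module[OF subset_trans[OF keys_map_times c] finite_keys])
qed

lemma keys_subst_poly:
  assumes p: "keys p \<subseteq> terms \<Omega>" and w: "\<And>i. keys (w i) \<subseteq> terms \<Omega>"
    and u: "u \<in> keys (subst_poly \<Omega> w p)"
  obtains t where "t \<in> keys p" "u \<in> keys (term_eval free_op w t)"
    "u \<in> terms \<Omega>"
proof -
  have c: "keys (term_eval free_op w t) \<subseteq> terms \<Omega>" if "t \<in> keys p" for t
    using free.term_eval_closed[of t \<Omega> w] that p w by auto
  note subst_poly_eq_sum[OF p w]
  with u have "u \<in> keys (\<Sum>t\<in>keys p.
      Poly_Mapping.map ((*) (lookup p t)) (term_eval free_op w t))" by (simp only:)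
  then have "u \<in> (\<Union>t\<in>keys p.
      keys (Poly_Mapping.map ((*) (lookup p t)) (term_eval free_op w t)))"
    by (rule subsetD[OF keys_sum])
  then obtain t where t: "t \<in> keys p"
      "u \<in> keys (Poly_Mapping.map ((*) (lookup p t)) (term_eval free_op w t))"
    by (rule UN_E)
  have "u \<in> keys (term_eval free_op w t)"
    by (rule subsetD[OF keys_map_times t(2)])
  with t(1) show thesis using subsetD[OF c[OF t(1)]] by (intro that)
qed

section \<open>Consecutive blocks of positions\<close>

lemma offset_Suc: "i < length ms \<Longrightarrow> offset ms (Suc i) = offset ms i + ms ! i"
  by (simp add: offset_def take_Suc_conv_app_nth)

lemma offset_le: "i < length ms \<Longrightarrow> offset ms i + ms ! i \<le> sum_list ms"
  using offset_Suc[of i ms] by (metis append_take_drop_id le_add1 offset_def sum_list_append)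

lemma offset_length: "offset ms (length ms) = sum_list ms"
  by (simp add: offset_def)

lemma sum_blocks:
  "k \<le> length ms \<Longrightarrow> (\<Sum>i<k. mset_set {offset ms i..<offset ms i + ms ! i}) = mset_set {..<offset ms k}"
proof (induction k)
  case 0
  then show ?case by (simp add: offset_def)
next
  case (Suc k)
  have "{..<offset ms (Suc k)} = {..<offset ms k} \<union> {offset ms k..<offset ms k + ms ! k}"
    using Suc.prems by (auto simp: offset_Suc)
  moreover have "mset_set ({..<offset ms k} \<union> {offset ms k..<offset ms k + ms ! k}) =
      mset_set {..<offset ms k} + mset_set {offset ms k..<offset ms k + ms ! k}"
    by (rule mset_set_Union) auto
  ultimately show ?case using Suc by (simp add: add.commute)
qed

section \<open>The free operad\<close>

lemma free_operad_simps:
  "ocomp (free_operad \<Omega>) ms f gs =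
     subst_poly \<Omega> (\<lambda>i. subst_poly \<Omega> (\<lambda>j. pvar (offset ms i + j)) (gs ! i)) f"
  "oid (free_operad \<Omega>) = pvar 0"
  "oact (free_operad \<Omega>) n \<sigma> f = subst_poly \<Omega> (\<lambda>i. pvar (\<sigma> i)) f"
  by (simp_all add: free_operad_def)

lemma ocarrier_free_iff:
  "p \<in> ocarrier (free_operad \<Omega>) n \<longleftrightarrow>
     keys p \<subseteq> terms \<Omega> \<and> (\<forall>t\<in>keys p. polylinear_term n t)"
  by (auto simp: ospace_free_operad)

text \<open>Only the closure properties are recorded, which is all that factorisation through a
  quotient needs from the operads involved.\<close>

locale operad_closed =
  fixes P :: "('k::field, 'p) operad"
  assumes ospace_vec: "1 \<le> n \<Longrightarrow> vector_space_over TYPE('k) (ospace P n)"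
    and oid_closed': "oid P \<in> ocarrier P 1"
    and ocomp_closed: "\<lbrakk>valid_arities ms; f \<in> ocarrier P (length ms); gs \<in> oargs P ms\<rbrakk> \<Longrightarrow>
      ocomp P ms f gs \<in> ocarrier P (sum_list ms)"
    and oact_closed: "\<lbrakk>1 \<le> n; \<sigma> permutes {..<n}; f \<in> ocarrier P n\<rbrakk> \<Longrightarrow> oact P n \<sigma> f \<in> ocarrier P n"

lemma (in operad) operad_closed: "operad_closed P"
  by (rule operad_closed.intro)
    (auto intro: ospace oid_closed[unfolded One_nat_def] linear_mapD(1)[OF ocomp_linear] linear_mapD(1)[OF oact_linear])

lemma oargs_iff: "gs \<in> oargs P ms \<longleftrightarrow> length gs = length ms \<and> (\<forall>i<length ms. gs ! i \<in> ocarrier P (ms ! i))"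
  by (auto simp: oargs_def list_all2_conv_all_nth)

text \<open>Off the range \<open>{..<length ms}\<close> the substitution defining \<open>ocomp\<close> involves the
  unspecified entries of \<open>gs\<close>; it may be replaced by any proper substitution.\<close>

lemma ocomp_free_eq:
  fixes \<Omega> :: "'o language" and f :: "('k::field, 'o) npoly"
  assumes f: "f \<in> ocarrier (free_operad \<Omega>) (length ms)" and gs: "gs \<in> oargs (free_operad \<Omega>) ms"
  defines "w \<equiv> \<lambda>i. if i < length ms then subst_poly \<Omega> (\<lambda>j. pvar (offset ms i + j)) (gs ! i) else 0"
  shows "ocomp (free_operad \<Omega>) ms f gs = subst_poly \<Omega> w f"
    and "\<And>i. keys (w i) \<subseteq> terms \<Omega>"
proof -
  show w: "keys (w i) \<subseteq> terms \<Omega>" for i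
    using free.poly_eval_closed[of "gs ! i" \<Omega> "\<lambda>j. pvar (offset ms i + j)"] gs
    by (auto simp: w_def oargs_iff ocarrier_free_iff)
  show "ocomp (free_operad \<Omega>) ms f gs = subst_poly \<Omega> w f"
    unfolding free_operad_simps using f w
    by (intro free.poly_eval_cong) (auto simp: ocarrier_free_iff polylinear_term_def w_def)
qed

lemma oact_free_closed:
  fixes \<Omega> :: "'o language" and f :: "('k::field, 'o) npoly"
  assumes f: "f \<in> ocarrier (free_operad \<Omega>) n" and \<sigma>: "\<sigma> permutes {..<n}"
  shows "oact (free_operad \<Omega>) n \<sigma> f \<in> ocarrier (free_operad \<Omega>) n"
  unfolding ocarrier_free_iff free_operad_simps
proof (intro conjI ballI subsetI)
  fix u assume "u \<in> keys (subst_poly \<Omega> (\<lambda>i. pvar (\<sigma> i)) f)"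
  then obtain t where t: "t \<in> keys f" "u \<in> keys (term_eval free_op (\<lambda>i. pvar (\<sigma> i) :: ('k, 'o) npoly) t)"
    and u: "u \<in> terms \<Omega>"
    by (rule keys_subst_poly[rotated 2]) (use f in \<open>auto simp: ocarrier_free_iff\<close>)
  show "u \<in> terms \<Omega>" by fact
  have [simp]: "u = relabel \<sigma> t" using t(2) by (simp add: term_eval_free_relabel)
  have "mset (leaves u) = image_mset \<sigma> (mset_set {..<n})"
    using f t(1) by (auto simp: ocarrier_free_iff polylinear_term_iff)
  also have "\<dots> = mset_set {..<n}"
    using \<sigma> by (simp add: image_mset_mset_set permutes_inj_on permutes_image)
  finally show "polylinear_term n u" by (simp add: polylinear_term_iff)
qed

text \<open>The shift sends the \<open>i\<close>-th argument to exactly the variables of the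
  \<open>i\<close>-th block, and every \<open>i\<close> is a leaf of each term of \<open>f\<close>
  exactly once, so the blocks tile \<open>{..<sum_list ms}\<close>.\<close>

lemma ocomp_free_closed:
  fixes \<Omega> :: "'o language" and f :: "('k::field, 'o) npoly"
  assumes f: "f \<in> ocarrier (free_operad \<Omega>) (length ms)" and gs: "gs \<in> oargs (free_operad \<Omega>) ms"
  shows "ocomp (free_operad \<Omega>) ms f gs \<in> ocarrier (free_operad \<Omega>) (sum_list ms)"
  unfolding ocarrier_free_iff
proof (intro conjI ballI subsetI)
  define w where "w = (\<lambda>i. if i < length ms then subst_poly \<Omega> (\<lambda>j. pvar (offset ms i + j)) (gs ! i) else 0)"
  have w: "ocomp (free_operad \<Omega>) ms f gs = subst_poly \<Omega> w f"
      "keys (w i) \<subseteq> terms \<Omega>" for i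
    using ocomp_free_eq[OF f gs] by (simp_all only: w_def)
  let ?M = "\<lambda>i. mset_set {offset ms i..<offset ms i + ms ! i}"
  have M: "mset (leaves u) = ?M i" if i: "i < length ms" and u: "u \<in> keys (w i)" for i u
  proof -
    have g: "gs ! i \<in> ocarrier (free_operad \<Omega>) (ms ! i)" using gs i by (simp add: oargs_iff)
    have "u \<in> keys (subst_poly \<Omega> (\<lambda>j. pvar (offset ms i + j)) (gs ! i))"
      using u i by (simp add: w_def)
    then obtain t where t: "t \<in> keys (gs ! i)"
        "u \<in> keys (term_eval free_op (\<lambda>j. pvar (offset ms i + j) :: ('k, 'o) npoly) t)"
      by (rule keys_subst_poly[rotated 2]) (use g in \<open>auto simp: ocarrier_free_iff\<close>)
    then have "u = relabel (\<lambda>j. offset ms i + j) t" by (simp add: term_eval_free_relabel)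
    then have "mset (leaves u) = image_mset (\<lambda>j. offset ms i + j) (mset_set {..<ms ! i})"
      using g t(1) by (auto simp: ocarrier_free_iff polylinear_term_iff)
    also have "\<dots> = mset_set ((\<lambda>j. offset ms i + j) ` {..<ms ! i})"
      by (rule image_mset_mset_set) auto
    also have "(\<lambda>j. offset ms i + j) ` {..<ms ! i} = {offset ms i..<offset ms i + ms ! i}"
      using image_add_atLeastLessThan[of "offset ms i" 0 "ms ! i"] by (simp add: atLeast0LessThan add.commute)
    finally show ?thesis .
  qed
  fix u assume "u \<in> keys (ocomp (free_operad \<Omega>) ms f gs)"
  then have "u \<in> keys (subst_poly \<Omega> w f)" using w(1) by simp
  then obtain t where t: "t \<in> keys f" "u \<in> keys (term_eval free_op w t)"
    and u: "u \<in> terms \<Omega>"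
    by (rule keys_subst_poly[rotated 2]) (use f w(2) in \<open>auto simp: ocarrier_free_iff\<close>)
  show "u \<in> terms \<Omega>" by fact
  have tl: "mset (leaves t) = mset_set {..<length ms}"
    using f t(1) by (auto simp: ocarrier_free_iff polylinear_term_iff)
  then have "set (leaves t) = {..<length ms}" by (simp add: mset_eq_mset_set_iff)
  then have "mset (leaves u) = (\<Sum>i\<leftarrow>leaves t. ?M i)"
    using M t(2) by (intro mset_leaves_term_eval[of t w ?M]) auto
  also have "\<dots> = sum_mset (image_mset ?M (mset (leaves t)))"
    by (simp flip: sum_mset_sum_list)
  also have "\<dots> = (\<Sum>i<length ms. ?M i)" by (simp add: tl sum_unfold_sum_mset)
  also have "\<dots> = mset_set {..<sum_list ms}" by (simp add: sum_blocks offset_length)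
  finally show "polylinear_term (sum_list ms) u" by (simp add: polylinear_term_iff)
qed

lemma operad_closed_free: "operad_closed (free_operad \<Omega>)"
proof (rule operad_closed.intro)
  show "oid (free_operad \<Omega>) \<in> ocarrier (free_operad \<Omega> :: ('a, ('a, 'b) npoly) operad) 1"
    by (auto simp: ocarrier_free_iff free_operad_simps polylinear_term_def)
  show "vector_space_over TYPE('a) (ospace (free_operad \<Omega>) n)" for n
    by (simp add: ospace_free_operad vector_space_poly_module)
qed (auto intro: oact_free_closed ocomp_free_closed)

section \<open>Evaluation as a morphism of operads\<close>

text \<open>Valuations are defined on all variables, elements of the endomorphism operad on lists of
  length \<open>n\<close>. The default is zero so that the valuation stays in the carrier;
  polylinear polynomials of degree \<open>n\<close> never read it.\<close>

definition pad :: "('k, 'u) module \<Rightarrow> 'u list \<Rightarrow> nat \<Rightarrow> 'u" where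
  "pad A as i = (if i < length as then as ! i else \<zero>\<^bsub>A\<^esub>)"

definition eval_hom :: "('k::field, 'o, 'u) alg \<Rightarrow> nat \<Rightarrow> ('k, 'o) npoly \<Rightarrow> 'u list \<Rightarrow> 'u" where
  "eval_hom = (\<lambda>(A, ops) n p. \<lambda>as\<in>tuples A n. poly_eval (A, ops) (pad A as) p)"

lemma take_drop_block:
  "as \<in> tuples A (sum_list ms) \<Longrightarrow> i < length ms \<Longrightarrow>
    take (ms ! i) (drop (offset ms i) as) \<in> tuples A (ms ! i)"
  using offset_le[of i ms] by (auto simp: tuples_def dest!: in_set_takeD in_set_dropD)

lemma distinct_concat_disjoint:
  assumes "distinct (concat xss)" "j < length xss" "k < length xss" "j \<noteq> k"
  shows "set (xss ! j) \<inter> set (xss ! k) = {}"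
proof -
  have *: "set (xss ! j) \<inter> set (xss ! k) = {}" if "j < k" "k < length xss" for j k
  proof -
    have "concat xss = concat (take k xss) @ concat (drop k xss)"
      by (metis append_take_drop_id concat_append)
    then have "set (concat (take k xss)) \<inter> set (concat (drop k xss)) = {}"
      using assms(1) by (metis distinct_append)
    moreover have "xss ! j \<in> set (take k xss)"
      using that by (auto simp: in_set_conv_nth intro!: exI[of _ j])
    moreover have "xss ! k \<in> set (drop k xss)"
      using that by (metis Cons_nth_drop_Suc list.set_intros(1))
    ultimately show ?thesis by auto
  qed
  show ?thesis using *[of j k] *[of k j] assms by (cases "j < k") auto
qed

context algebra_of
begin

lemma pad_closed: "as \<in> tuples A n \<Longrightarrow> pad A as i \<in> carrier A"
  by (auto simp: pad_def tuples_def)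

text \<open>Distinct leaves put the variable \<open>i\<close> into exactly one subtree. The other
  arguments do not depend on \<open>a\<close>, so the map is that of the subtree followed by one
  slot of a multilinear operation.\<close>

lemma linear_map_term_eval:
  assumes "t \<in> terms \<Omega>" "distinct (leaves t)" "i \<in> set (leaves t)" and v: "\<And>i. v i \<in> carrier A"
  shows "linear_map A A (\<lambda>a. term_eval ops (v(i := a)) t)"
  using assms(1-3)
proof (induction rule: terms.induct)
  case (Var j)
  then show ?case by (auto intro: linear_mapI)
next
  case (Op s ts)
  then obtain t where "t \<in> set ts" "i \<in> set (leaves t)" by auto
  then obtain j where j: "j < length ts" "i \<in> set (leaves (ts ! j))" "ts ! j \<in> set ts"
    by (auto simp: in_set_conv_nth)
  have other: "i \<notin> set (leaves (ts ! k))" if "k < length ts" "k \<noteq> j" for k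
    using distinct_concat_disjoint[of "map leaves ts" j k] Op.prems(1) j that by auto
  have eq: "map (term_eval ops (v(i := a))) ts = (map (term_eval ops v) ts)[j := term_eval ops (v(i := a)) (ts ! j)]" for a
  proof (rule nth_equalityI)
    fix k assume "k < length (map (term_eval ops (v(i := a))) ts)"
    then show "map (term_eval ops (v(i := a))) ts ! k =
        (map (term_eval ops v) ts)[j := term_eval ops (v(i := a)) (ts ! j)] ! k"
      using other[of k] by (cases "k = j") (auto intro!: term_eval_cong)
  qed simp
  have dist: "distinct (leaves (ts ! j))"
    using Op.prems(1) j by (auto simp: distinct_concat_iff)
  have "linear_map A A (\<lambda>a. ops s ((map (term_eval ops v) ts)[j := a]))"
    using Op j v by (intro multilinearD(2)[OF multilinear_ops]) (auto simp: tuples_def intro!: term_eval_closed)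
  from linear_map_comp[OF Op.IH[OF j(3) dist j(2)] this]
  show ?case by (simp only: term_eval.simps eq)
qed

lemma eval_hom_closed:
  assumes p: "p \<in> ocarrier (free_operad \<Omega>) n"
  shows "eval_hom (A, ops) n p \<in> ocarrier (endo A) n"
proof -
  have pt: "t \<in> terms \<Omega> \<and> distinct (leaves t) \<and> set (leaves t) = {..<n}" if "t \<in> keys p" for t
    using p that by (auto simp: ocarrier_free_iff polylinear_term_def)
  have keys: "keys p \<subseteq> terms \<Omega>" using pt by auto
  have "multilinear A n (\<lambda>as. poly_eval (A, ops) (pad A as) p)"
  proof (rule multilinearI)
    fix as assume as: "as \<in> tuples A n"
    then show "poly_eval (A, ops) (pad A as) p \<in> carrier A"
      using keys pad_closed by (intro poly_eval_closed) auto
    fix i assume i: "i < n"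
    have "pad A (as[i := a]) = (pad A as)(i := a)" for a
      using as i by (auto simp: pad_def tuples_def fun_eq_iff)
    moreover have "linear_map A A (\<lambda>a. \<Oplus>\<^bsub>A\<^esub>t\<in>keys p.
        lookup p t \<odot>\<^bsub>A\<^esub> term_eval ops ((pad A as)(i := a)) t)"
      using pt as i pad_closed
      by (intro linear_map_finsum_fun[OF vec_space] linear_map_smult_fun[OF vec_space] linear_map_term_eval vec_space finite_keys) auto
    ultimately show "linear_map A A (\<lambda>a. poly_eval (A, ops) (pad A (as[i := a])) p)"
      by (simp add: poly_eval_def)
  qed
  from multilinear_restrict[OF vec_space this, of "eval_hom (A, ops) n p"]
  show ?thesis by (simp add: eval_hom_def)
qed

lemma eval_hom_apply: "as \<in> tuples A n \<Longrightarrow> eval_hom (A, ops) n p as = poly_eval (A, ops) (pad A as) p"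
  by (simp add: eval_hom_def)

lemma poly_eval_pad:
  assumes p: "p \<in> ocarrier (free_operad \<Omega>) n" and "as \<in> tuples A n"
    and "\<And>i. i < n \<Longrightarrow> v i = as ! i"
  shows "poly_eval (A, ops) v p = eval_hom (A, ops) n p as"
  unfolding eval_hom_apply[OF assms(2)] using assms pad_closed
  by (intro poly_eval_cong) (auto simp: ocarrier_free_iff polylinear_term_def pad_def tuples_def)

lemma is_identity_iff_eval_hom:
  assumes p: "p \<in> ocarrier (free_operad \<Omega>) n"
  shows "is_identity (A, ops) p \<longleftrightarrow> eval_hom (A, ops) n p = \<zero>\<^bsub>ospace (endo A) n\<^esub>"
proof
  assume id: "is_identity (A, ops) p"
  show "eval_hom (A, ops) n p = \<zero>\<^bsub>ospace (endo A) n\<^esub>"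
    using id pad_closed by (auto simp: eval_hom_def is_identity_def intro!: restrict_ext)
next
  assume eq: "eval_hom (A, ops) n p = \<zero>\<^bsub>ospace (endo A) n\<^esub>"
  show "is_identity (A, ops) p"
    unfolding is_identity_def
  proof (intro allI impI)
    fix v :: "nat \<Rightarrow> 'u" assume v: "\<forall>i. v i \<in> carrier (fst (A, ops))"
    then have "map v [0..<n] \<in> tuples A n" by (auto simp: tuples_def)
    with poly_eval_pad[OF p this, of v] eq show "poly_eval (A, ops) v p = \<zero>\<^bsub>fst (A, ops)\<^esub>" by simp
  qed
qed

lemma operad_hom_eval: "operad_hom (free_operad \<Omega>) (endo A) (eval_hom (A, ops))"
  unfolding operad_hom_def
proof (intro conjI allI impI)
  fix n :: nat assume "1 \<le> n"
  have "linear_map (poly_module (terms \<Omega>)) A (\<lambda>p. eval_hom (A, ops) n p as)" if "as \<in> tuples A n" for as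
    unfolding eval_hom_apply[OF that] using pad_closed[OF that] by (rule linear_poly_eval)
  then have "linear_map (ospace (free_operad \<Omega>) n) A (\<lambda>p. eval_hom (A, ops) n p as)" if "as \<in> tuples A n" for as
    unfolding ospace_free_operad using that by (blast intro: linear_map_poly_subset)
  then show "linear_map (ospace (free_operad \<Omega>) n) (ospace (endo A) n) (eval_hom (A, ops) n)"
    by (intro linear_map_endoI eval_hom_closed vec_space)
      (simp_all add: ospace_free_operad vector_space_poly_module)
next
  show "eval_hom (A, ops) 1 (oid (free_operad \<Omega>)) = oid (endo A)"
    unfolding eval_hom_def prod.case free_operad_simps endo_simps
  proof (rule restrict_ext)
    fix as assume as: "as \<in> tuples A 1"
    have "as ! 0 \<in> carrier A" using as by (auto simp: tuples_def)
    then show "poly_eval (A, ops) (pad A as) (pvar 0) = hd as"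
      using poly_eval_single[of "Var 0" "pad A as" 1] pad_closed[OF as] as
      by (auto simp: pvar_def pad_def tuples_def hd_conv_nth)
  qed
next
  fix ms :: "nat list" and f :: "('k, 'o) npoly" and gs :: "('k, 'o) npoly list"
  assume asm: "valid_arities ms \<and> f \<in> ocarrier (free_operad \<Omega>) (length ms) \<and> gs \<in> oargs (free_operad \<Omega>) ms"
  then have f: "f \<in> ocarrier (free_operad \<Omega>) (length ms)" and gs: "gs \<in> oargs (free_operad \<Omega>) ms" by auto
  define w where "w = (\<lambda>i. if i < length ms then subst_poly \<Omega> (\<lambda>j. pvar (offset ms i + j)) (gs ! i) else 0)"
  have w: "ocomp (free_operad \<Omega>) ms f gs = subst_poly \<Omega> w f"
      "keys (w i) \<subseteq> terms \<Omega>" for i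
    using ocomp_free_eq[OF f gs] by (simp_all only: w_def)
  have len: "length gs = length ms" and g: "\<And>i. i < length ms \<Longrightarrow> gs ! i \<in> ocarrier (free_operad \<Omega>) (ms ! i)"
    using gs by (auto simp: oargs_iff)
  let ?h = "eval_hom (A, ops)"
  show "?h (sum_list ms) (ocomp (free_operad \<Omega>) ms f gs) =
      ocomp (endo A) ms (?h (length ms) f) (map2 ?h ms gs)"
    unfolding w(1) endo_simps
  proof (subst eval_hom_def, unfold prod.case, rule restrict_ext)
    fix as assume as: "as \<in> tuples A (sum_list ms)"
    let ?b = "\<lambda>i. take (ms ! i) (drop (offset ms i) as)"
    let ?cs = "map (\<lambda>i. (map2 ?h ms gs ! i) (?b i)) [0..<length ms]"
    have cs: "?cs = map (\<lambda>i. ?h (ms ! i) (gs ! i) (?b i)) [0..<length ms]"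
      using len by auto
    have b: "?b i \<in> tuples A (ms ! i)" if "i < length ms" for i
      using take_drop_block[OF as that] .
    have cs_closed: "?cs \<in> tuples A (length ms)"
    proof -
      have "?h (ms ! i) (gs ! i) (?b i) \<in> carrier A" if i: "i < length ms" for i
        using multilinearD(1)[OF _ b[OF i]] eval_hom_closed[OF g[OF i]] by simp
      then show ?thesis unfolding cs by (auto simp: tuples_def)
    qed
    \<comment> \<open>The shift by \<open>offset ms i\<close> in the free operad corresponds to
      cutting the \<open>i\<close>-th block out of \<open>as\<close> in the endomorphism
      operad.\<close>
    have "poly_eval (A, ops) (pad A as) (w i) = ?cs ! i" if i: "i < length ms" for i
    proof -
      have "poly_eval (A, ops) (pad A as) (w i) =
          poly_eval (A, ops) (\<lambda>j. poly_eval (A, ops) (pad A as) (pvar (offset ms i + j))) (gs ! i)"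
        using g[OF i] i pad_closed[OF as] by (simp add: w_def ocarrier_free_iff poly_eval_subst)
      also have "\<dots> = poly_eval (A, ops) (\<lambda>j. pad A as (offset ms i + j)) (gs ! i)"
        using pad_closed[OF as] poly_eval_single[of "Var _" "pad A as" 1] by (simp add: pvar_def)
      also have "\<dots> = ?h (ms ! i) (gs ! i) (?b i)"
        using as offset_le[OF i] by (intro poly_eval_pad g i b) (auto simp: tuples_def pad_def)
      finally show ?thesis using i by (simp add: cs)
    qed
    then have "poly_eval (A, ops) (\<lambda>i. poly_eval (A, ops) (pad A as) (w i)) f = ?h (length ms) f ?cs"
      by (intro poly_eval_pad f cs_closed) auto
    then show "poly_eval (A, ops) (pad A as) (subst_poly \<Omega> w f) = ?h (length ms) f ?cs"
      using f w(2) pad_closed[OF as] by (simp only: poly_eval_subst ocarrier_free_iff)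
  qed
next
  fix n :: nat and \<sigma> :: "nat \<Rightarrow> nat" and f :: "('k, 'o) npoly"
  assume "\<sigma> permutes {..<n} \<and> f \<in> ocarrier (free_operad \<Omega>) n"
  then have \<sigma>: "\<sigma> permutes {..<n}" and f: "f \<in> ocarrier (free_operad \<Omega>) n" by auto
  show "eval_hom (A, ops) n (oact (free_operad \<Omega>) n \<sigma> f) = oact (endo A) n \<sigma> (eval_hom (A, ops) n f)"
    unfolding free_operad_simps endo_simps
  proof (subst eval_hom_def, unfold prod.case, rule restrict_ext)
    fix as assume as: "as \<in> tuples A n"
    have \<sigma>i: "\<sigma> i < n" if "i < n" for i using permutes_in_image[OF \<sigma>, of i] that by simp
    have "poly_eval (A, ops) (pad A as) (subst_poly \<Omega> (\<lambda>i. pvar (\<sigma> i)) f) =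
        poly_eval (A, ops) (\<lambda>i. poly_eval (A, ops) (pad A as) (pvar (\<sigma> i))) f"
      using f pad_closed[OF as] by (intro poly_eval_subst) (auto simp: ocarrier_free_iff)
    also have "\<dots> = poly_eval (A, ops) (\<lambda>i. pad A as (\<sigma> i)) f"
      using pad_closed[OF as] poly_eval_single[of "Var _" "pad A as" 1] by (simp add: pvar_def)
    also have "\<dots> = eval_hom (A, ops) n f (map (\<lambda>i. as ! \<sigma> i) [0..<n])"
      using as \<sigma>i by (intro poly_eval_pad f) (auto simp: tuples_def pad_def)
    finally show "poly_eval (A, ops) (pad A as) (subst_poly \<Omega> (\<lambda>i. pvar (\<sigma> i)) f) = \<dots>" .
  qed
qed

lemma eval_hom_generator:
  assumes "s \<in> symb \<Omega>"
  shows "eval_hom (A, ops) (ar \<Omega> s) (generator \<Omega> s) = restrict (ops s) (tuples A (ar \<Omega> s))"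
  unfolding eval_hom_def prod.case
proof (rule restrict_ext)
  fix as assume as: "as \<in> tuples A (ar \<Omega> s)"
  have "map (pad A as) [0..<ar \<Omega> s] = as"
    using as by (auto simp: tuples_def pad_def intro!: nth_equalityI)
  then have "term_eval ops (pad A as) (Op s (map Var [0..<ar \<Omega> s])) = ops s as"
    by (simp add: comp_def)
  moreover have "ops s as \<in> carrier A"
    using as assms multilinearD(1)[OF multilinear_ops] by blast
  moreover have "Op s (map Var [0..<ar \<Omega> s]) \<in> terms \<Omega>"
    using assms by (auto simp: terms_Op_iff)
  ultimately show "poly_eval (A, ops) (pad A as) (generator \<Omega> s) = ops s as"
    using pad_closed[OF as] by (simp only: generator_def poly_eval_single smult_one)
qed

end

lemma generator_closed: "s \<in> symb \<Omega> \<Longrightarrow> generator \<Omega> s \<in> ocarrier (free_operad \<Omega>) (ar \<Omega> s)"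
  by (auto simp: ocarrier_free_iff generator_def terms_Op_iff polylinear_term_def comp_def)

section \<open>Morphisms of operads\<close>

lemma operad_homD:
  assumes "operad_hom P Q h"
  shows "1 \<le> n \<Longrightarrow> linear_map (ospace P n) (ospace Q n) (h n)"
    and "h 1 (oid P) = oid Q"
    and "valid_arities ms \<Longrightarrow> f \<in> ocarrier P (length ms) \<Longrightarrow> gs \<in> oargs P ms \<Longrightarrow>
        h (sum_list ms) (ocomp P ms f gs) = ocomp Q ms (h (length ms) f) (map2 h ms gs)"
    and "1 \<le> n \<Longrightarrow> \<sigma> permutes {..<n} \<Longrightarrow> f \<in> ocarrier P n \<Longrightarrow> h n (oact P n \<sigma> f) = oact Q n \<sigma> (h n f)"
    and "1 \<le> n \<Longrightarrow> f \<in> ocarrier P n \<Longrightarrow> h n f \<in> ocarrier Q n"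
proof -
  show lin: "linear_map (ospace P n) (ospace Q n) (h n)" if "1 \<le> n" for n
    using assms that by (simp add: operad_hom_def)
  show "h n f \<in> ocarrier Q n" if "1 \<le> n" "f \<in> ocarrier P n"
    using linear_mapD(1)[OF lin] that by blast
qed (use assms in \<open>auto simp: operad_hom_def\<close>)

lemma valid_aritiesD:
  assumes "valid_arities ms"
  shows "1 \<le> length ms" "i < length ms \<Longrightarrow> 1 \<le> ms ! i" "1 \<le> sum_list ms"
proof -
  show "1 \<le> length ms" using assms by (cases ms) (auto simp: valid_arities_def)
  show pos: "1 \<le> ms ! i" if "i < length ms" for i
    using assms that by (auto simp: valid_arities_def in_set_conv_nth Suc_le_eq)
  show "1 \<le> sum_list ms"
    using assms by (cases ms) (auto simp: valid_arities_def Suc_le_eq)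
qed

lemma oargs_map2:
  assumes "valid_arities ms" "gs \<in> oargs P ms"
    "\<And>m g. 1 \<le> m \<Longrightarrow> g \<in> ocarrier P m \<Longrightarrow> h m g \<in> ocarrier Q m"
  shows "map2 h ms gs \<in> oargs Q ms"
  using assms valid_aritiesD(2)[OF assms(1)] by (auto simp: oargs_iff)

lemma operad_hom_comp:
  assumes g: "operad_hom P Q g" and h: "operad_hom Q R h"
  shows "operad_hom P R (\<lambda>n x. h n (g n x))"
  unfolding operad_hom_def
proof (intro conjI allI impI)
  show "linear_map (ospace P n) (ospace R n) (\<lambda>x. h n (g n x))" if "1 \<le> n" for n
    using linear_map_comp[OF operad_homD(1)[OF g that] operad_homD(1)[OF h that]] .
  show "h 1 (g 1 (oid P)) = oid R" by (simp only: operad_homD(2)[OF g] operad_homD(2)[OF h])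
next
  fix ms f gs assume "valid_arities ms \<and> f \<in> ocarrier P (length ms) \<and> gs \<in> oargs P ms"
  then have *: "valid_arities ms" "f \<in> ocarrier P (length ms)" "gs \<in> oargs P ms" by auto
  have "map2 h ms (map2 g ms gs) = map2 (\<lambda>n x. h n (g n x)) ms gs"
    using *(3) by (auto simp: oargs_iff intro!: nth_equalityI)
  moreover have "map2 g ms gs \<in> oargs Q ms"
    using *(1,3) operad_homD(5)[OF g] by (rule oargs_map2)
  ultimately show "h (sum_list ms) (g (sum_list ms) (ocomp P ms f gs)) =
      ocomp R ms (h (length ms) (g (length ms) f)) (map2 (\<lambda>n x. h n (g n x)) ms gs)"
    using * operad_homD(5)[OF g valid_aritiesD(1)[OF *(1)] *(2)]
    by (simp add: operad_homD(3)[OF g] operad_homD(3)[OF h])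
next
  show "h n (g n (oact P n \<sigma> f)) = oact R n \<sigma> (h n (g n f))"
    if "1 \<le> n" "\<sigma> permutes {..<n} \<and> f \<in> ocarrier P n" for n \<sigma> f
    using that operad_homD(5)[OF g, of n f] by (simp add: operad_homD(4)[OF g] operad_homD(4)[OF h])
qed

text \<open>The kernel condition makes \<open>h\<close> constant on the fibres of \<pi>, so the
  preimage chosen by \<open>inv_into\<close> is irrelevant and every law for \<open>g\<close> can be
  checked on preimages. The same construction yields \<open>induced_hom\<close> and the operad
  action on an algebra of a variety.\<close>

lemma operad_hom_factor:
  fixes F :: "('k::field, 'f) operad" and P :: "('k, 'p) operad" and Q :: "('k, 'q) operad"
  assumes F: "operad_closed F" and Q: "\<And>n. 1 \<le> n \<Longrightarrow> vector_space_over TYPE('k) (ospace Q n)"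
    and P: "\<And>n. 1 \<le> n \<Longrightarrow> vector_space_over TYPE('k) (ospace P n)"
    and \<pi>: "operad_hom F P \<pi>" and h: "operad_hom F Q h"
    and surj: "\<And>n. 1 \<le> n \<Longrightarrow> \<pi> n ` ocarrier F n = ocarrier P n"
    and ker: "\<And>n f. 1 \<le> n \<Longrightarrow> f \<in> ocarrier F n \<Longrightarrow> \<pi> n f = \<zero>\<^bsub>ospace P n\<^esub> \<Longrightarrow> h n f = \<zero>\<^bsub>ospace Q n\<^esub>"
  defines "g \<equiv> \<lambda>n x. h n (inv_into (ocarrier F n) (\<pi> n) x)"
  shows "operad_hom P Q g" "\<And>n f. 1 \<le> n \<Longrightarrow> f \<in> ocarrier F n \<Longrightarrow> g n (\<pi> n f) = h n f"
proof -
  interpret F: operad_closed F by fact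
  have eq: "h n x = h n y" if n: "1 \<le> n" and x: "x \<in> ocarrier F n" and y: "y \<in> ocarrier F n"
    and xy: "\<pi> n x = \<pi> n y" for n x y
  proof -
    interpret Fn: vec_space "ospace F n" by (rule vec_space.intro[OF F.ospace_vec[OF n]])
    interpret Pn: vec_space "ospace P n" by (rule vec_space.intro[OF P[OF n]])
    interpret Qn: vec_space "ospace Q n" by (rule vec_space.intro[OF Q[OF n]])
    note lin\<pi> = linear_mapD[OF operad_homD(1)[OF \<pi> n]] and linh = linear_mapD[OF operad_homD(1)[OF h n]]
    \<comment> \<open>The difference is written with the scalar -1, since sums and multiples are
      what \<open>linear_map\<close> preserves by definition.\<close>
    let ?d = "x \<oplus>\<^bsub>ospace F n\<^esub> (-1) \<odot>\<^bsub>ospace F n\<^esub> y"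
    have "\<pi> n ?d = \<pi> n x \<oplus>\<^bsub>ospace P n\<^esub> (-1) \<odot>\<^bsub>ospace P n\<^esub> \<pi> n x"
      using x y xy by (simp add: lin\<pi>)
    also have "\<dots> = \<zero>\<^bsub>ospace P n\<^esub>"
      using lin\<pi>(1)[OF x] Pn.r_neg[of "\<pi> n x"] by (simp add: Pn.minus_eq_smult)
    finally have "h n ?d = \<zero>\<^bsub>ospace Q n\<^esub>" using ker[OF n, of ?d] x y by simp
    then have "h n x \<oplus>\<^bsub>ospace Q n\<^esub> (-1) \<odot>\<^bsub>ospace Q n\<^esub> h n y = \<zero>\<^bsub>ospace Q n\<^esub>"
      using x y by (simp add: linh)
    then have "h n x \<oplus>\<^bsub>ospace Q n\<^esub> \<ominus>\<^bsub>ospace Q n\<^esub> h n y = \<zero>\<^bsub>ospace Q n\<^esub>"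
      using linh(1)[OF y] by (simp add: Qn.minus_eq_smult)
    from Qn.minus_equality[OF this] show ?thesis using linh(1) x y by simp
  qed
  have g: "g n (\<pi> n f) = h n f" if "1 \<le> n" "f \<in> ocarrier F n" for n f
    unfolding g_def using that
    by (intro eq) (auto intro: inv_into_into f_inv_into_f)
  then show "\<And>n f. 1 \<le> n \<Longrightarrow> f \<in> ocarrier F n \<Longrightarrow> g n (\<pi> n f) = h n f" .
  have lift: "\<exists>y\<in>ocarrier F n. x = \<pi> n y" if "1 \<le> n" "x \<in> ocarrier P n" for n x
    using surj[OF that(1)] that(2) by blast
  show "operad_hom P Q g"
    unfolding operad_hom_def
  proof (intro conjI allI impI)
    fix n :: nat assume n: "1 \<le> n"
    interpret Fn: vec_space "ospace F n" by (rule vec_space.intro[OF F.ospace_vec[OF n]])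
    note lin\<pi> = linear_mapD[OF operad_homD(1)[OF \<pi> n]] and linh = linear_mapD[OF operad_homD(1)[OF h n]]
    show "linear_map (ospace P n) (ospace Q n) (g n)"
    proof (rule linear_mapI)
      fix x assume "x \<in> ocarrier P n"
      then obtain x' where x': "x' \<in> ocarrier F n" and x: "x = \<pi> n x'" using lift n by blast
      show "g n x \<in> ocarrier Q n" using x' n by (simp add: x g linh)
      show "g n (c \<odot>\<^bsub>ospace P n\<^esub> x) = c \<odot>\<^bsub>ospace Q n\<^esub> g n x" for c
      proof -
        have "c \<odot>\<^bsub>ospace P n\<^esub> x = \<pi> n (c \<odot>\<^bsub>ospace F n\<^esub> x')"
          using lin\<pi>(3)[OF x', of c] x by simp
        then show ?thesis using x' n by (simp add: x g linh)
      qed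
      fix y assume "y \<in> ocarrier P n"
      then obtain y' where y': "y' \<in> ocarrier F n" and y: "y = \<pi> n y'" using lift n by blast
      show "g n (x \<oplus>\<^bsub>ospace P n\<^esub> y) = g n x \<oplus>\<^bsub>ospace Q n\<^esub> g n y"
      proof -
        have "x \<oplus>\<^bsub>ospace P n\<^esub> y = \<pi> n (x' \<oplus>\<^bsub>ospace F n\<^esub> y')"
          using lin\<pi>(2)[OF x' y'] x y by simp
        then show ?thesis using x' y' n by (simp add: x y g linh)
      qed
    qed
    fix \<sigma> f assume *: "\<sigma> permutes {..<n} \<and> f \<in> ocarrier P n"
    then obtain f' where f': "f' \<in> ocarrier F n" and f: "f = \<pi> n f'" using lift n by blast
    have "oact P n \<sigma> f = \<pi> n (oact F n \<sigma> f')"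
      using operad_homD(4)[OF \<pi> n _ f'] * f by simp
    then show "g n (oact P n \<sigma> f) = oact Q n \<sigma> (g n f)"
      using operad_homD(4)[OF h n _ f'] * f f' n F.oact_closed[OF n _ f'] by (simp add: g)
  next
    have "oid P = \<pi> 1 (oid F)" using operad_homD(2)[OF \<pi>] by simp
    then show "g 1 (oid P) = oid Q"
      using g[of 1 "oid F"] F.oid_closed' operad_homD(2)[OF h] by simp
  next
    fix ms f gs assume "valid_arities ms \<and> f \<in> ocarrier P (length ms) \<and> gs \<in> oargs P ms"
    then have *: "valid_arities ms" "f \<in> ocarrier P (length ms)" "gs \<in> oargs P ms" by auto
    obtain f' where f': "f' \<in> ocarrier F (length ms)" and f: "f = \<pi> (length ms) f'"
      using lift *(2) valid_aritiesD(1)[OF *(1)] by blast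
    have "\<forall>i<length ms. \<exists>y\<in>ocarrier F (ms ! i). gs ! i = \<pi> (ms ! i) y"
      using lift *(3) valid_aritiesD(2)[OF *(1)] by (auto simp: oargs_iff)
    then obtain G where G: "i < length ms \<Longrightarrow> G i \<in> ocarrier F (ms ! i) \<and> gs ! i = \<pi> (ms ! i) (G i)" for i
      by metis
    define gs' where "gs' = map G [0..<length ms]"
    have gs': "gs' \<in> oargs F ms" using G by (auto simp: gs'_def oargs_iff)
    have gs: "gs = map2 \<pi> ms gs'"
      using G *(3) by (auto simp: gs'_def oargs_iff intro!: nth_equalityI)
    have "map2 g ms gs = map2 h ms gs'"
      using G *(3) valid_aritiesD(2)[OF *(1)] by (auto simp: gs'_def oargs_iff g intro!: nth_equalityI)
    moreover have "ocomp P ms f gs = \<pi> (sum_list ms) (ocomp F ms f' gs')"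
      using operad_homD(3)[OF \<pi> *(1) f' gs'] f gs by simp
    ultimately show "g (sum_list ms) (ocomp P ms f gs) = ocomp Q ms (g (length ms) f) (map2 g ms gs)"
      using operad_homD(3)[OF h *(1) f' gs'] f f' valid_aritiesD[OF *(1)] F.ocomp_closed[OF *(1) f' gs']
      by (simp add: g)
  qed
qed

section \<open>Morphisms out of the free operad\<close>

lemma nth_concat_block:
  assumes "i < length xss"
  shows "xss ! i = take (length (xss ! i)) (drop (offset (map length xss) i) (concat xss))"
proof -
  have "concat xss = concat (take i xss) @ xss ! i @ concat (drop (Suc i) xss)"
    using assms by (metis concat.simps(2) concat_append id_take_nth_drop)
  moreover have "length (concat (take i xss)) = offset (map length xss) i"
    by (simp add: offset_def length_concat take_map)
  ultimately show ?thesis by simp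
qed

text \<open>The free operad is generated by its generators under compositions, permutations of
  variables and linear combinations: a polylinear monomial is a permutation applied to one whose
  leaves increase from left to right, and the monomials span.\<close>

lemma operad_hom_free_unique:
  fixes h h' :: "nat \<Rightarrow> ('k::field, 'o) npoly \<Rightarrow> 'q"
  assumes \<Omega>: "is_language \<Omega>" and Q: "\<And>n. 1 \<le> n \<Longrightarrow> vector_space_over TYPE('k) (ospace Q n)"
    and h: "operad_hom (free_operad \<Omega>) Q h" and h': "operad_hom (free_operad \<Omega>) Q h'"
    and gen: "\<And>s. s \<in> symb \<Omega> \<Longrightarrow> h (ar \<Omega> s) (generator \<Omega> s) = h' (ar \<Omega> s) (generator \<Omega> s)"
    and n: "1 \<le> n" and p: "p \<in> ocarrier (free_operad \<Omega>) n"
  shows "h n p = h' n p"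
proof -
  let ?mon = "\<lambda>t. single t (1::'k)"
  \<comment> \<open>Composition is restricted to positive arities. Operations of arity at least 2
    exclude constants, so no subtree is without leaves.\<close>
  have ne: "leaves t \<noteq> []" if "t \<in> terms \<Omega>" for t
    using that
  proof (induction rule: terms.induct)
    case (Op s ts)
    then have "2 \<le> length ts" using \<Omega> by (simp add: is_language_def)
    then have "ts \<noteq> []" by auto
    then show ?case using Op.IH by (cases ts) auto
  qed simp
  \<comment> \<open>The terms with leaves in increasing order are iterated compositions of generators.\<close>
  have ordered: "h m (?mon (relabel (\<lambda>x. x - k) t)) = h' m (?mon (relabel (\<lambda>x. x - k) t))"
    if "t \<in> terms \<Omega>" "leaves t = [k..<k + m]" for t k m
    using that
  proof (induction arbitrary: k m rule: terms.induct)
    case (Var i)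
    then have i: "[i] = [k..<k + m]" by simp
    from arg_cong[OF i, of length] have "m = 1" by simp
    with i have "k = i" by simp
    note \<open>m = 1\<close> this
    moreover have "oid (free_operad \<Omega>) = ?mon (Var 0)" by (simp add: free_operad_simps pvar_def)
    ultimately show ?case using operad_homD(2)[OF h] operad_homD(2)[OF h'] by simp
  next
    case (Op s ts)
    define ms where "ms = map (length \<circ> leaves) ts"
    \<comment> \<open>The leaves of the \<open>i\<close>-th subtree begin at
      \<open>k + offset ms i\<close> and are moved down to begin at 0, as those of an argument of a
      composition must. Allowing any start \<open>k\<close> in the statement is what makes the
      induction hypothesis apply to the subtrees.\<close>
    define us where "us = map (\<lambda>i. relabel (\<lambda>x. x - (k + offset ms i)) (ts ! i)) [0..<length ts]"
    have len: "length ms = ar \<Omega> s" "length us = length ts" "length ms = length ts"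
      using Op.hyps by (simp_all add: ms_def us_def)
    have m: "sum_list ms = m"
      using arg_cong[OF Op.prems, of length] by (simp add: ms_def length_concat comp_def)
    have valid: "valid_arities ms"
      using Op.hyps ne \<Omega> len by (auto simp: valid_arities_def ms_def is_language_def)
    have block: "leaves (ts ! i) = [k + offset ms i..<k + offset ms i + ms ! i]" if i: "i < length ts" for i
    proof -
      have "leaves (ts ! i) = take (ms ! i) (drop (offset ms i) [k..<k + m])"
        using nth_concat_block[of i "map leaves ts"] i Op.prems by (simp add: ms_def comp_def)
      then show ?thesis using offset_le[of i ms] i m len by (simp add: add.assoc)
    qed
    have IH: "h (ms ! i) (?mon (us ! i)) = h' (ms ! i) (?mon (us ! i))" if "i < length ts" for i
      using Op.IH[of "ts ! i" "k + offset ms i" "ms ! i"] block that by (simp add: us_def)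
    let ?gs = "map ?mon us"
    have us_closed: "?mon (us ! i) \<in> ocarrier (free_operad \<Omega>) (ms ! i)" if i: "i < length ts" for i
    proof -
      have "leaves (us ! i) = [0..<ms ! i]"
        using i block[OF i] by (auto simp: us_def intro!: nth_equalityI)
      moreover have "us ! i \<in> terms \<Omega>" using i Op.hyps by (simp add: us_def)
      ultimately show ?thesis by (auto simp: ocarrier_free_iff polylinear_term_def)
    qed
    have gs: "?gs \<in> oargs (free_operad \<Omega>) ms"
      using us_closed len by (auto simp: oargs_iff)
    have gen_closed: "generator \<Omega> s \<in> ocarrier (free_operad \<Omega>) (length ms)"
      using generator_closed[OF Op.hyps(1)] len by simp
    define w :: "nat \<Rightarrow> ('k, 'o) npoly"
      where "w = (\<lambda>i. if i < length ms then subst_poly \<Omega> (\<lambda>j. pvar (offset ms i + j)) (?gs ! i) else 0)"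
    have w: "ocomp (free_operad \<Omega>) ms (generator \<Omega> s) ?gs = subst_poly \<Omega> w (generator \<Omega> s)"
        "keys (w i) \<subseteq> terms \<Omega>" for i
      using ocomp_free_eq[OF gen_closed gs] by (simp_all only: w_def)
    have wi: "w i = ?mon (relabel (\<lambda>x. x - k) (ts ! i))" if i: "i < length ts" for i
    proof -
      have "w i = ?mon (relabel (\<lambda>j. offset ms i + j) (us ! i))"
        using i len us_closed[OF i] by (simp add: w_def relabel_single ocarrier_free_iff)
      also have "relabel (\<lambda>j. offset ms i + j) (us ! i) = relabel (\<lambda>x. x - k) (ts ! i)"
        using i block[OF i] by (auto simp: us_def relabel_relabel intro!: relabel_cong)
      finally show ?thesis .
    qed
    have "ocomp (free_operad \<Omega>) ms (generator \<Omega> s) ?gs = term_eval free_op w (Op s (map Var [0..<ar \<Omega> s]))"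
      unfolding w(1) unfolding generator_def using w(2) Op.hyps
      by (intro subst_poly_single) (auto simp: terms_Op_iff)
    also have "\<dots> = free_op s (map w [0..<ar \<Omega> s])" by (simp add: comp_def)
    also have "map w [0..<ar \<Omega> s] = map ?mon (map (relabel (\<lambda>x. x - k)) ts)"
      using wi len by (auto intro!: nth_equalityI)
    also have "free_op s \<dots> = ?mon (relabel (\<lambda>x. x - k) (Op s ts))"
      by (simp only: free_op_single relabel.simps)
    finally have eq: "?mon (relabel (\<lambda>x. x - k) (Op s ts)) = ocomp (free_operad \<Omega>) ms (generator \<Omega> s) ?gs" ..
    have "map2 h ms ?gs = map2 h' ms ?gs"
      using IH len by (intro nth_equalityI) auto
    then show ?case
      using operad_homD(3)[OF h valid gen_closed gs] operad_homD(3)[OF h' valid gen_closed gs]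
        gen[OF Op.hyps(1)] m len by (simp only: eq)
  qed
  have mono: "h n (?mon t) = h' n (?mon t)" if t: "t \<in> polylinear_terms \<Omega> n" for t
  proof -
    \<comment> \<open>\<sigma> lists the leaves of \<open>t\<close> in their order of appearance, so
      relabelling by its inverse makes them increasing; off \<open>{..<n}\<close> it is the
      identity, as \<open>permutes\<close> demands.\<close>
    define \<sigma> where "\<sigma> i = (if i < n then leaves t ! i else i)" for i
    have d: "distinct (leaves t)" "set (leaves t) = {..<n}" using t by (auto simp: polylinear_term_def)
    have len: "length (leaves t) = n" using distinct_card[OF d(1)] d(2) by simp
    have lv: "leaves t = map \<sigma> [0..<n]" using len by (auto simp: \<sigma>_def intro!: nth_equalityI)
    have "bij_betw \<sigma> {..<n} {..<n}"
    proof (rule bij_betw_imageI)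
      show "inj_on \<sigma> {..<n}" using d len by (auto simp: inj_on_def \<sigma>_def nth_eq_iff_index_eq)
      show "\<sigma> ` {..<n} = {..<n}" using d(2) lv by (metis atLeast_upt set_map set_upt)
    qed
    then have \<sigma>: "\<sigma> permutes {..<n}" by (rule bij_imp_permutes) (simp add: \<sigma>_def)
    define u where "u = relabel (inv_into UNIV \<sigma>) t"
    have "leaves u = [0..<n]"
      using permutes_inverses[OF \<sigma>] by (simp add: u_def lv comp_def)
    moreover have "u \<in> terms \<Omega>" using t by (simp add: u_def)
    ultimately have u: "?mon u \<in> ocarrier (free_operad \<Omega>) n" "h n (?mon u) = h' n (?mon u)"
      using ordered[of u 0 n] relabel_ident[of u "\<lambda>x. x - 0"]
      by (auto simp: ocarrier_free_iff polylinear_term_def)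
    have "relabel \<sigma> u = t"
      using permutes_inverses[OF \<sigma>] by (simp add: u_def relabel_relabel relabel_ident)
    then have "oact (free_operad \<Omega>) n \<sigma> (?mon u) = ?mon t"
      using t by (simp add: free_operad_simps relabel_single u_def)
    then show ?thesis
      using operad_homD(4)[OF h n \<sigma> u(1)] operad_homD(4)[OF h' n \<sigma> u(1)] u(2) by simp
  qed
  show ?thesis
    using linear_map_poly_eqI[OF Q[OF n] operad_homD(1)[OF h n, unfolded ospace_free_operad]
        operad_homD(1)[OF h' n, unfolded ospace_free_operad] mono, of p] p
    by (simp add: ospace_free_operad)
qed

section \<open>The Hadamard product with Perm\<close>

lemma vector_space_perm_space: "vector_space_over TYPE('k::field) (perm_space n :: ('k, nat \<Rightarrow> 'k) module)"
proof -
  let ?K = "mk_module UNIV 0 (+) (*) :: ('k, 'k) module"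
  have "abelian_group ?K"
    by (rule abelian_groupI) (auto simp: algebra_simps intro: exI[of _ "- _"])
  then have "vector_space_over TYPE('k) ?K"
    by (rule vector_space_overI) (auto simp: algebra_simps)
  from vector_space_tensor_space[OF this, of n] show ?thesis
    by (simp add: perm_space_def tensor_space_def)
qed

lemma basis_vec_closed: "basis_vec n k \<in> carrier (perm_space n)"
  by (auto simp: basis_vec_def perm_space_def)

lemma finite_choices [simp]: "finite (choices ms)"
  by (auto simp: choices_def intro!: finite_listset)

lemma choices_iff: "js \<in> choices ms \<longleftrightarrow> length js = length ms \<and> (\<forall>i<length ms. js ! i < ms ! i)"
  by (auto simp: choices_def in_listset_iff list_all2_conv_all_nth)

lemma perm_sum_delta:
  fixes c :: "'a \<Rightarrow> 'k::field"
  assumes "finite I" "i \<in> I" "c i = 1" "\<And>j. j \<in> I \<Longrightarrow> j \<noteq> i \<Longrightarrow> c j = 0"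
    and "\<And>j. j \<in> I \<Longrightarrow> b j \<in> carrier V" "vector_space_over TYPE('k) V"
  shows "(\<Oplus>\<^bsub>V\<^esub>j\<in>I. c j \<odot>\<^bsub>V\<^esub> b j) = b i"
proof -
  interpret vec_space V by (rule vec_space.intro) fact
  have "(\<Oplus>\<^bsub>V\<^esub>j\<in>I. c j \<odot>\<^bsub>V\<^esub> b j) = (\<Oplus>\<^bsub>V\<^esub>j\<in>I. if i = j then b j else \<zero>\<^bsub>V\<^esub>)"
    using assms by (intro finsum_cong') auto
  also have "\<dots> = b i" using assms by (intro finsum_singleton) auto
  finally show ?thesis .
qed

lemma oact_perm_basis:
  assumes "k < n"
  shows "oact perm n \<sigma> (basis_vec n k) = (basis_vec n (\<sigma> k) :: nat \<Rightarrow> 'k::field)"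
  unfolding perm_def operad.simps using assms
  by (intro perm_sum_delta basis_vec_closed vector_space_perm_space) (auto simp: basis_vec_def)

lemma oid_perm: "oid perm = basis_vec 1 0"
  by (simp add: perm_def)

text \<open>The coefficients of the multilinear extension at basis vectors are products of Kronecker
  deltas, so a single summand survives, which is the defining rule of Perm.\<close>

lemma ocomp_perm_basis:
  assumes k: "k < length ms" and js: "js \<in> choices ms"
  shows "ocomp perm ms (basis_vec (length ms) k) (map2 basis_vec ms js) =
    (basis_vec (sum_list ms) (offset ms k + js ! k) :: nat \<Rightarrow> 'k::field)"
proof -
  let ?N = "sum_list ms"
  let ?V = "perm_space ?N :: ('k, nat \<Rightarrow> 'k) module"
  interpret V: vec_space ?V by (rule vec_space.intro[OF vector_space_perm_space])
  let ?u = "basis_vec (length ms) k :: nat \<Rightarrow> 'k"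
  let ?c = "\<lambda>js'. \<Prod>i<length ms. (map2 basis_vec ms js ! i) (js' ! i) :: 'k"
  let ?b = "\<lambda>k js'. basis_vec ?N (offset ms k + js' ! k)"
  have c: "?c js' = (if js' = js then 1 else 0)" if "js' \<in> choices ms" for js'
  proof -
    have "?c js' = (\<Prod>i<length ms. if js' ! i = js ! i then 1 else 0)"
      using js that by (intro prod.cong) (auto simp: choices_iff basis_vec_def)
    then show ?thesis using js that by (auto simp: choices_iff list_eq_iff_nth_eq)
  qed
  have "ocomp perm ms ?u (map2 basis_vec ms js) =
      (\<Oplus>\<^bsub>?V\<^esub>k'\<in>{..<length ms}. \<Oplus>\<^bsub>?V\<^esub>js'\<in>choices ms. (?u k' * ?c js') \<odot>\<^bsub>?V\<^esub> ?b k' js')"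
    by (simp add: perm_def)
  also have "\<dots> = (\<Oplus>\<^bsub>?V\<^esub>k'\<in>{..<length ms}. ?u k' \<odot>\<^bsub>?V\<^esub> ?b k' js)"
  proof (rule V.finsum_cong')
    fix k' assume k': "k' \<in> {..<length ms}"
    have "(\<Oplus>\<^bsub>?V\<^esub>js'\<in>choices ms. (?u k' * ?c js') \<odot>\<^bsub>?V\<^esub> ?b k' js') =
        (\<Oplus>\<^bsub>?V\<^esub>js'\<in>choices ms. ?u k' \<odot>\<^bsub>?V\<^esub> (?c js' \<odot>\<^bsub>?V\<^esub> ?b k' js'))"
      by (intro V.finsum_cong') (auto simp: V.smult_assoc basis_vec_closed)
    also have "\<dots> = ?u k' \<odot>\<^bsub>?V\<^esub> (\<Oplus>\<^bsub>?V\<^esub>js'\<in>choices ms. ?c js' \<odot>\<^bsub>?V\<^esub> ?b k' js')"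
      by (rule linear_map_finsum[OF V.vec_space V.vec_space V.linear_map_smult, symmetric])
        (auto simp: basis_vec_closed)
    also have "(\<Oplus>\<^bsub>?V\<^esub>js'\<in>choices ms. ?c js' \<odot>\<^bsub>?V\<^esub> ?b k' js') = ?b k' js"
      using js c by (intro perm_sum_delta vector_space_perm_space) (auto simp: basis_vec_closed)
    finally show "(\<Oplus>\<^bsub>?V\<^esub>js'\<in>choices ms. (?u k' * ?c js') \<odot>\<^bsub>?V\<^esub> ?b k' js') = ?u k' \<odot>\<^bsub>?V\<^esub> ?b k' js" .
  qed (auto simp: basis_vec_closed)
  also have "\<dots> = ?b k js"
    using k by (intro perm_sum_delta vector_space_perm_space) (auto simp: basis_vec_def[of "length ms"] basis_vec_closed)
  finally show ?thesis .
qed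

lemma ospace_di [simp]: "ospace (di P) n = tensor_space (ospace P n) n"
  by (simp add: di_def)

lemma tensor_space_simps [simp]:
  "F \<in> carrier (tensor_space V n) \<longleftrightarrow> F \<in> {..<n} \<rightarrow>\<^sub>E carrier V"
  "zero (tensor_space V n) = (\<lambda>i\<in>{..<n}. \<zero>\<^bsub>V\<^esub>)"
  "add (tensor_space V n) = (\<lambda>F G. \<lambda>i\<in>{..<n}. F i \<oplus>\<^bsub>V\<^esub> G i)"
  "module.smult (tensor_space V n) = (\<lambda>c F. \<lambda>i\<in>{..<n}. c \<odot>\<^bsub>V\<^esub> F i)"
  by (simp_all add: tensor_space_def)

lemma (in vec_space) tensor_basis:
  "x \<in> carrier V \<Longrightarrow> tensor V n x (basis_vec n k) = (\<lambda>i\<in>{..<n}. if i = k then x else \<zero>\<^bsub>V\<^esub>)"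
  by (auto simp: tensor_def basis_vec_def fun_eq_iff)

lemma (in vec_space) tensor_basis_closed:
  "x \<in> carrier V \<Longrightarrow> tensor V n x (basis_vec n k) \<in> carrier (tensor_space V n)"
  by (auto simp: tensor_basis)

section \<open>Compositions and actions in the Hadamard product\<close>

context operad_closed
begin

lemma di_choice_closed:
  assumes "Gs \<in> oargs (di P) ms" "js \<in> choices ms"
  shows "map2 (\<lambda>G j. G j) Gs js \<in> oargs P ms"
  using assms by (fastforce simp: oargs_iff choices_iff PiE_iff)

lemma di_ospace_vec: "1 \<le> n \<Longrightarrow> vector_space_over TYPE('k) (ospace (di P) n)"
  by (simp add: vector_space_tensor_space ospace_vec)

text \<open>Serves with three kinds of \<open>h\<close>: the identity, \<open>di_hom\<close>, and
  the action on fixed arguments. With \<open>h\<close> passed inside the double sum, only tensors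
  with basis vectors remain to be treated each time.\<close>

lemma linear_map_di_ocomp:
  assumes ms: "valid_arities ms" and F: "F \<in> ocarrier (di P) (length ms)" and Gs: "Gs \<in> oargs (di P) ms"
    and W: "vector_space_over TYPE('k) W" and h: "linear_map (ospace (di P) (sum_list ms)) W h"
  shows "h (ocomp (di P) ms F Gs) =
    (\<Oplus>\<^bsub>W\<^esub>k\<in>{..<length ms}. \<Oplus>\<^bsub>W\<^esub>js\<in>choices ms.
      h (di_tensor P (sum_list ms) (ocomp P ms (F k) (map2 (\<lambda>G j. G j) Gs js))
        (basis_vec (sum_list ms) (offset ms k + js ! k))))"
proof -
  let ?N = "sum_list ms" and ?T = "ospace (di P) (sum_list ms)"
  have N: "1 \<le> ?N" using valid_aritiesD(3)[OF ms] .
  have T: "vector_space_over TYPE('k) ?T" using di_ospace_vec[OF N] .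
  interpret T: vec_space ?T by (rule vec_space.intro[OF T])
  interpret W: vec_space W by (rule vec_space.intro[OF W])
  interpret N: vec_space "ospace P ?N" by (rule vec_space.intro[OF ospace_vec[OF N]])
  let ?x = "\<lambda>k js. ocomp P ms (F k) (map2 (\<lambda>G j. G j) Gs js)"
  let ?e = "\<lambda>k js. di_tensor P ?N (?x k js) (basis_vec ?N (offset ms k + js ! k))"
  have x: "?x k js \<in> ocarrier P ?N" if "k < length ms" "js \<in> choices ms" for k js
    using that F by (intro ocomp_closed ms di_choice_closed[OF Gs]) auto
  have e: "?e k js \<in> carrier ?T" if "k < length ms" "js \<in> choices ms" for k js
    using N.tensor_basis_closed[OF x[OF that]] by simp
  have "ocomp (di P) ms F Gs = (\<Oplus>\<^bsub>?T\<^esub>k\<in>{..<length ms}. \<Oplus>\<^bsub>?T\<^esub>js\<in>choices ms.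
      di_tensor P ?N (?x k js) (ocomp perm ms (basis_vec (length ms) k) (map2 basis_vec ms js)))"
    by (simp add: di_def)
  also have "\<dots> = (\<Oplus>\<^bsub>?T\<^esub>k\<in>{..<length ms}. \<Oplus>\<^bsub>?T\<^esub>js\<in>choices ms. ?e k js)"
    using e by (intro T.finsum_cong') (auto simp: ocomp_perm_basis simp del: ospace_di tensor_space_simps intro!: T.finsum_closed)
  finally have "h (ocomp (di P) ms F Gs) = h (\<Oplus>\<^bsub>?T\<^esub>k\<in>{..<length ms}. \<Oplus>\<^bsub>?T\<^esub>js\<in>choices ms. ?e k js)"
    by simp
  also have "\<dots> = (\<Oplus>\<^bsub>W\<^esub>k\<in>{..<length ms}. h (\<Oplus>\<^bsub>?T\<^esub>js\<in>choices ms. ?e k js))"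
    using e by (intro linear_map_finsum[OF T W h]) (auto simp del: ospace_di tensor_space_simps intro!: T.finsum_closed)
  also have "\<dots> = (\<Oplus>\<^bsub>W\<^esub>k\<in>{..<length ms}. \<Oplus>\<^bsub>W\<^esub>js\<in>choices ms. h (?e k js))"
  proof (rule W.finsum_cong')
    fix k assume k: "k \<in> {..<length ms}"
    show "h (\<Oplus>\<^bsub>?T\<^esub>js\<in>choices ms. ?e k js) = (\<Oplus>\<^bsub>W\<^esub>js\<in>choices ms. h (?e k js))"
      using e k by (intro linear_map_finsum[OF T W h]) (auto simp del: ospace_di tensor_space_simps)
  qed (use e linear_mapD(1)[OF h] in \<open>auto simp del: ospace_di tensor_space_simps intro!: W.finsum_closed\<close>)
  finally show ?thesis .
qed

lemma linear_map_di_oact: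
  assumes n: "1 \<le> n" and F: "F \<in> ocarrier (di P) n" and \<sigma>: "\<sigma> permutes {..<n}"
    and W: "vector_space_over TYPE('k) W" and h: "linear_map (ospace (di P) n) W h"
  shows "h (oact (di P) n \<sigma> F) =
    (\<Oplus>\<^bsub>W\<^esub>k\<in>{..<n}. h (di_tensor P n (oact P n \<sigma> (F k)) (basis_vec n (\<sigma> k))))"
proof -
  let ?T = "ospace (di P) n"
  have T: "vector_space_over TYPE('k) ?T" using di_ospace_vec[OF n] .
  interpret T: vec_space ?T by (rule vec_space.intro[OF T])
  interpret V: vec_space "ospace P n" by (rule vec_space.intro[OF ospace_vec[OF n]])
  have e: "di_tensor P n (oact P n \<sigma> (F k)) (basis_vec n (\<sigma> k)) \<in> carrier ?T" if "k < n" for k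
    using V.tensor_basis_closed[OF oact_closed[OF n \<sigma>]] F that by auto
  have "oact (di P) n \<sigma> F = (\<Oplus>\<^bsub>?T\<^esub>k\<in>{..<n}. di_tensor P n (oact P n \<sigma> (F k)) (oact perm n \<sigma> (basis_vec n k)))"
    by (simp add: di_def)
  also have "\<dots> = (\<Oplus>\<^bsub>?T\<^esub>k\<in>{..<n}. di_tensor P n (oact P n \<sigma> (F k)) (basis_vec n (\<sigma> k)))"
    using e by (intro T.finsum_cong') (auto simp: oact_perm_basis simp del: ospace_di tensor_space_simps)
  finally show ?thesis
    using linear_map_finsum[OF T W h, of "{..<n}"] e by (auto simp del: ospace_di tensor_space_simps)
qed

end

lemma linear_map_id: "linear_map V V (\<lambda>x. x)"
  by (rule linear_mapI) auto

lemma di_hom_tensor: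
  assumes P: "operad_closed P" and Q: "operad_closed Q" and h: "operad_hom P Q h"
    and n: "1 \<le> n" and x: "x \<in> ocarrier P n"
  shows "di_hom h n (di_tensor P n x (basis_vec n k)) = di_tensor Q n (h n x) (basis_vec n k)"
proof -
  interpret V: vec_space "ospace P n" by (rule vec_space.intro[OF operad_closed.ospace_vec[OF P n]])
  interpret W: vec_space "ospace Q n" by (rule vec_space.intro[OF operad_closed.ospace_vec[OF Q n]])
  have "h n \<zero>\<^bsub>ospace P n\<^esub> = \<zero>\<^bsub>ospace Q n\<^esub>"
    by (rule linear_map_zero[OF V.vec_space W.vec_space operad_homD(1)[OF h n]])
  then show ?thesis
    using operad_homD(5)[OF h n x] x by (auto simp: V.tensor_basis W.tensor_basis di_hom_def fun_eq_iff)
qed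

text \<open>The Perm factor is untouched by \<open>h\<close>, so after expansion into tensors with
  basis vectors the two sides agree summand by summand.\<close>

lemma operad_hom_di_hom:
  assumes P: "operad_closed P" and Q: "operad_closed Q" and h: "operad_hom P Q h"
  shows "operad_hom (di P) (di Q) (di_hom h)"
proof -
  interpret P: operad_closed P by fact
  interpret Q: operad_closed Q by fact
  have lin: "linear_map (ospace (di P) n) (ospace (di Q) n) (di_hom h n)" if "1 \<le> n" for n
    using linear_mapD[OF operad_homD(1)[OF h that]]
    by (intro linear_mapI) (auto simp: di_hom_def PiE_iff fun_eq_iff)
  note tensor = di_hom_tensor[OF P Q h]
  show ?thesis
    unfolding operad_hom_def
  proof (intro conjI allI impI)
    show "linear_map (ospace (di P) n) (ospace (di Q) n) (di_hom h n)" if "1 \<le> n" for n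
      using lin[OF that] .
    show "di_hom h 1 (oid (di P)) = oid (di Q)"
      using tensor[of 1 "oid P" 0] P.oid_closed' operad_homD(2)[OF h]
      by (simp add: di_def oid_perm)
  next
    fix ms F Gs assume "valid_arities ms \<and> F \<in> ocarrier (di P) (length ms) \<and> Gs \<in> oargs (di P) ms"
    then have ms: "valid_arities ms" and F: "F \<in> ocarrier (di P) (length ms)" and Gs: "Gs \<in> oargs (di P) ms"
      by auto
    note v = valid_aritiesD[OF ms]
    let ?N = "sum_list ms" and ?W = "ospace (di Q) (sum_list ms)"
    let ?F' = "di_hom h (length ms) F" and ?Gs' = "map2 (di_hom h) ms Gs"
    have F': "?F' \<in> ocarrier (di Q) (length ms)" using linear_mapD(1)[OF lin[OF v(1)] F] .
    have Gs': "?Gs' \<in> oargs (di Q) ms"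
      using linear_mapD(1)[OF lin] by (rule oargs_map2[OF ms Gs])
    have W: "vector_space_over TYPE('a) ?W" using Q.di_ospace_vec[OF v(3)] .
    interpret W: vec_space ?W by (rule vec_space.intro[OF W])
    interpret V: vec_space "ospace Q ?N" by (rule vec_space.intro[OF Q.ospace_vec[OF v(3)]])
    let ?G = "\<lambda>Gs js. map2 (\<lambda>G j. G j) Gs js"
    have x: "ocomp P ms (F k) (?G Gs js) \<in> ocarrier P ?N \<and>
        h ?N (ocomp P ms (F k) (?G Gs js)) = ocomp Q ms (?F' k) (?G ?Gs' js)"
      if "k < length ms" "js \<in> choices ms" for k js
    proof -
      have Fk: "F k \<in> ocarrier P (length ms)" using F that by auto
      have "map2 h ms (?G Gs js) = ?G ?Gs' js"
        using Gs that by (auto simp: oargs_iff choices_iff di_hom_def intro!: nth_equalityI)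
      then show ?thesis
        using operad_homD(3)[OF h ms Fk P.di_choice_closed[OF Gs that(2)]] that
          P.ocomp_closed[OF ms Fk P.di_choice_closed[OF Gs that(2)]]
        by (simp add: di_hom_def)
    qed
    have y: "ocomp Q ms (?F' k) (?G ?Gs' js) \<in> ocarrier Q ?N" if "k < length ms" "js \<in> choices ms" for k js
      using F' that by (intro Q.ocomp_closed ms Q.di_choice_closed[OF Gs']) auto
    have "di_hom h ?N (ocomp (di P) ms F Gs) = (\<Oplus>\<^bsub>?W\<^esub>k\<in>{..<length ms}. \<Oplus>\<^bsub>?W\<^esub>js\<in>choices ms.
        di_hom h ?N (di_tensor P ?N (ocomp P ms (F k) (?G Gs js)) (basis_vec ?N (offset ms k + js ! k))))"
      by (rule P.linear_map_di_ocomp[OF ms F Gs W lin[OF v(3)]])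
    also have "\<dots> = (\<Oplus>\<^bsub>?W\<^esub>k\<in>{..<length ms}. \<Oplus>\<^bsub>?W\<^esub>js\<in>choices ms.
        di_tensor Q ?N (ocomp Q ms (?F' k) (?G ?Gs' js)) (basis_vec ?N (offset ms k + js ! k)))"
      using x y V.tensor_basis_closed tensor[OF v(3)]
      by (intro W.finsum_cong') (auto simp del: tensor_space_simps intro!: W.finsum_closed[unfolded ospace_di] V.tensor_basis_closed)
    also have "\<dots> = ocomp (di Q) ms ?F' ?Gs'"
      by (rule Q.linear_map_di_ocomp[OF ms F' Gs' W linear_map_id, symmetric])
    finally show "di_hom h ?N (ocomp (di P) ms F Gs) = ocomp (di Q) ms ?F' ?Gs'" .
  next
    fix n \<sigma> F assume n: "1 \<le> (n::nat)" and *: "\<sigma> permutes {..<n} \<and> F \<in> ocarrier (di P) n"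
    then have \<sigma>: "\<sigma> permutes {..<n}" and F: "F \<in> ocarrier (di P) n" by auto
    let ?W = "ospace (di Q) n"
    have F': "di_hom h n F \<in> ocarrier (di Q) n" using linear_mapD(1)[OF lin[OF n] F] .
    have W: "vector_space_over TYPE('a) ?W" using Q.di_ospace_vec[OF n] .
    interpret W: vec_space ?W by (rule vec_space.intro[OF W])
    interpret V: vec_space "ospace Q n" by (rule vec_space.intro[OF Q.ospace_vec[OF n]])
    have x: "oact P n \<sigma> (F k) \<in> ocarrier P n \<and> h n (oact P n \<sigma> (F k)) = oact Q n \<sigma> (di_hom h n F k) \<and>
        oact Q n \<sigma> (di_hom h n F k) \<in> ocarrier Q n" if "k < n" for k
    proof -
      have Fk: "F k \<in> ocarrier P n" using F that by auto
      then show ?thesis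
        using operad_homD(4)[OF h n \<sigma> Fk] P.oact_closed[OF n \<sigma> Fk] that
          Q.oact_closed[OF n \<sigma> operad_homD(5)[OF h n Fk]] by (simp add: di_hom_def)
    qed
    have "di_hom h n (oact (di P) n \<sigma> F) = (\<Oplus>\<^bsub>?W\<^esub>k\<in>{..<n}.
        di_hom h n (di_tensor P n (oact P n \<sigma> (F k)) (basis_vec n (\<sigma> k))))"
      by (rule P.linear_map_di_oact[OF n F \<sigma> W lin[OF n]])
    also have "\<dots> = (\<Oplus>\<^bsub>?W\<^esub>k\<in>{..<n}. di_tensor Q n (oact Q n \<sigma> (di_hom h n F k)) (basis_vec n (\<sigma> k)))"
      using x V.tensor_basis_closed tensor[OF n]
      by (intro W.finsum_cong') (auto simp del: tensor_space_simps intro!: V.tensor_basis_closed)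
    also have "\<dots> = oact (di Q) n \<sigma> (di_hom h n F)"
      by (rule Q.linear_map_di_oact[OF n F' \<sigma> W linear_map_id, symmetric])
    finally show "di_hom h n (oact (di P) n \<sigma> F) = oact (di Q) n \<sigma> (di_hom h n F)" .
  qed
qed

section \<open>Doubling an algebra\<close>

text \<open>The position \<open>offset ms k + l\<close> lies in block \<open>k\<close> and, blocks
  being disjoint, in no other. This locates the distinguished argument of a composite in one of the
  inner operations.\<close>

lemma map_block_update:
  assumes "i < length ms" "k < length ms" "l < ms ! k" "length as = sum_list ms"
  shows "take (ms ! i) (drop (offset ms i) (as[offset ms k + l := a])) =
    (if i = k then (take (ms ! i) (drop (offset ms i) as))[l := a] else take (ms ! i) (drop (offset ms i) as))"
proof (rule nth_equalityI)
  have mono: "offset ms i' + ms ! i' \<le> offset ms k'" if "i' < k'" "k' \<le> length ms" for i' k'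
    using that(2,1)
  proof (induction k')
    case (Suc k')
    then show ?case
      using offset_Suc[of k' ms] offset_Suc[of i' ms] by (cases "i' = k'") auto
  qed simp
  fix j assume "j < length (take (ms ! i) (drop (offset ms i) (as[offset ms k + l := a])))"
  then have j: "j < ms ! i" by simp
  have "i \<noteq> k \<Longrightarrow> offset ms k + l \<noteq> offset ms i + j"
    using mono[of i k] mono[of k i] assms j by (cases "i < k") auto
  then show "take (ms ! i) (drop (offset ms i) (as[offset ms k + l := a])) ! j =
      (if i = k then (take (ms ! i) (drop (offset ms i) as))[l := a] else take (ms ! i) (drop (offset ms i) as)) ! j"
    using j assms offset_le[of i ms] by (auto simp: nth_list_update)
qed auto

text \<open>Given a \<open>P\<close>-algebra \<open>\<alpha>\<close> on \<open>A\<close> and linear maps \<open>p, c: E \<rightarrow> A\<close>, an element \<open>\<Sum>\<^sub>k x\<^sub>k \<otimes> e\<^sub>k\<close> of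
  \<open>di P\<close> sends \<open>a\<^sub>1, \<dots>, a\<^sub>n\<close> to \<open>\<Sum>\<^sub>k x\<^sub>k(p a\<^sub>1, \<dots>, c a\<^sub>k, \<dots>, p a\<^sub>n)\<close>.\<close>

locale di_action = operad_closed P for P :: "('k::field, 'p) operad" +
  fixes A E :: "('k, 'u) module" and \<alpha> :: "nat \<Rightarrow> 'p \<Rightarrow> 'u list \<Rightarrow> 'u" and p :: "'u \<Rightarrow> 'u"
  assumes A: "vector_space_over TYPE('k) A" and E: "vector_space_over TYPE('k) E"
    and \<alpha>: "operad_hom P (endo A) \<alpha>" and p: "linear_map E A p"
begin

sublocale A: vec_space A by (rule vec_space.intro[OF A])

definition act :: "('u \<Rightarrow> 'u) \<Rightarrow> nat \<Rightarrow> (nat \<Rightarrow> 'p) \<Rightarrow> 'u list \<Rightarrow> 'u" where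
  "act c n F as = (\<Oplus>\<^bsub>A\<^esub>k\<in>{..<n}. \<alpha> n (F k) ((map p as)[k := c (as ! k)]))"

lemma \<alpha>_multilinear: "1 \<le> n \<Longrightarrow> x \<in> ocarrier P n \<Longrightarrow> multilinear A n (\<alpha> n x)"
  using operad_homD(5)[OF \<alpha>] by auto

lemma \<alpha>_linear: "1 \<le> n \<Longrightarrow> as \<in> tuples A n \<Longrightarrow> linear_map (ospace P n) A (\<lambda>x. \<alpha> n x as)"
  using linear_map_comp[OF operad_homD(1)[OF \<alpha>] linear_map_endo_apply] .

lemma \<alpha>_closed: "1 \<le> n \<Longrightarrow> x \<in> ocarrier P n \<Longrightarrow> as \<in> tuples A n \<Longrightarrow> \<alpha> n x as \<in> carrier A"
  using linear_mapD(1)[OF \<alpha>_linear] .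

lemma map_p: "as \<in> tuples E n \<Longrightarrow> map p as \<in> tuples A n"
  using linear_mapD(1)[OF p] by (auto simp: tuples_def)

lemma args_closed:
  assumes "linear_map E A c" "as \<in> tuples E n" "k < n"
  shows "(map p as)[k := c (as ! k)] \<in> tuples A n"
  using assms by (intro tuples_update map_p linear_mapD(1)[OF assms(1)]) (auto simp: tuples_def)

lemma act_closed:
  assumes "linear_map E A c" "1 \<le> n" "F \<in> ocarrier (di P) n" "as \<in> tuples E n"
  shows "act c n F as \<in> carrier A"
  unfolding act_def using assms(3) by (intro A.finsum_closed) (auto intro!: \<alpha>_closed[OF assms(2)] args_closed[OF assms(1,4)])

lemma act_linear:
  assumes c: "linear_map E A c" and n: "1 \<le> n" and as: "as \<in> tuples E n"
  shows "linear_map (ospace (di P) n) A (\<lambda>F. act c n F as)"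
proof -
  have "linear_map (ospace (di P) n) A (\<lambda>F. \<alpha> n (F k) ((map p as)[k := c (as ! k)]))" if "k < n" for k
  proof -
    have "linear_map (ospace (di P) n) (ospace P n) (\<lambda>F. F k)"
      using that by (intro linear_mapI) auto
    from linear_map_comp[OF this \<alpha>_linear[OF n args_closed[OF c as that]]] show ?thesis .
  qed
  then show ?thesis
    unfolding act_def using di_ospace_vec[OF n] by (intro linear_map_finsum_fun A) auto
qed

lemma act_multilinear:
  assumes c: "linear_map E A c" and n: "1 \<le> n" and F: "F \<in> ocarrier (di P) n"
    and as: "as \<in> tuples E n" and l: "l < n"
  shows "linear_map E A (\<lambda>a. act c n F (as[l := a]))"
proof -
  have "linear_map E A (\<lambda>a. \<alpha> n (F k) ((map p (as[l := a]))[k := c (as[l := a] ! k)]))" if k: "k < n" for k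
  proof -
    have Fk: "F k \<in> ocarrier P n" using F k by auto
    have len: "length as = n" using as by (simp add: tuples_def)
    let ?b = "(map p as)[k := c (as ! k)]"
    have lin: "linear_map A A (\<lambda>a. \<alpha> n (F k) (?b[l := a]))"
      using multilinearD(2)[OF \<alpha>_multilinear[OF n Fk] args_closed[OF c as k] l] .
    have "(map p (as[l := a]))[k := c (as[l := a] ! k)] = ?b[l := (if l = k then c else p) a]" for a
      using len k l by (auto simp: map_update list_update_swap)
    then show ?thesis
      using linear_map_comp[OF c lin] linear_map_comp[OF p lin] by (cases "l = k") auto
  qed
  then show ?thesis
    unfolding act_def by (intro linear_map_finsum_fun A E) auto
qed

lemma act_tensor:
  assumes c: "linear_map E A c" and n: "1 \<le> n" and x: "x \<in> ocarrier P n"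
    and as: "as \<in> tuples E n" and k: "k < n"
  shows "act c n (di_tensor P n x (basis_vec n k)) as = \<alpha> n x ((map p as)[k := c (as ! k)])"
proof -
  interpret V: vec_space "ospace P n" by (rule vec_space.intro[OF ospace_vec[OF n]])
  let ?b = "\<lambda>i. (map p as)[i := c (as ! i)]"
  have "act c n (di_tensor P n x (basis_vec n k)) as =
      (\<Oplus>\<^bsub>A\<^esub>i\<in>{..<n}. if k = i then \<alpha> n x (?b i) else \<zero>\<^bsub>A\<^esub>)"
    unfolding act_def V.tensor_basis[OF x]
    using linear_map_zero[OF V.vec_space A \<alpha>_linear[OF n args_closed[OF c as]]] x
    by (intro A.finsum_cong') (auto intro!: \<alpha>_closed[OF n] args_closed[OF c as])
  also have "\<dots> = \<alpha> n x (?b k)"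
    using k x by (intro A.finsum_singleton) (auto intro!: \<alpha>_closed[OF n] args_closed[OF c as])
  finally show ?thesis .
qed

text \<open>The summand of the composite belonging to \<open>k\<close> and \<open>js\<close> has its
  distinguished argument in block \<open>k\<close>, at place \<open>js ! k\<close>. Hence block
  \<open>k\<close> is evaluated with \<open>c\<close> and every other block with \<open>p\<close>;
  there \<open>js ! i\<close> merely selects a component of \<open>Gs ! i\<close>. Summing over all
  \<open>js\<close> is the multilinear expansion of the outer operation. For a \<open>c\<close>
  other than \<open>p\<close> the result mixes both actions, so \<open>act c\<close> respects
  composition only when \<open>act p\<close> is carried along with it.\<close>

lemma act_ocomp:
  assumes c: "linear_map E A c" and ms: "valid_arities ms"
    and F: "F \<in> ocarrier (di P) (length ms)" and Gs: "Gs \<in> oargs (di P) ms"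
    and as: "as \<in> tuples E (sum_list ms)"
  defines "b \<equiv> \<lambda>i. take (ms ! i) (drop (offset ms i) as)"
  shows "act c (sum_list ms) (ocomp (di P) ms F Gs) as =
    (\<Oplus>\<^bsub>A\<^esub>k\<in>{..<length ms}. \<alpha> (length ms) (F k)
      ((map (\<lambda>i. act p (ms ! i) (Gs ! i) (b i)) [0..<length ms])[k := act c (ms ! k) (Gs ! k) (b k)]))"
proof -
  let ?N = "sum_list ms" and ?n = "length ms"
  note v = valid_aritiesD[OF ms]
  let ?G = "\<lambda>js. map2 (\<lambda>G j. G j) Gs js"
  let ?c = "\<lambda>k i. if i = k then c else p"
  have cl: "linear_map E A (?c k i)" for k i using c p by auto
  have b: "b i \<in> tuples E (ms ! i)" if "i < ?n" for i
    unfolding b_def by (rule take_drop_block[OF as that])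
  have G: "Gs ! i \<in> ocarrier (di P) (ms ! i)" "\<And>j. j < ms ! i \<Longrightarrow> (Gs ! i) j \<in> ocarrier P (ms ! i)" if "i < ?n" for i
    using Gs that by (auto simp: oargs_iff)
  have Fk: "F k \<in> ocarrier P ?n" if "k < ?n" for k using F that by auto
  let ?y = "\<lambda>k i j. \<alpha> (ms ! i) ((Gs ! i) j) ((map p (b i))[j := ?c k i (b i ! j)])"
  have y: "?y k i j \<in> carrier A" if "i < ?n" "j < ms ! i" for k i j
    using that by (intro \<alpha>_closed v(2) G(2) args_closed[OF cl b])
  have summand: "act c ?N (di_tensor P ?N (ocomp P ms (F k) (?G js)) (basis_vec ?N (offset ms k + js ! k))) as =
      \<alpha> ?n (F k) (map (\<lambda>i. ?y k i (js ! i)) [0..<?n])"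
    if k: "k < ?n" and js: "js \<in> choices ms" for k js
  proof -
    let ?l = "offset ms k + js ! k"
    have jk: "js ! k < ms ! k" using js k by (simp add: choices_iff)
    then have l: "?l < ?N" using offset_le[OF k] by simp
    have Gj: "?G js \<in> oargs P ms" by (rule di_choice_closed[OF Gs js])
    have x: "ocomp P ms (F k) (?G js) \<in> ocarrier P ?N" by (rule ocomp_closed[OF ms Fk[OF k] Gj])
    let ?as = "(map p as)[?l := c (as ! ?l)]"
    have len: "length as = ?N" "length Gs = ?n" "length js = ?n"
      using as Gs js by (auto simp: tuples_def oargs_iff choices_iff)
    have block: "take (ms ! i) (drop (offset ms i) ?as) = (map p (b i))[js ! i := ?c k i (b i ! (js ! i))]"
      if i: "i < ?n" for i
    proof -
      have ji: "js ! i < ms ! i" using js i by (simp add: choices_iff)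
      then have *: "b i ! (js ! i) = as ! (offset ms i + js ! i)" "js ! i < length (b i)"
        using offset_le[OF i] len by (auto simp: b_def)
      have "take (ms ! i) (drop (offset ms i) ?as) =
          (if i = k then (map p (b i))[js ! k := c (as ! ?l)] else map p (b i))"
        using map_block_update[OF i k jk, of "map p as" "c (as ! ?l)"] len
        by (simp add: b_def take_map drop_map)
      \<comment> \<open>Overwriting an entry by its own value under \<open>p\<close> changes
        nothing; this brings the blocks without distinguished argument into the same shape
        \<open>?y\<close> as block \<open>k\<close>.\<close>
      moreover have "(map p (b i))[js ! i := p (b i ! (js ! i))] = map p (b i)"
        by (simp flip: map_update)
      ultimately show ?thesis using *(1) by auto
    qed
    have "act c ?N (di_tensor P ?N (ocomp P ms (F k) (?G js)) (basis_vec ?N ?l)) as = \<alpha> ?N (ocomp P ms (F k) (?G js)) ?as"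
      by (rule act_tensor[OF c v(3) x as l])
    also have "\<dots> = ocomp (endo A) ms (\<alpha> ?n (F k)) (map2 \<alpha> ms (?G js)) ?as"
      by (simp only: operad_homD(3)[OF \<alpha> ms Fk[OF k] Gj])
    also have "\<dots> = \<alpha> ?n (F k) (map (\<lambda>i. (map2 \<alpha> ms (?G js) ! i) (take (ms ! i) (drop (offset ms i) ?as))) [0..<?n])"
      using args_closed[OF c as l] by simp
    also have "map (\<lambda>i. (map2 \<alpha> ms (?G js) ! i) (take (ms ! i) (drop (offset ms i) ?as))) [0..<?n] =
        map (\<lambda>i. ?y k i (js ! i)) [0..<?n]"
      using block len by (intro map_cong refl) simp
    finally show ?thesis .
  qed
  have "act c ?N (ocomp (di P) ms F Gs) as = (\<Oplus>\<^bsub>A\<^esub>k\<in>{..<?n}. \<Oplus>\<^bsub>A\<^esub>js\<in>choices ms.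
      act c ?N (di_tensor P ?N (ocomp P ms (F k) (?G js)) (basis_vec ?N (offset ms k + js ! k))) as)"
    by (rule linear_map_di_ocomp[OF ms F Gs A act_linear[OF c v(3) as]])
  also have "\<dots> = (\<Oplus>\<^bsub>A\<^esub>k\<in>{..<?n}. \<Oplus>\<^bsub>A\<^esub>js\<in>choices ms. \<alpha> ?n (F k) (map (\<lambda>i. ?y k i (js ! i)) [0..<?n]))"
  proof -
    have "\<alpha> ?n (F k) (map (\<lambda>i. ?y k i (js ! i)) [0..<?n]) \<in> carrier A" if "k < ?n" "js \<in> choices ms" for k js
      using that y by (intro \<alpha>_closed v(1) Fk) (auto simp: tuples_def choices_iff)
    then show ?thesis
      by (intro A.finsum_cong') (auto simp: summand intro!: A.finsum_closed)
  qed
  also have "\<dots> = (\<Oplus>\<^bsub>A\<^esub>k\<in>{..<?n}. \<alpha> ?n (F k)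
      ((map (\<lambda>i. act p (ms ! i) (Gs ! i) (b i)) [0..<?n])[k := act c (ms ! k) (Gs ! k) (b k)]))"
  proof (rule A.finsum_cong')
    fix k assume k: "k \<in> {..<?n}"
    have ch: "choices ms = listset (map (\<lambda>i. {..<ms ! i}) [0..<?n])"
      unfolding choices_def by (intro arg_cong[of _ _ listset] nth_equalityI) auto
    have "(\<Oplus>\<^bsub>A\<^esub>js\<in>choices ms. \<alpha> ?n (F k) (map (\<lambda>i. ?y k i (js ! i)) [0..<?n])) =
        \<alpha> ?n (F k) (map (\<lambda>i. \<Oplus>\<^bsub>A\<^esub>j\<in>{..<ms ! i}. ?y k i j) [0..<?n])"
      unfolding ch using k y
      by (intro multilinear_expand[OF A, symmetric] \<alpha>_multilinear v(1) Fk) auto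
    also have "map (\<lambda>i. \<Oplus>\<^bsub>A\<^esub>j\<in>{..<ms ! i}. ?y k i j) [0..<?n] =
        (map (\<lambda>i. act p (ms ! i) (Gs ! i) (b i)) [0..<?n])[k := act c (ms ! k) (Gs ! k) (b k)]"
      using k by (intro nth_equalityI) (auto simp: act_def nth_list_update)
    finally show "(\<Oplus>\<^bsub>A\<^esub>js\<in>choices ms. \<alpha> ?n (F k) (map (\<lambda>i. ?y k i (js ! i)) [0..<?n])) =
      \<alpha> ?n (F k) ((map (\<lambda>i. act p (ms ! i) (Gs ! i) (b i)) [0..<?n])[k := act c (ms ! k) (Gs ! k) (b k)])" .
  next
    show "(\<lambda>k. \<alpha> ?n (F k) ((map (\<lambda>i. act p (ms ! i) (Gs ! i) (b i)) [0..<?n])[k := act c (ms ! k) (Gs ! k) (b k)]))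
        \<in> {..<?n} \<rightarrow> carrier A"
    proof
      fix k assume k: "k \<in> {..<?n}"
      have "map (\<lambda>i. act p (ms ! i) (Gs ! i) (b i)) [0..<?n] \<in> tuples A ?n"
        using act_closed[OF p v(2) G(1) b] by (auto simp: tuples_def)
      then show "\<alpha> ?n (F k) ((map (\<lambda>i. act p (ms ! i) (Gs ! i) (b i)) [0..<?n])[k := act c (ms ! k) (Gs ! k) (b k)]) \<in> carrier A"
        using k act_closed[OF c v(2) G(1) b] by (intro \<alpha>_closed v(1) Fk tuples_update) auto
    qed
  qed simp
  finally show ?thesis .
qed

text \<open>The action moves the distinguished place from \<open>k\<close> to
  \<open>\<sigma> k\<close> and lets the operation read argument \<open>\<sigma> k\<close> at its
  place \<open>k\<close>, so both sides single out the same argument.\<close>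

lemma act_oact:
  assumes c: "linear_map E A c" and n: "1 \<le> n" and F: "F \<in> ocarrier (di P) n"
    and \<sigma>: "\<sigma> permutes {..<n}" and as: "as \<in> tuples E n"
  shows "act c n (oact (di P) n \<sigma> F) as = act c n F (map (\<lambda>i. as ! \<sigma> i) [0..<n])"
proof -
  have len: "length as = n" using as by (simp add: tuples_def)
  have \<sigma>i: "\<sigma> i < n" if "i < n" for i using permutes_in_image[OF \<sigma>, of i] that by simp
  have Fk: "F k \<in> ocarrier P n" if "k < n" for k using F that by auto
  have as': "map (\<lambda>i. as ! \<sigma> i) [0..<n] \<in> tuples E n" using as \<sigma>i by (auto simp: tuples_def)
  have summand: "act c n (di_tensor P n (oact P n \<sigma> (F k)) (basis_vec n (\<sigma> k))) as =
      \<alpha> n (F k) ((map p (map (\<lambda>i. as ! \<sigma> i) [0..<n]))[k := c (map (\<lambda>i. as ! \<sigma> i) [0..<n] ! k)])"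
    if k: "k < n" for k
  proof -
    let ?as = "(map p as)[\<sigma> k := c (as ! \<sigma> k)]"
    have "act c n (di_tensor P n (oact P n \<sigma> (F k)) (basis_vec n (\<sigma> k))) as = \<alpha> n (oact P n \<sigma> (F k)) ?as"
      by (rule act_tensor[OF c n oact_closed[OF n \<sigma> Fk[OF k]] as \<sigma>i[OF k]])
    also have "\<dots> = oact (endo A) n \<sigma> (\<alpha> n (F k)) ?as"
      by (simp only: operad_homD(4)[OF \<alpha> n \<sigma> Fk[OF k]])
    also have "\<dots> = \<alpha> n (F k) (map (\<lambda>i. ?as ! \<sigma> i) [0..<n])"
      using args_closed[OF c as \<sigma>i[OF k]] by simp
    also have "map (\<lambda>i. ?as ! \<sigma> i) [0..<n] = (map p (map (\<lambda>i. as ! \<sigma> i) [0..<n]))[k := c (map (\<lambda>i. as ! \<sigma> i) [0..<n] ! k)]"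
      using k \<sigma>i len permutes_inj[OF \<sigma>] by (intro nth_equalityI) (auto simp: nth_list_update inj_eq)
    finally show ?thesis .
  qed
  have "act c n (oact (di P) n \<sigma> F) as = (\<Oplus>\<^bsub>A\<^esub>k\<in>{..<n}.
      act c n (di_tensor P n (oact P n \<sigma> (F k)) (basis_vec n (\<sigma> k))) as)"
    by (rule linear_map_di_oact[OF n F \<sigma> A act_linear[OF c n as]])
  also have "\<dots> = act c n F (map (\<lambda>i. as ! \<sigma> i) [0..<n])"
  proof -
    have "\<alpha> n (F k) ((map p (map (\<lambda>i. as ! \<sigma> i) [0..<n]))[k := c (map (\<lambda>i. as ! \<sigma> i) [0..<n] ! k)]) \<in> carrier A"
      if "k < n" for k
      using that by (intro \<alpha>_closed n Fk args_closed c as')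
    then show ?thesis unfolding act_def[of c n F] using summand by (intro A.finsum_cong') auto
  qed
  finally show ?thesis .
qed

end

text \<open>Stands for A \<oplus> A, described by its projections and pairing. Algebras are formed
  within the type \<open>'u\<close>, so the direct sum cannot be taken on pairs.\<close>

locale square = vec_space A for A :: "('k::field, 'u) module" +
  fixes E :: "('k, 'u) module" and p q :: "'u \<Rightarrow> 'u" and pr :: "'u \<Rightarrow> 'u \<Rightarrow> 'u"
  assumes square_vec: "vector_space_over TYPE('k) E" and p: "linear_map E A p" and q: "linear_map E A q"
    and pr: "a \<in> carrier A \<Longrightarrow> b \<in> carrier A \<Longrightarrow> pr a b \<in> carrier E \<and> p (pr a b) = a \<and> q (pr a b) = b"
    and square_eqI: "x \<in> carrier E \<Longrightarrow> y \<in> carrier E \<Longrightarrow> p x = p y \<Longrightarrow> q x = q y \<Longrightarrow> x = y"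

text \<open>An infinite type is in bijection with its square; the direct sum on pairs is transported
  along such a bijection.\<close>

lemma (in vec_space) ex_square:
  assumes "infinite (UNIV :: 'v set)"
  obtains E p q pr where "square V E p q pr"
proof -
  obtain g :: "'v \<times> 'v \<Rightarrow> 'v" where "bij_betw g (UNIV \<times> UNIV) UNIV"
    using card_of_Times_same_infinite[OF assms] card_of_ordIso by blast
  then have g: "inj g" by (simp add: bij_betw_imp_inj_on)
  define p q pr where "p x = fst (inv_into UNIV g x)" and "q x = snd (inv_into UNIV g x)"
    and "pr a b = g (a, b)" for x a b
  have [simp]: "p (pr a b) = a" "q (pr a b) = b" "pr a b = pr a' b' \<longleftrightarrow> a = a' \<and> b = b'" for a b a' b'
    using g by (auto simp: p_def q_def pr_def inj_eq)
  define E where "E = mk_module {pr a b | a b. a \<in> carrier V \<and> b \<in> carrier V} (pr \<zero>\<^bsub>V\<^esub> \<zero>\<^bsub>V\<^esub>)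
    (\<lambda>x y. pr (p x \<oplus>\<^bsub>V\<^esub> p y) (q x \<oplus>\<^bsub>V\<^esub> q y)) (\<lambda>c x. pr (c \<odot>\<^bsub>V\<^esub> p x) (c \<odot>\<^bsub>V\<^esub> q x))"
  have [simp]: "x \<in> carrier E \<longleftrightarrow> (\<exists>a\<in>carrier V. \<exists>b\<in>carrier V. x = pr a b)"
    "\<zero>\<^bsub>E\<^esub> = pr \<zero>\<^bsub>V\<^esub> \<zero>\<^bsub>V\<^esub>"
    "x \<oplus>\<^bsub>E\<^esub> y = pr (p x \<oplus>\<^bsub>V\<^esub> p y) (q x \<oplus>\<^bsub>V\<^esub> q y)"
    "c \<odot>\<^bsub>E\<^esub> x = pr (c \<odot>\<^bsub>V\<^esub> p x) (c \<odot>\<^bsub>V\<^esub> q x)" for x y c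
    by (auto simp: E_def)
  have vsE: "vector_space_over TYPE('k) E"
  proof (rule vector_space_overI)
    show "abelian_group E"
    proof (rule abelian_groupI)
      show "\<exists>y\<in>carrier E. y \<oplus>\<^bsub>E\<^esub> x = \<zero>\<^bsub>E\<^esub>" if "x \<in> carrier E" for x
        using that by (intro bexI[of _ "pr (\<ominus>\<^bsub>V\<^esub> p x) (\<ominus>\<^bsub>V\<^esub> q x)"]) (auto simp: l_neg)
    qed (auto simp: a_assoc intro: a_comm)
  qed (auto simp: smult_l_distr smult_r_distr smult_assoc)
  have "square V E p q pr"
  proof (intro square.intro square_axioms.intro vec_space_axioms vsE)
    show "linear_map E V p" "linear_map E V q" by (auto intro!: linear_mapI)
  qed auto
  then show thesis by (rule that)
qed

locale double = operad_closed P + square A E p q pr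
  for P :: "('k::field, 'p) operad" and A E :: "('k, 'u) module" and p q pr +
  fixes \<alpha> :: "nat \<Rightarrow> 'p \<Rightarrow> 'u list \<Rightarrow> 'u"
  assumes \<alpha>: "operad_hom P (endo A) \<alpha>"

sublocale double \<subseteq> di_action P A E \<alpha> p
  using \<alpha> vec_space square_vec p operad_closed_axioms by (intro di_action.intro di_action_axioms.intro)

context double
begin

text \<open>In the first copy of A, \<open>F\<close> acts through the sum of its components. The
  second copy behaves as the module in a split null extension, the distinguished argument being the
  one taken from it.\<close>

definition dbl :: "nat \<Rightarrow> (nat \<Rightarrow> 'p) \<Rightarrow> 'u list \<Rightarrow> 'u" where
  "dbl n F = (\<lambda>as\<in>tuples E n. pr (act p n F as) (act q n F as))"

lemma dbl_apply:
  assumes "1 \<le> n" "F \<in> ocarrier (di P) n" "as \<in> tuples E n"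
  shows "dbl n F as \<in> carrier E" "p (dbl n F as) = act p n F as" "q (dbl n F as) = act q n F as"
  using pr[OF act_closed[OF p assms] act_closed[OF q assms]] assms(3) by (auto simp: dbl_def)

text \<open>A vector of \<open>E\<close> is determined by its two projections, so linearity into
  \<open>E\<close> may be tested after each of them.\<close>

lemma linear_map_squareI:
  assumes V: "\<And>x. x \<in> carrier V \<Longrightarrow> h x \<in> carrier E" "vector_space_over TYPE('k) V"
    and "linear_map V A (\<lambda>x. p (h x))" "linear_map V A (\<lambda>x. q (h x))"
  shows "linear_map V E h"
proof -
  interpret V: vec_space V by (rule vec_space.intro) fact
  interpret E: vec_space E by (rule vec_space.intro[OF square_vec])
  note p' = linear_mapD[OF p] and q' = linear_mapD[OF q]
    and ph = linear_mapD[OF assms(3)] and qh = linear_mapD[OF assms(4)]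
  show ?thesis
  proof (rule linear_mapI)
    fix x y c assume x: "x \<in> carrier V"
    show "h x \<in> carrier E" by (rule V(1)[OF x])
    show "h (c \<odot>\<^bsub>V\<^esub> x) = c \<odot>\<^bsub>E\<^esub> h x"
      using x V(1)[OF x] V(1)[OF V.smult_closed[OF x, of c]]
      by - (rule square_eqI, simp_all add: p'(3) q'(3) ph(3) qh(3))
    assume y: "y \<in> carrier V"
    show "h (x \<oplus>\<^bsub>V\<^esub> y) = h x \<oplus>\<^bsub>E\<^esub> h y"
      using x y V(1)[OF x] V(1)[OF y] V(1)[OF V.add.m_closed[OF x y]]
      by - (rule square_eqI, simp_all add: p'(2) q'(2) ph(2) qh(2))
  qed
qed

lemma dbl_closed:
  assumes n: "1 \<le> n" and F: "F \<in> ocarrier (di P) n"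
  shows "dbl n F \<in> ocarrier (endo E) n"
proof -
  have "multilinear E n (dbl n F)"
  proof (rule multilinearI)
    show "dbl n F as \<in> carrier E" if "as \<in> tuples E n" for as
      using dbl_apply(1)[OF n F that] .
    fix as i assume as: "as \<in> tuples E n" and i: "i < n"
    have upd: "as[i := a] \<in> tuples E n" if "a \<in> carrier E" for a
      using tuples_update[OF as that] .
    show "linear_map E E (\<lambda>a. dbl n F (as[i := a]))"
    proof (rule linear_map_squareI)
      show "linear_map E A (\<lambda>x. p (dbl n F (as[i := x])))"
        using act_multilinear[OF p n F as i]
        by (rule linear_map_cong) (simp_all add: dbl_apply(2)[OF n F upd] square_vec)
      show "linear_map E A (\<lambda>x. q (dbl n F (as[i := x])))"
        using act_multilinear[OF q n F as i]
        by (rule linear_map_cong) (simp_all add: dbl_apply(3)[OF n F upd] square_vec)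
    qed (use dbl_apply(1)[OF n F upd] square_vec in auto)
  qed
  then show ?thesis by (simp add: dbl_def)
qed

lemma operad_hom_dbl: "operad_hom (di P) (endo E) dbl"
  unfolding operad_hom_def
proof (intro conjI allI impI)
  fix n :: nat assume n: "1 \<le> n"
  show "linear_map (ospace (di P) n) (ospace (endo E) n) (dbl n)"
  proof (rule linear_map_endoI[OF dbl_closed[OF n] _ di_ospace_vec[OF n] square_vec])
    fix as assume as: "as \<in> tuples E n"
    note dbl_as = dbl_apply[OF n _ as]
    show "linear_map (ospace (di P) n) E (\<lambda>F. dbl n F as)"
    proof (rule linear_map_squareI[OF dbl_as(1) di_ospace_vec[OF n]])
      show "linear_map (ospace (di P) n) A (\<lambda>F. p (dbl n F as))"
        using act_linear[OF p n as] by (rule linear_map_cong) (simp_all only: dbl_as(2) di_ospace_vec[OF n])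
      show "linear_map (ospace (di P) n) A (\<lambda>F. q (dbl n F as))"
        using act_linear[OF q n as] by (rule linear_map_cong) (simp_all only: dbl_as(3) di_ospace_vec[OF n])
    qed
  qed
next
  interpret V: vec_space "ospace P 1" by (rule vec_space.intro[OF ospace_vec[OF order_refl]])
  have closed: "oid (di P) \<in> ocarrier (di P) 1"
    using V.tensor_basis_closed[OF oid_closed'] by (simp add: di_def oid_perm)
  have oid: "act c 1 (oid (di P)) as = c (as ! 0)" if c: "linear_map E A c" and as: "as \<in> tuples E 1" for c as
  proof -
    have "act c 1 (oid (di P)) as = \<alpha> 1 (oid P) ((map p as)[0 := c (as ! 0)])"
      using act_tensor[OF c order_refl oid_closed' as, of 0] by (simp add: di_def oid_perm)
    also have "\<dots> = c (as ! 0)"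
      using args_closed[OF c as, of 0] as operad_homD(2)[OF \<alpha>]
      by (auto simp: tuples_def length_Suc_conv)
    finally show ?thesis .
  qed
  show "dbl 1 (oid (di P)) = oid (endo E)"
    unfolding endo_simps
  proof (rule extensionalityI[of _ "tuples E 1"])
    fix as assume as: "as \<in> tuples E 1"
    then have a: "as ! 0 \<in> carrier E" "hd as = as ! 0" by (auto simp: tuples_def length_Suc_conv)
    have "dbl 1 (oid (di P)) as = as ! 0"
      by (rule square_eqI) (simp_all only: dbl_apply[OF order_refl closed as] oid[OF p as] oid[OF q as] a(1))
    then show "dbl 1 (oid (di P)) as = (\<lambda>as\<in>tuples E 1. hd as) as" using a(2) as by simp
  qed (auto simp: dbl_def)
next
  fix ms F Gs assume "valid_arities ms \<and> F \<in> ocarrier (di P) (length ms) \<and> Gs \<in> oargs (di P) ms"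
  then have ms: "valid_arities ms" and F: "F \<in> ocarrier (di P) (length ms)" and Gs: "Gs \<in> oargs (di P) ms"
    by auto
  note v = valid_aritiesD[OF ms]
  show "dbl (sum_list ms) (ocomp (di P) ms F Gs) = ocomp (endo E) ms (dbl (length ms) F) (map2 dbl ms Gs)"
    unfolding endo_simps
  proof (rule extensionalityI[of _ "tuples E (sum_list ms)"])
    fix as assume as: "as \<in> tuples E (sum_list ms)"
    let ?n = "length ms"
    let ?b = "\<lambda>i. take (ms ! i) (drop (offset ms i) as)"
    let ?cs = "map (\<lambda>i. (map2 dbl ms Gs ! i) (?b i)) [0..<?n]"
    have G: "length Gs = ?n" "i < ?n \<Longrightarrow> Gs ! i \<in> ocarrier (di P) (ms ! i)" for i
      using Gs by (auto simp: oargs_iff)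
    have b: "?b i \<in> tuples E (ms ! i)" if "i < ?n" for i by (rule take_drop_block[OF as that])
    have cs_nth: "?cs ! i = dbl (ms ! i) (Gs ! i) (?b i)" if "i < ?n" for i
      using that G by simp
    have cs: "?cs \<in> tuples E ?n"
      using dbl_apply(1)[OF v(2) G(2) b] G(1) by (auto simp: tuples_def)
    have "map p ?cs = map (\<lambda>i. act p (ms ! i) (Gs ! i) (?b i)) [0..<?n]"
      using dbl_apply(2)[OF v(2) G(2) b] G(1) by auto
    note map_cs = this
    \<comment> \<open>Stated for a general \<open>c\<close> because the two components of the
      doubled algebra need the same computation with \<open>c = p\<close> and
      \<open>c = q\<close>.\<close>
    have act_cs: "act c (sum_list ms) (ocomp (di P) ms F Gs) as = act c ?n F ?cs"
      if c: "linear_map E A c" "\<And>i. i < ?n \<Longrightarrow> c (?cs ! i) = act c (ms ! i) (Gs ! i) (?b i)" for c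
      unfolding act_ocomp[OF c(1) ms F Gs as] act_def[of c ?n F]
    proof (rule finsum_cong')
      fix k assume k: "k \<in> {..<?n}"
      then show "\<alpha> ?n (F k) ((map (\<lambda>i. act p (ms ! i) (Gs ! i) (?b i)) [0..<?n])[k := act c (ms ! k) (Gs ! k) (?b k)]) =
          \<alpha> ?n (F k) ((map p ?cs)[k := c (?cs ! k)])"
        using c(2)[of k] by (simp only: map_cs lessThan_iff)
    next
      show "(\<lambda>k. \<alpha> ?n (F k) ((map p ?cs)[k := c (?cs ! k)])) \<in> {..<?n} \<rightarrow> carrier A"
        using F by (intro Pi_I \<alpha>_closed v(1) args_closed c(1) cs) auto
    qed simp
    have "p (?cs ! i) = act p (ms ! i) (Gs ! i) (?b i) \<and> q (?cs ! i) = act q (ms ! i) (Gs ! i) (?b i)" if "i < ?n" for i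
      using dbl_apply(2,3)[OF v(2)[OF that] G(2)[OF that] b[OF that]] by (simp only: cs_nth[OF that])
    then have "act p (sum_list ms) (ocomp (di P) ms F Gs) as = act p ?n F ?cs"
      "act q (sum_list ms) (ocomp (di P) ms F Gs) as = act q ?n F ?cs"
      using act_cs[OF p] act_cs[OF q] by blast+
    then show "dbl (sum_list ms) (ocomp (di P) ms F Gs) as = (\<lambda>as\<in>tuples E (sum_list ms). dbl ?n F
        (map (\<lambda>i. (map2 dbl ms Gs ! i) (take (ms ! i) (drop (offset ms i) as))) [0..<?n])) as"
      using as cs by (simp add: dbl_def[of "sum_list ms"] dbl_def[of ?n])
  qed (auto simp: dbl_def)
next
  fix n \<sigma> F assume n: "1 \<le> (n::nat)" and *: "\<sigma> permutes {..<n} \<and> F \<in> ocarrier (di P) n"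
  then have \<sigma>: "\<sigma> permutes {..<n}" and F: "F \<in> ocarrier (di P) n" by auto
  show "dbl n (oact (di P) n \<sigma> F) = oact (endo E) n \<sigma> (dbl n F)"
    unfolding endo_simps
  proof (rule extensionalityI[of _ "tuples E n"])
    fix as assume as: "as \<in> tuples E n"
    have "\<sigma> i < n" if "i < n" for i using permutes_in_image[OF \<sigma>, of i] that by simp
    then have "map (\<lambda>i. as ! \<sigma> i) [0..<n] \<in> tuples E n" using as by (auto simp: tuples_def)
    then show "dbl n (oact (di P) n \<sigma> F) as = (\<lambda>as\<in>tuples E n. dbl n F (map (\<lambda>i. as ! \<sigma> i) [0..<n])) as"
      using as act_oact[OF p n F \<sigma> as] act_oact[OF q n F \<sigma> as] by (simp add: dbl_def)
  qed (auto simp: dbl_def)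
qed

text \<open>The \<open>k\<close>-th component is recovered by evaluating at \<open>a\<^sub>i \<oplus> 0\<close> for \<open>i \<noteq> k\<close> and \<open>a\<^sub>k \<oplus> a\<^sub>k\<close>.\<close>

lemma dbl_zeroD:
  assumes n: "1 \<le> n" and F: "F \<in> ocarrier (di P) n"
    and zero: "dbl n F = \<zero>\<^bsub>ospace (endo E) n\<^esub>" and k: "k < n"
  shows "\<alpha> n (F k) = \<zero>\<^bsub>ospace (endo A) n\<^esub>"
proof (rule extensionalityI[of _ "tuples A n"])
  have Fl: "F l \<in> ocarrier P n" if "l < n" for l using F that by auto
  then show "\<alpha> n (F k) \<in> extensional (tuples A n)" using operad_homD(5)[OF \<alpha> n] k by auto
  fix bs assume bs: "bs \<in> tuples A n"
  then have len: "length bs = n" and bc: "\<And>i. i < n \<Longrightarrow> bs ! i \<in> carrier A" by (auto simp: tuples_def)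
  define as where "as = map (\<lambda>i. pr (bs ! i) (if i = k then bs ! i else \<zero>\<^bsub>A\<^esub>)) [0..<n]"
  have pq: "pr (bs ! i) (if i = k then bs ! i else \<zero>\<^bsub>A\<^esub>) \<in> carrier E"
    "p (as ! i) = bs ! i" "q (as ! i) = (if i = k then bs ! i else \<zero>\<^bsub>A\<^esub>)" if "i < n" for i
    using pr[of "bs ! i" "if i = k then bs ! i else \<zero>\<^bsub>A\<^esub>"] bc[OF that] that by (auto simp: as_def)
  have as: "as \<in> tuples E n" using pq(1) by (auto simp: as_def tuples_def)
  have "length as = n" by (simp add: as_def)
  then have map_p: "map p as = bs" using pq(2) len by (intro nth_equalityI) auto
  have "\<alpha> n (F l) ((map p as)[l := q (as ! l)]) = (if k = l then \<alpha> n (F l) bs else \<zero>\<^bsub>A\<^esub>)" if l: "l < n" for l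
  proof (cases "k = l")
    case True
    then show ?thesis using map_p pq(3)[OF l] len by simp
  next
    case False
    have "\<alpha> n (F l) (bs[l := \<zero>\<^bsub>A\<^esub>]) = \<zero>\<^bsub>A\<^esub>"
      using linear_map_zero[OF A A multilinearD(2)[OF \<alpha>_multilinear[OF n Fl[OF l]] bs l]] .
    then show ?thesis using False map_p pq(3)[OF l] by simp
  qed
  then have "act q n F as = (\<Oplus>\<^bsub>A\<^esub>l\<in>{..<n}. if k = l then \<alpha> n (F l) bs else \<zero>\<^bsub>A\<^esub>)"
    unfolding act_def using \<alpha>_closed[OF n Fl bs] by (intro finsum_cong') auto
  also have "\<dots> = \<alpha> n (F k) bs"
    using k \<alpha>_closed[OF n Fl bs] by (intro finsum_singleton) auto
  finally have "\<alpha> n (F k) bs = q (dbl n F as)" using dbl_apply(3)[OF n F as] by simp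
  also have "\<dots> = q \<zero>\<^bsub>E\<^esub>" using zero as by simp
  also have "\<dots> = \<zero>\<^bsub>A\<^esub>" by (rule linear_map_zero[OF square_vec A q])
  finally show "\<alpha> n (F k) bs = \<zero>\<^bsub>ospace (endo A) n\<^esub> bs" using bs by simp
qed simp

end

section \<open>Linearization\<close>

text \<open>Relabelling keeps the shape of a tree, so any list of labels lying over the leaves of
  \<open>t\<close> can be planted on that shape. Together with \<open>relabel_leaves_eqD\<close>,
  trees over \<open>t\<close> correspond to lists over its leaves.\<close>

lemma ex_relabel:
  assumes "map c l = leaves t"
  shows "\<exists>t'. leaves t' = l \<and> relabel c t' = t"
  using assms
proof (induction t arbitrary: l)
  case (Var i)
  then show ?case by (auto simp: map_eq_Cons_conv intro!: exI[of _ "Var _"])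
next
  case (Op s ts)
  have split: "\<exists>lss. l = concat lss \<and> map (map c) lss = xss" if "map c l = concat xss" for l xss
    using that
  proof (induction xss arbitrary: l)
    case (Cons xs xss)
    then obtain l1 l2 where "l = l1 @ l2" "map c l1 = xs" "map c l2 = concat xss"
      by (auto simp: map_eq_append_conv)
    with Cons.IH[of l2] show ?case by (metis concat.simps(2) list.simps(9))
  qed simp
  obtain lss where l: "l = concat lss" "map (map c) lss = map leaves ts"
    using split[of l "map leaves ts"] Op.prems by auto
  from arg_cong[OF l(2), of length] have len: "length lss = length ts" by simp
  have "\<forall>i<length ts. \<exists>t'. leaves t' = lss ! i \<and> relabel c t' = ts ! i"
  proof (intro allI impI)
    fix i assume i: "i < length ts"
    have "map c (lss ! i) = leaves (ts ! i)"
      using arg_cong[OF l(2), of "\<lambda>xs. xs ! i"] i len by simp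
    then show "\<exists>t'. leaves t' = lss ! i \<and> relabel c t' = ts ! i"
      using i by (intro Op.IH) auto
  qed
  then obtain T where T: "\<And>i. i < length ts \<Longrightarrow> leaves (T i) = lss ! i \<and> relabel c (T i) = ts ! i"
    by metis
  have "map leaves (map T [0..<length ts]) = lss" "map (relabel c) (map T [0..<length ts]) = ts"
    using T len by (auto intro!: nth_equalityI)
  then show ?case
    by (intro exI[of _ "Op s (map T [0..<length ts])"]) (simp add: l(1))
qed

lemma relabel_leaves_eqD:
  assumes "relabel c t = relabel c u" "leaves t = leaves u"
  shows "t = u"
  using assms
proof (induction t arbitrary: u)
  case (Var i)
  then show ?case by (cases u) auto
next
  case (Op s ts)
  then obtain us where u: "u = Op s us" by (cases u) auto
  have maps: "map (relabel c) ts = map (relabel c) us" using Op.prems u by simp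
  from arg_cong[OF maps, of length] have len: "length ts = length us" by simp
  have nth: "relabel c (ts ! i) = relabel c (us ! i)" if "i < length us" for i
    using arg_cong[OF maps, of "\<lambda>xs. xs ! i"] that len by simp
  have "length (leaves (ts ! i)) = length (leaves (us ! i))" if "i < length us" for i
    using arg_cong[OF nth[OF that], of "\<lambda>t. length (leaves t)"] by simp
  \<comment> \<open>Subtrees in the same position have equally many leaves because relabelling by
    \<open>c\<close> identifies them, so the common list of leaves is cut at the same
    places.\<close>
  then have eq: "map leaves ts = map leaves us"
    using Op.prems u len by (intro concat_injective) (auto simp: set_zip)
  have "ts = us"
  proof (rule nth_equalityI)
    fix i assume i: "i < length ts"
    have "leaves (ts ! i) = leaves (us ! i)"
      using arg_cong[OF eq, of "\<lambda>xs. xs ! i"] i len by simp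
    then show "ts ! i = us ! i" using Op.IH[of "ts ! i" "us ! i"] nth i len by simp
  qed fact
  with u show ?case by simp
qed

text \<open>The lists \<open>l\<close> counted here are the ways of distributing the new variables over the leaves of
  a term whose list of leaves is \<open>w\<close>.\<close>

definition labelings :: "(nat \<Rightarrow> nat) \<Rightarrow> nat \<Rightarrow> nat list \<Rightarrow> nat list set" where
  "labelings c n w = {l. distinct l \<and> set l = {..<n} \<and> map c l = w}"

lemma labelingsD:
  assumes "l \<in> labelings c n w"
  shows "distinct l" "set l = {..<n}" "map c l = w" "length l = n" "length l = length w"
proof -
  show l: "distinct l" "set l = {..<n}" "map c l = w"
    using assms unfolding labelings_def by blast+
  show "length l = n" using distinct_card[OF l(1)] l(2) by simp
  show "length l = length w" using arg_cong[OF l(3), of length] by simp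
qed

lemma finite_labelings: "finite (labelings c n w)"
proof (rule finite_subset)
  show "labelings c n w \<subseteq> {l. set l \<subseteq> {..<n} \<and> length l = n}"
    using labelingsD(2,4) by blast
qed (simp add: finite_lists_length_eq)

text \<open>Rearranging \<open>w\<close> and the list of labels by the same permutation is
  injective. Used in both directions, this shows that the count depends only on the multiset of
  \<open>w\<close>.\<close>

lemma card_labelings_le:
  assumes "mset w' = mset w"
  shows "card (labelings c n w) \<le> card (labelings c n w')"
proof -
  obtain \<sigma> where \<sigma>: "\<sigma> permutes {..<length w}" and w': "permute_list \<sigma> w = w'"
    using mset_eq_permutation[OF assms] by blast
  show ?thesis
  proof (rule card_inj_on_le[OF _ _ finite_labelings])
    have len: "length l = length w" if "l \<in> labelings c n w" for l
      using labelingsD(5)[OF that] .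
    show "inj_on (permute_list \<sigma>) (labelings c n w)"
    proof (rule inj_onI)
      fix l l' assume l: "l \<in> labelings c n w" and l': "l' \<in> labelings c n w"
        and eq: "permute_list \<sigma> l = permute_list \<sigma> l'"
      note len' = len[OF l] len[OF l']
      show "l = l'"
      proof (rule nth_equalityI)
        fix j assume "j < length l"
        then have "j \<in> \<sigma> ` {..<length w}" using permutes_image[OF \<sigma>] len' by simp
        then obtain i where i: "i < length w" "j = \<sigma> i" by auto
        show "l ! j = l' ! j"
          using arg_cong[OF eq, of "\<lambda>xs. xs ! i"] i len' \<sigma> by (simp add: permute_list_nth)
      qed (simp add: len')
    qed
    show "permute_list \<sigma> ` labelings c n w \<subseteq> labelings c n w'"
    proof
      fix y assume "y \<in> permute_list \<sigma> ` labelings c n w"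
      then obtain l where l: "l \<in> labelings c n w" "y = permute_list \<sigma> l" by auto
      have "\<sigma> permutes {..<length l}" using \<sigma> len[OF l(1)] by simp
      then show "y \<in> labelings c n w'"
        using labelingsD(1-3)[OF l(1)] w' l(2)
        by (simp add: labelings_def flip: permute_list_map)
    qed
  qed
qed

text \<open>Inclusion-exclusion: the sum is the expansion of the product over \<open>U\<close> of 1
  + a(x), with a(x) = 0 on \<open>S\<close> and a(x) = -1 elsewhere, and every element of
  \<open>U\<close> outside \<open>S\<close> contributes a factor 0.\<close>

lemma sum_supersets:
  fixes S :: "'a set"
  assumes "finite U" "S \<subseteq> U"
  shows "(\<Sum>J\<in>Pow U. if S \<subseteq> J then (-1) ^ card (U - J) else 0) = (if S = U then 1 else (0::'b::comm_ring_1))"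
proof -
  have "(\<Sum>J\<in>Pow U. if S \<subseteq> J then (-1) ^ card (U - J) else 0) =
      (\<Sum>J\<in>Pow U. (\<Prod>x\<in>J. 1) * (\<Prod>x\<in>U - J. if x \<in> S then 0 else (-1 :: 'b)))"
  proof (rule sum.cong)
    fix J assume J: "J \<in> Pow U"
    show "(if S \<subseteq> J then (-1) ^ card (U - J) else 0) =
        (\<Prod>x\<in>J. 1) * (\<Prod>x\<in>U - J. if x \<in> S then 0 else (-1 :: 'b))"
    proof (cases "S \<subseteq> J")
      case True
      then have "(\<Prod>x\<in>U - J. if x \<in> S then 0 else (-1 :: 'b)) = (\<Prod>x\<in>U - J. -1)"
        by (intro prod.cong) auto
      then show ?thesis using True by simp
    next
      case False
      then have "\<exists>x\<in>U - J. (if x \<in> S then 0 else (-1 :: 'b)) = 0" using assms by auto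
      then have "(\<Prod>x\<in>U - J. if x \<in> S then 0 else (-1 :: 'b)) = 0"
        using assms(1) by (intro prod_zero) auto
      then show ?thesis using False by simp
    qed
  qed simp
  also have "\<dots> = (\<Prod>x\<in>U. 1 + (if x \<in> S then 0 else (-1 :: 'b)))"
    by (rule prod_add[symmetric]) fact
  also have "\<dots> = (if S = U then 1 else 0)"
  proof (cases "S = U")
    case False
    then have "\<exists>x\<in>U. 1 + (if x \<in> S then 0 else (-1 :: 'b)) = 0" using assms by auto
    then show ?thesis using False assms by (simp add: prod_zero)
  qed simp
  finally show ?thesis .
qed

text \<open>Substituting sums of variables into a tree yields each tree of the same shape lying over
  it exactly once, the choices at the leaves being independent; \<open>J\<close> limits the
  variables that are available.\<close>

lemma lookup_term_eval_sum:
  assumes "finite J"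
  shows "lookup (term_eval free_op (\<lambda>i. \<Sum>j\<in>{j\<in>J. c j = i}. pvar j) t) u =
    (if relabel c u = t \<and> set (leaves u) \<subseteq> J then 1 else (0::'k::field))"
proof (induction t arbitrary: u)
  case (Var i)
  have "lookup (\<Sum>j\<in>{j\<in>J. c j = i}. pvar j :: ('k, 'a) npoly) u =
      (\<Sum>j\<in>{j\<in>J. c j = i}. 1 when Var j = u)"
    by (simp add: lookup_sum pvar_def lookup_single)
  also have "\<dots> = (if relabel c u = Var i \<and> set (leaves u) \<subseteq> J then 1 else 0)"
  proof (cases u)
    case (Var k)
    then show ?thesis using assms by (simp add: when_def sum.delta')
  qed (auto simp: when_def)
  finally show ?case by simp
next
  case (Op s ts)
  show ?case
  proof (cases u)
    case (Op s' us)
    let ?P = "\<lambda>i. relabel c (us ! i) = ts ! i \<and> set (leaves (us ! i)) \<subseteq> J"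
    have "(\<Prod>i<length ts. if ?P i then 1 else (0::'k)) = (if \<forall>i<length ts. ?P i then 1 else 0)"
      by (cases "\<forall>i<length ts. ?P i") (auto intro: prod_zero)
    moreover have "(\<forall>i<length ts. ?P i) \<longleftrightarrow> map (relabel c) us = ts \<and> (\<forall>u\<in>set us. set (leaves u) \<subseteq> J)"
      if "length us = length ts"
      unfolding list_eq_iff_nth_eq all_set_conv_all_nth using that by auto
    ultimately show ?thesis using Op.IH Op
      by (auto simp: lookup_free_op)
  qed (simp add: lookup_free_op)
qed

lemma lookup_subst_sum:
  fixes f :: "('k::field, 'o) npoly"
  assumes f: "keys f \<subseteq> terms \<Omega>" and J: "finite J"
  shows "lookup (subst_poly \<Omega> (\<lambda>i. \<Sum>j\<in>{j\<in>J. c j = i}. pvar j) f) u =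
    (if set (leaves u) \<subseteq> J then lookup f (relabel c u) else 0)"
proof -
  let ?w = "\<lambda>i. \<Sum>j\<in>{j\<in>J. c j = i}. pvar j :: ('k, 'o) npoly"
  have w: "keys (?w i) \<subseteq> terms \<Omega>" for i
    using keys_sum[of "\<lambda>j. pvar j :: ('k, 'o) npoly" "{j\<in>J. c j = i}"] by auto
  have "lookup (subst_poly \<Omega> ?w f) u =
      (\<Sum>t\<in>keys f. lookup f t * (if relabel c u = t \<and> set (leaves u) \<subseteq> J then 1 else 0))"
    by (simp add: subst_poly_eq_sum[OF f w] lookup_sum lookup_term_eval_sum[OF J])
  also have "\<dots> = (\<Sum>t\<in>keys f.
      if relabel c u = t then if set (leaves u) \<subseteq> J then lookup f t else 0 else 0)"
    by (intro sum.cong) auto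
  also have "\<dots> = (if set (leaves u) \<subseteq> J then lookup f (relabel c u) else 0)"
    by (auto simp: sum.delta' in_keys_iff)
  finally show ?thesis .
qed

lemma lookup_polylinear_part:
  "lookup (polylinear_part n p) t = (if polylinear_term n t then lookup p t else 0)"
proof -
  let ?K = "{t \<in> keys p. polylinear_term n t}"
  have "lookup (polylinear_part n p) t = (\<Sum>u\<in>?K. if u = t then lookup p u else 0)"
    by (simp add: polylinear_part_def lookup_sum lookup_single when_def)
  then show ?thesis by (auto simp: sum.delta in_keys_iff)
qed

section \<open>Equivalence of an identity and its complete linearization\<close>

locale linearization =
  fixes \<Omega> :: "'o language" and n :: nat and f L :: "('k::field_char_0, 'o) npoly" and c :: "nat \<Rightarrow> nat"
  assumes f: "keys f \<subseteq> terms \<Omega>"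
    and count: "\<And>t i. t \<in> keys f \<Longrightarrow> count_list (leaves t) i = card {j. j < n \<and> c j = i}"
    and L: "L = polylinear_part n (subst_poly \<Omega> (\<lambda>i. \<Sum>j\<in>{j. j < n \<and> c j = i}. pvar j) f)"
begin

lemma lookup_L:
  "lookup L u = (if polylinear_term n u then lookup f (relabel c u) else 0)"
  using lookup_subst_sum[OF f, of "{..<n}" c u]
  by (simp add: L lookup_polylinear_part polylinear_term_def)

lemma L_closed: "L \<in> ocarrier (free_operad \<Omega>) n"
proof -
  have "u \<in> terms \<Omega> \<and> polylinear_term n u" if "u \<in> keys L" for u
  proof -
    have "polylinear_term n u" "relabel c u \<in> keys f"
      using that by (auto simp: in_keys_iff lookup_L split: if_splits)
    with f have "relabel c u \<in> terms \<Omega>" by blast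
    with \<open>polylinear_term n u\<close> show ?thesis by simp
  qed
  then show ?thesis by (auto simp: ocarrier_free_iff)
qed

lemma mset_leaves:
  assumes "t \<in> keys f"
  shows "mset (leaves t) = mset (map c [0..<n])"
proof (rule multiset_eqI)
  fix i
  have "card {j. j < m \<and> c j = i} = count_list (map c [0..<m]) i" for m
  proof (induction m)
    case (Suc m)
    have "{j. j < Suc m \<and> c j = i} = (if c m = i then insert m {j. j < m \<and> c j = i} else {j. j < m \<and> c j = i})"
      by (auto simp: less_Suc_eq)
    with Suc show ?case by simp
  qed simp
  then show "count (mset (leaves t)) i = count (mset (map c [0..<n])) i"
    using count[OF assms, of i] by (simp only: count_mset)
qed

text \<open>This is the product of the factorials of the fibre sizes of \<open>c\<close> on
  \<open>{..<n}\<close>, which are the degrees of each term of \<open>f\<close> in the single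
  variables. Defined as a count, it is positive as soon as one labeling is exhibited, and its value
  need not be computed.\<close>

definition N :: nat where
  "N = card (labelings c n (map c [0..<n]))"

lemma N_pos: "0 < N"
proof -
  have "[0..<n] \<in> labelings c n (map c [0..<n])" by (auto simp: labelings_def)
  then show ?thesis unfolding N_def using finite_labelings card_gt_0_iff by blast
qed

text \<open>The shape of \<open>u\<close> is that of \<open>t\<close>, so \<open>u\<close> amounts
  to its list of leaves. All terms of \<open>f\<close> have the same leaves up to order, so the
  count does not depend on \<open>t\<close>.\<close>

lemma card_fibre:
  assumes "t \<in> keys f"
  shows "card {u. polylinear_term n u \<and> relabel c u = t} = N"
proof -
  have "bij_betw leaves {u. polylinear_term n u \<and> relabel c u = t} (labelings c n (leaves t))"
  proof (rule bij_betw_imageI)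
    show "inj_on leaves {u. polylinear_term n u \<and> relabel c u = t}"
    proof (rule inj_onI)
      fix u u' assume "u \<in> {u. polylinear_term n u \<and> relabel c u = t}"
        "u' \<in> {u. polylinear_term n u \<and> relabel c u = t}" "leaves u = leaves u'"
      then show "u = u'" using relabel_leaves_eqD[of c u u'] by simp
    qed
    show "leaves ` {u. polylinear_term n u \<and> relabel c u = t} = labelings c n (leaves t)"
    proof (intro equalityI subsetI)
      fix l assume l: "l \<in> labelings c n (leaves t)"
      obtain u where u: "leaves u = l" "relabel c u = t"
        using ex_relabel[OF labelingsD(3)[OF l]] by blast
      have "polylinear_term n u" using labelingsD(1,2)[OF l] u(1) by (simp add: polylinear_term_def)
      with u show "l \<in> leaves ` {u. polylinear_term n u \<and> relabel c u = t}" by blast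
    next
      fix l assume "l \<in> leaves ` {u. polylinear_term n u \<and> relabel c u = t}"
      then obtain u where "l = leaves u" "polylinear_term n u" "relabel c u = t" by blast
      then show "l \<in> labelings c n (leaves t)"
        using leaves_relabel[of c u] by (simp add: labelings_def polylinear_term_def)
    qed
  qed
  then have "card {u. polylinear_term n u \<and> relabel c u = t} = card (labelings c n (leaves t))"
    by (rule bij_betw_same_card)
  also have "\<dots> = N"
    unfolding N_def using mset_leaves[OF assms]
    by (intro antisym card_labelings_le) auto
  finally show ?thesis .
qed

text \<open>Each term \<open>t\<close> of \<open>f\<close> is the image of exactly \<open>N\<close>
  terms of \<open>L\<close>, and all of them carry the coefficient of \<open>t\<close>.\<close>

lemma subst_L: "subst_poly \<Omega> (\<lambda>j. pvar (c j)) L = Poly_Mapping.map ((*) (of_nat N)) f"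
proof (rule poly_mapping_eqI)
  fix t
  have LT: "keys L \<subseteq> terms \<Omega>" using L_closed by (simp add: ocarrier_free_iff)
  have "lookup (subst_poly \<Omega> (\<lambda>j. pvar (c j)) L) t =
      (\<Sum>u\<in>keys L. if relabel c u = t then lookup L u else 0)"
    by (simp add: subst_poly_eq_sum[OF LT] lookup_sum term_eval_free_relabel lookup_single when_def)
  also have "\<dots> = (\<Sum>u\<in>{u \<in> keys L. relabel c u = t}. lookup f t)"
    by (rule sum.mono_neutral_cong_right) (auto simp: in_keys_iff lookup_L split: if_splits)
  also have "\<dots> = of_nat (card {u \<in> keys L. relabel c u = t}) * lookup f t"
    by simp
  also have "\<dots> = of_nat N * lookup f t"
  proof (cases "t \<in> keys f")
    case True
    then have "{u \<in> keys L. relabel c u = t} = {u. polylinear_term n u \<and> relabel c u = t}"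
      by (auto simp: in_keys_iff lookup_L)
    then show ?thesis using card_fibre[OF True] by simp
  qed (simp add: in_keys_iff)
  finally show "lookup (subst_poly \<Omega> (\<lambda>j. pvar (c j)) L) t =
      lookup (Poly_Mapping.map ((*) (of_nat N)) f) t" by simp
qed

text \<open>The polarization formula: the substitution belonging to \<open>J\<close> keeps the terms
  with leaves in \<open>J\<close>, and the alternating sum keeps those whose leaves fill
  \<open>{..<n}\<close>. Taking the polylinear part is not a substitution, so it is this form that
  carries identities from \<open>f\<close> to \<open>L\<close>.\<close>

lemma L_eq_sum:
  "L = (\<Sum>J\<in>Pow {..<n}. Poly_Mapping.map ((*) ((-1) ^ card ({..<n} - J)))
    (subst_poly \<Omega> (\<lambda>i. \<Sum>j\<in>{j\<in>J. c j = i}. pvar j) f))"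
proof (rule poly_mapping_eqI)
  fix u :: "'o tm"
  let ?S = "set (leaves u)"
  have fin: "finite J" if "J \<in> Pow {..<n}" for J using that by (auto intro: finite_subset)
  have "lookup (\<Sum>J\<in>Pow {..<n}. Poly_Mapping.map ((*) ((-1) ^ card ({..<n} - J)))
      (subst_poly \<Omega> (\<lambda>i. \<Sum>j\<in>{j\<in>J. c j = i}. pvar j) f)) u =
    (\<Sum>J\<in>Pow {..<n}. lookup f (relabel c u) * (if ?S \<subseteq> J then (-1) ^ card ({..<n} - J) else 0))"
    unfolding lookup_sum lookup_map_times
    by (intro sum.cong refl) (simp add: lookup_subst_sum[OF f fin])
  also have "\<dots> = lookup f (relabel c u) *
      (\<Sum>J\<in>Pow {..<n}. if ?S \<subseteq> J then (-1) ^ card ({..<n} - J) else 0)"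
    by (simp only: sum_distrib_left)
  also have "\<dots> = lookup L u"
  proof (cases "?S \<subseteq> {..<n} \<and> relabel c u \<in> keys f")
    case True
    \<comment> \<open>By multihomogeneity every term of \<open>f\<close> has \<open>n\<close>
      leaves, so a term over it that uses all \<open>n\<close> variables uses each of them
      once.\<close>
    have "length (leaves u) = n"
      using arg_cong[OF mset_leaves[of "relabel c u"], of size] True by simp
    then have "distinct (leaves u)" if "?S = {..<n}"
      using that by (intro card_distinct) simp
    then have "polylinear_term n u \<longleftrightarrow> ?S = {..<n}"
      unfolding polylinear_term_def by blast
    then show ?thesis using True by (simp add: sum_supersets lookup_L)
  next
    case False
    then show ?thesis
    proof (cases "relabel c u \<in> keys f")
      case True
      then have "(\<Sum>J\<in>Pow {..<n}. if ?S \<subseteq> J then (-1) ^ card ({..<n} - J) else 0) = (0::'k)"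
        using False by (intro sum.neutral) auto
      then show ?thesis using True False by (auto simp: lookup_L polylinear_term_def)
    qed (simp add: in_keys_iff lookup_L)
  qed
  finally show "lookup L u = lookup (\<Sum>J\<in>Pow {..<n}.
    Poly_Mapping.map ((*) ((-1) ^ card ({..<n} - J)))
      (subst_poly \<Omega> (\<lambda>i. \<Sum>j\<in>{j\<in>J. c j = i}. pvar j) f)) u" ..
qed

lemma is_identity_iff:
  assumes "algebra_of_type \<Omega> (A, ops)"
  shows "is_identity (A, ops) f \<longleftrightarrow> is_identity (A, ops) L"
proof
  interpret algebra_of \<Omega> A ops by (rule algebra_of.intro) fact
  have LT: "keys L \<subseteq> terms \<Omega>" using L_closed by (simp add: ocarrier_free_iff)
  {
    assume id: "is_identity (A, ops) f"
    show "is_identity (A, ops) L"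
      unfolding is_identity_def
    proof (intro allI impI)
      fix v :: "nat \<Rightarrow> 'a" assume "\<forall>i. v i \<in> carrier (fst (A, ops))"
      then have v: "v i \<in> carrier A" for i by simp
      let ?w = "\<lambda>J i. \<Sum>j\<in>{j\<in>J. c j = i}. pvar j :: ('k, 'o) npoly"
      have w: "keys (?w J i) \<subseteq> terms \<Omega>" for J i
        using keys_sum[of "\<lambda>j. pvar j :: ('k, 'o) npoly" "{j\<in>J. c j = i}"] by auto
      have g: "keys (subst_poly \<Omega> (?w J) f) \<subseteq> terms \<Omega>" for J
        using free.poly_eval_closed[OF f, of "?w J"] w by simp
      have "poly_eval (A, ops) v (Poly_Mapping.map ((*) a) (subst_poly \<Omega> (?w J) f)) = \<zero>\<^bsub>A\<^esub>" for a J
      proof -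
        have "poly_eval (A, ops) v (subst_poly \<Omega> (?w J) f) = poly_eval (A, ops) (\<lambda>i. poly_eval (A, ops) v (?w J i)) f"
          by (rule poly_eval_subst[OF f w v])
        also have "\<dots> = \<zero>\<^bsub>A\<^esub>"
          using id poly_eval_closed[OF w v] by (simp add: is_identity_def)
        finally show ?thesis
          using linear_mapD(3)[OF linear_poly_eval[of v, OF v], of "subst_poly \<Omega> (?w J) f" a] g by simp
      qed
      moreover have "keys (Poly_Mapping.map ((*) a) (subst_poly \<Omega> (?w J) f)) \<subseteq> terms \<Omega>" for a J
        using keys_map_times g by (rule subset_trans)
      ultimately show "poly_eval (A, ops) v L = \<zero>\<^bsub>fst (A, ops)\<^esub>"
        using v unfolding L_eq_sum by (subst poly_eval_sum) (auto intro!: finsum_all_zero)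
    qed
  next
    assume id: "is_identity (A, ops) L"
    show "is_identity (A, ops) f"
      unfolding is_identity_def
    proof (intro allI impI)
      fix v :: "nat \<Rightarrow> 'a" assume "\<forall>i. v i \<in> carrier (fst (A, ops))"
      then have v: "v i \<in> carrier A" for i by simp
      have "of_nat N \<odot>\<^bsub>A\<^esub> poly_eval (A, ops) v f = poly_eval (A, ops) v (subst_poly \<Omega> (\<lambda>j. pvar (c j)) L)"
        using linear_mapD(3)[OF linear_poly_eval[of v, OF v], of f "of_nat N"] f by (simp add: subst_L)
      also have "\<dots> = poly_eval (A, ops) (\<lambda>i. poly_eval (A, ops) v (pvar (c i))) L"
        using v by (intro poly_eval_subst LT) auto
      also have "\<dots> = \<zero>\<^bsub>A\<^esub>"
        using id v by (simp add: is_identity_def poly_eval_closed)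
      \<comment> \<open>Characteristic zero enters here: \<open>N\<close> is positive, hence
        invertible as a scalar.\<close>
      finally show "poly_eval (A, ops) v f = \<zero>\<^bsub>fst (A, ops)\<^esub>"
        using smult_eq_zeroD[OF _ _ poly_eval_closed[OF f v]] N_pos by simp
    qed
  }
qed

end

section \<open>Algebras over operads\<close>

text \<open>The bridge from polynomial identities to operads: evaluation and \<open>g\<close> agree
  on generators, hence on the whole free operad, so the operation defined by a polylinear
  \<open>p\<close> is \<open>g n p\<close>.\<close>

lemma algebra_of_operad_hom:
  fixes A :: "('k::field, 'u) module" and ops :: "'o \<Rightarrow> 'u list \<Rightarrow> 'u"
  assumes \<Omega>: "is_language \<Omega>" and A: "vector_space_over TYPE('k) A"
    and g: "operad_hom (free_operad \<Omega>) (endo A) g"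
    and ops: "\<And>s. s \<in> symb \<Omega> \<Longrightarrow> ops s = g (ar \<Omega> s) (generator \<Omega> s)"
  shows "algebra_of_type \<Omega> (A, ops)"
    and "\<And>n p. 1 \<le> n \<Longrightarrow> p \<in> ocarrier (free_operad \<Omega>) n \<Longrightarrow>
      is_identity (A, ops) p \<longleftrightarrow> g n p = \<zero>\<^bsub>ospace (endo A) n\<^esub>"
proof -
  have ops_endo: "ops s \<in> ocarrier (endo A) (ar \<Omega> s)" if s: "s \<in> symb \<Omega>" for s
  proof -
    have "2 \<le> ar \<Omega> s" using \<Omega> s by (simp add: is_language_def)
    then show ?thesis
      using operad_homD(5)[OF g _ generator_closed[OF s]] by (simp add: ops[OF s])
  qed
  then show alg: "algebra_of_type \<Omega> (A, ops)"
    using A by (simp add: algebra_of_type_def)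
  interpret algebra_of \<Omega> A ops by (rule algebra_of.intro) fact
  fix n p assume n: "1 \<le> (n::nat)" and p: "p \<in> ocarrier (free_operad \<Omega> :: ('k, ('k, 'o) npoly) operad) n"
  have "eval_hom (A, ops) n p = g n p"
  proof (rule operad_hom_free_unique[OF \<Omega> vector_space_endo[OF A] operad_hom_eval g _ n p])
    show "eval_hom (A, ops) (ar \<Omega> s) (generator \<Omega> s) = g (ar \<Omega> s) (generator \<Omega> s)" if "s \<in> symb \<Omega>" for s
      using ops_endo[OF that] by (simp add: eval_hom_generator[OF that] ops[OF that, symmetric] extensional_restrict)
  qed
  then show "is_identity (A, ops) p \<longleftrightarrow> g n p = \<zero>\<^bsub>ospace (endo A) n\<^esub>"
    using is_identity_iff_eval_hom[OF p] by simp
qed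

lemma algebrasD:
  assumes "(A, \<alpha>) \<in> algebras P"
  shows "vector_space_over TYPE('k::field) (A :: ('k, 'u) module)" "operad_hom P (endo A) \<alpha>"
  using assms by (auto simp: algebras_def)

lemma special_algebrasE:
  assumes "(A, \<alpha>) \<in> special_algebras P R \<omega>"
  obtains \<beta> where "(A, \<alpha>) \<in> algebras P" "(A, \<beta>) \<in> algebras R"
    "\<forall>n\<ge>1. \<forall>f\<in>ocarrier P n. \<alpha> n f = \<beta> n (\<omega> n f)"
  using assms by (auto simp: special_algebras_def)

lemma is_identity_operad_alg:
  assumes "is_language \<Omega>" "operad_hom (free_operad \<Omega>) P \<pi>" "(A, \<alpha>) \<in> algebras P"
    and "1 \<le> n" "p \<in> ocarrier (free_operad \<Omega>) n"
  shows "is_identity (operad_alg \<Omega> \<pi> (A, \<alpha>)) p \<longleftrightarrow> \<alpha> n (\<pi> n p) = \<zero>\<^bsub>ospace (endo A) n\<^esub>"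
  unfolding operad_alg_def prod.case
  by (rule algebra_of_operad_hom(2)[OF assms(1) algebrasD(1)[OF assms(3)]
        operad_hom_comp[OF assms(2) algebrasD(2)[OF assms(3)]] _ assms(4,5)]) (rule refl)

lemma governsD:
  assumes "governs \<Omega> V P \<pi>"
  shows "operad P" "operad_closed P" "operad_hom (free_operad \<Omega>) P \<pi>"
    and "1 \<le> n \<Longrightarrow> \<pi> n ` ocarrier (free_operad \<Omega>) n = ocarrier P n"
    and "1 \<le> n \<Longrightarrow> f \<in> ocarrier (free_operad \<Omega>) n \<Longrightarrow>
      \<pi> n f = \<zero>\<^bsub>ospace P n\<^esub> \<longleftrightarrow> (\<forall>B\<in>V. is_identity B f)"
proof -
  show "operad P" and "operad_hom (free_operad \<Omega>) P \<pi>"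
    using assms by (auto simp: governs_def)
  then show "operad_closed P" using operad.operad_closed by blast
  show "\<pi> n ` ocarrier (free_operad \<Omega>) n = ocarrier P n" if "1 \<le> n"
    using assms that by (auto simp: governs_def)
  assume n: "1 \<le> n" and f: "f \<in> ocarrier (free_operad \<Omega>) n"
  have "{f \<in> ocarrier (free_operad \<Omega>) n. \<pi> n f = \<zero>\<^bsub>ospace P n\<^esub>} = ocarrier (free_operad \<Omega>) n \<inter> identities \<Omega> V"
    using assms n by (simp add: governs_def)
  then have "\<pi> n f = \<zero>\<^bsub>ospace P n\<^esub> \<longleftrightarrow> f \<in> identities \<Omega> V" using f by blast
  also have "\<dots> \<longleftrightarrow> (\<forall>B\<in>V. is_identity B f)"
    using f by (auto simp: identities_def free_module_eq ocarrier_free_iff)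
  finally show "\<pi> n f = \<zero>\<^bsub>ospace P n\<^esub> \<longleftrightarrow> (\<forall>B\<in>V. is_identity B f)" .
qed

text \<open>Elements of the kernel of \<pi> are identities of the variety, so evaluation in one of
  its algebras factors through \<open>P\<close>.\<close>

lemma variety_algebra:
  fixes A :: "('k::field, 'u) module"
  assumes gov: "governs \<Omega> (variety \<Omega> S :: ('k, 'o, 'u) alg set) P \<pi>" and A: "(A, ops) \<in> variety \<Omega> S"
  obtains \<alpha> where "(A, \<alpha>) \<in> algebras P"
    "\<forall>n\<ge>1. \<forall>f\<in>ocarrier (free_operad \<Omega>) n.
      is_identity (A, ops) f \<longleftrightarrow> \<alpha> n (\<pi> n f) = \<zero>\<^bsub>ospace (endo A) n\<^esub>"
proof -
  note g = governsD[OF gov]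
  interpret algebra_of \<Omega> A ops
    by (rule algebra_of.intro) (use A in \<open>auto simp: variety_def\<close>)
  let ?\<alpha> = "\<lambda>n x. eval_hom (A, ops) n (inv_into (ocarrier (free_operad \<Omega>) n) (\<pi> n) x)"
  have ker: "eval_hom (A, ops) n f = \<zero>\<^bsub>ospace (endo A) n\<^esub>"
    if "1 \<le> n" "f \<in> ocarrier (free_operad \<Omega>) n" "\<pi> n f = \<zero>\<^bsub>ospace P n\<^esub>" for n f
    using g(5)[OF that(1,2)] that(3) A is_identity_iff_eval_hom[OF that(2)] by simp
  have hom: "operad_hom P (endo A) ?\<alpha>"
    by (rule operad_hom_factor(1)[OF operad_closed_free vector_space_endo[OF vec_space]
          operad_closed.ospace_vec[OF g(2)] g(3) operad_hom_eval g(4) ker])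
  have fac: "?\<alpha> n (\<pi> n f) = eval_hom (A, ops) n f" if "1 \<le> n" "f \<in> ocarrier (free_operad \<Omega>) n" for n f
    by (rule operad_hom_factor(2)[OF operad_closed_free vector_space_endo[OF vec_space]
          operad_closed.ospace_vec[OF g(2)] g(3) operad_hom_eval g(4) ker that])
  show thesis
  proof (rule that)
    show "(A, ?\<alpha>) \<in> algebras P"
      unfolding algebras_def mem_Collect_eq prod.case by (intro conjI vec_space hom)
    show "\<forall>n\<ge>1. \<forall>f\<in>ocarrier (free_operad \<Omega>) n.
        is_identity (A, ops) f \<longleftrightarrow> ?\<alpha> n (\<pi> n f) = \<zero>\<^bsub>ospace (endo A) n\<^esub>"
      by (intro allI impI ballI) (simp only: fac is_identity_iff_eval_hom)
  qed
qed

lemma algebra_zero: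
  assumes A: "(A, \<alpha>) \<in> algebras P" and P: "operad_closed P" and n: "1 \<le> n"
  shows "\<alpha> n \<zero>\<^bsub>ospace P n\<^esub> = \<zero>\<^bsub>ospace (endo A) n\<^esub>"
  using linear_map_zero[OF operad_closed.ospace_vec[OF P n] vector_space_endo[OF algebrasD(1)[OF A]]
      operad_homD(1)[OF algebrasD(2)[OF A] n]] .

lemma di_algebra_zero:
  assumes A: "(A, \<alpha>) \<in> algebras (di P)" and P: "operad_closed P" and n: "1 \<le> n"
    and F: "F \<in> ocarrier (di P) n" "\<And>k. k < n \<Longrightarrow> F k = \<zero>\<^bsub>ospace P n\<^esub>"
  shows "\<alpha> n F = \<zero>\<^bsub>ospace (endo A) n\<^esub>"
proof -
  have "F = \<zero>\<^bsub>ospace (di P) n\<^esub>"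
    using F by (auto simp: PiE_iff intro!: extensionalityI[of _ "{..<n}"])
  then show ?thesis
    using linear_map_zero[OF operad_closed.di_ospace_vec[OF P n] vector_space_endo[OF algebrasD(1)[OF A]]
        operad_homD(1)[OF algebrasD(2)[OF A] n]] by simp
qed

text \<open>By \<open>variety_algebra\<close> the algebras of the variety come from
  \<open>P\<close>-algebras, so an identity of all \<open>P\<close>-algebras is one of the variety,
  and the polylinear ones among these make up the kernel of \<pi> by \<open>governs\<close>.\<close>

lemma identity_of_algebras_iff:
  fixes S :: "('k::field, 'o) npoly set" and P :: "('k, 'p) operad"
  assumes \<Omega>: "is_language \<Omega>" and gov: "governs \<Omega> (variety \<Omega> S :: ('k, 'o, 'u) alg set) P \<pi>"
    and n: "1 \<le> n" and f: "f \<in> ocarrier (free_operad \<Omega>) n"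
  shows "(\<forall>A \<in> (algebras P :: (('k, 'u) module \<times> (nat \<Rightarrow> 'p \<Rightarrow> 'u list \<Rightarrow> 'u)) set).
      is_identity (operad_alg \<Omega> \<pi> A) f) \<longleftrightarrow> \<pi> n f = \<zero>\<^bsub>ospace P n\<^esub>"
proof
  note g = governsD[OF gov]
  {
    assume id: "\<forall>A \<in> (algebras P :: (('k, 'u) module \<times> (nat \<Rightarrow> 'p \<Rightarrow> 'u list \<Rightarrow> 'u)) set).
      is_identity (operad_alg \<Omega> \<pi> A) f"
    have "is_identity B f" if B: "B \<in> variety \<Omega> S" for B :: "('k, 'o, 'u) alg"
    proof -
      obtain A ops where [simp]: "B = (A, ops)" by (cases B)
      have "(A, ops) \<in> variety \<Omega> S" using B by simp
      then obtain \<alpha> where \<alpha>: "(A, \<alpha>) \<in> algebras P"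
        "\<forall>n\<ge>1. \<forall>f\<in>ocarrier (free_operad \<Omega>) n.
          is_identity (A, ops) f \<longleftrightarrow> \<alpha> n (\<pi> n f) = \<zero>\<^bsub>ospace (endo A) n\<^esub>"
        by (rule variety_algebra[OF gov])
      have "is_identity (operad_alg \<Omega> \<pi> (A, \<alpha>)) f" using id \<alpha>(1) by blast
      then show ?thesis using is_identity_operad_alg[OF \<Omega> g(3) \<alpha>(1) n f] \<alpha>(2) n f by simp
    qed
    then show "\<pi> n f = \<zero>\<^bsub>ospace P n\<^esub>" using g(5)[OF n f] by blast
  next
    assume zero: "\<pi> n f = \<zero>\<^bsub>ospace P n\<^esub>"
    show "\<forall>A \<in> (algebras P :: (('k, 'u) module \<times> (nat \<Rightarrow> 'p \<Rightarrow> 'u list \<Rightarrow> 'u)) set).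
      is_identity (operad_alg \<Omega> \<pi> A) f"
    proof clarify
      fix A :: "('k, 'u) module" and \<alpha> assume A: "(A, \<alpha>) \<in> algebras P"
      show "is_identity (operad_alg \<Omega> \<pi> (A, \<alpha>)) f"
        using is_identity_operad_alg[OF \<Omega> g(3) A n f] algebra_zero[OF A g(2) n] zero by simp
    qed
  }
qed

lemma (in double) in_algebras: "(E, dbl) \<in> algebras (di P)"
  using square_vec operad_hom_dbl by (simp add: algebras_def)

text \<open>In the application \<beta> is the structure of the same space over another operad, and
  the right-hand side is its action; this compares the doubled algebras formed over \<open>P\<close>
  and over \<open>R\<close>.\<close>

lemma (in di_action) act_cong:
  assumes "linear_map E A c" "1 \<le> n" "F \<in> ocarrier (di P) n" "as \<in> tuples E n"
    and "\<And>k. k < n \<Longrightarrow> \<alpha> n (F k) = \<beta> n (G k)"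
  shows "act c n F as = (\<Oplus>\<^bsub>A\<^esub>k\<in>{..<n}. \<beta> n (G k) ((map p as)[k := c (as ! k)]))"
proof -
  have "\<beta> n (G k) ((map p as)[k := c (as ! k)]) \<in> carrier A" if k: "k < n" for k
    unfolding assms(5)[OF k, symmetric] using assms(3) k
    by (intro \<alpha>_closed[OF assms(2)] args_closed[OF assms(1,4)]) auto
  then show ?thesis
    unfolding act_def by (intro A.finsum_cong') (simp_all add: assms(5))
qed

lemma is_language_doubled: "is_language \<Omega> \<Longrightarrow> is_language (doubled \<Omega>)"
  by (auto simp: is_language_def doubled_def)

lemma complete_linearizationE:
  fixes f :: "('k::field_char_0, 'o) npoly"
  assumes "complete_linearization \<Omega> n f L" "f \<in> carrier (free_module \<Omega>)"
  obtains c where "linearization \<Omega> n f L c"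
  using assms by (auto simp: complete_linearization_def linearization_def free_module_eq)

theorem corollary3:
  fixes \<Omega> :: "'o language" and \<Xi> :: "'x language"
    and S :: "('k::field_char_0, 'o) npoly set" and S' :: "('k, 'x) npoly set"
    and P :: "('k, 'p) operad" and R :: "('k, 'r) operad"
    and \<pi> :: "nat \<Rightarrow> ('k, 'o) npoly \<Rightarrow> 'p" and \<rho> :: "nat \<Rightarrow> ('k, 'x) npoly \<Rightarrow> 'r"
    and \<omega> :: "nat \<Rightarrow> ('k, 'o) npoly \<Rightarrow> ('k, 'x) npoly"
    and \<zeta> :: "nat \<Rightarrow> ('k, 'o \<times> nat) npoly \<Rightarrow> nat \<Rightarrow> ('k, 'o) npoly"
    and f L :: "('k, 'o \<times> nat) npoly" and n :: nat
  assumes universe: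
      "(UNIV :: 'k set) \<lesssim> (UNIV :: 'u set)"
      "symb \<Omega> \<lesssim> (UNIV :: 'u set)"
      "symb \<Xi> \<lesssim> (UNIV :: 'u set)"
    and languages: "is_language \<Omega>" "is_language \<Xi>"
    and polylinear_axioms:
      "S \<subseteq> (\<Union>m\<in>{1..}. ocarrier (free_operad \<Omega>) m)"
      "S' \<subseteq> (\<Union>m\<in>{1..}. ocarrier (free_operad \<Xi>) m)"
    and P: "governs \<Omega> (variety \<Omega> S :: ('k, 'o, 'u) alg set) P \<pi>"
    and R: "governs \<Xi> (variety \<Xi> S' :: ('k, 'x, 'u) alg set) R \<rho>"
    and \<omega>: "operad_hom (free_operad \<Omega>) (free_operad \<Xi>) \<omega>"
    and induces: "induces \<Omega> P \<pi> R \<rho> \<omega>"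
    and \<zeta>: "is_zeta \<Omega> \<zeta>"
    and f: "f \<in> carrier (free_module (doubled \<Omega>))"
    and L: "1 \<le> n" "complete_linearization (doubled \<Omega>) n f L"
  defines "\<omega>\<^sub>P \<equiv> induced_hom \<Omega> \<pi> \<rho> \<omega>"
  shows
    "((\<forall>B \<in> (special_algebras (di P) (di R) (di_hom \<omega>\<^sub>P) ::
             (('k, 'u) module \<times> (nat \<Rightarrow> (nat \<Rightarrow> 'p) \<Rightarrow> 'u list \<Rightarrow> 'u)) set).
         is_identity (di_operad_alg \<Omega> P \<pi> B) f) \<and>
      \<not> (\<forall>B \<in> (algebras (di P) ::
             (('k, 'u) module \<times> (nat \<Rightarrow> (nat \<Rightarrow> 'p) \<Rightarrow> 'u list \<Rightarrow> 'u)) set).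
         is_identity (di_operad_alg \<Omega> P \<pi> B) f))
     \<longleftrightarrow>
     (\<exists>fs. (\<forall>k<n. fs k \<in> ocarrier (free_operad \<Omega>) n) \<and>
        \<zeta> n L = (\<Oplus>\<^bsub>ospace (di (free_operad \<Omega>)) n\<^esub>k\<in>{..<n}.
                  di_tensor (free_operad \<Omega>) n (fs k) (basis_vec n k)) \<and>
        (\<forall>k<n. \<forall>A \<in> (special_algebras P R \<omega>\<^sub>P ::
             (('k, 'u) module \<times> (nat \<Rightarrow> 'p \<Rightarrow> 'u list \<Rightarrow> 'u)) set).
           is_identity (operad_alg \<Omega> \<pi> A) (fs k)) \<and>
        (\<exists>k<n. \<not> (\<forall>A \<in> (algebras P ::
             (('k, 'u) module \<times> (nat \<Rightarrow> 'p \<Rightarrow> 'u list \<Rightarrow> 'u)) set).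
           is_identity (operad_alg \<Omega> \<pi> A) (fs k))))"
proof -
  let ?alg = "algebras P :: (('k, 'u) module \<times> (nat \<Rightarrow> 'p \<Rightarrow> 'u list \<Rightarrow> 'u)) set"
  let ?spec = "special_algebras P R \<omega>\<^sub>P :: (('k, 'u) module \<times> (nat \<Rightarrow> 'p \<Rightarrow> 'u list \<Rightarrow> 'u)) set"
  let ?di_alg = "algebras (di P) :: (('k, 'u) module \<times> (nat \<Rightarrow> (nat \<Rightarrow> 'p) \<Rightarrow> 'u list \<Rightarrow> 'u)) set"
  let ?di_spec = "special_algebras (di P) (di R) (di_hom \<omega>\<^sub>P) :: (('k, 'u) module \<times> (nat \<Rightarrow> (nat \<Rightarrow> 'p) \<Rightarrow> 'u list \<Rightarrow> 'u)) set"
  note n = \<open>1 \<le> n\<close>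
  note gP = governsD[OF P] and gR = governsD[OF R]
  \<comment> \<open>A field of characteristic zero is infinite and embeds into \<open>'u\<close>;
    this is the room needed for doubling an algebra.\<close>
  have inf: "infinite (UNIV :: 'u set)"
    using universe(1) infinite_UNIV_char_0[where 'a = 'k] unfolding infinite_le_lepoll
    by (blast intro: lepoll_trans)
  have \<zeta>_hom: "operad_hom (free_operad (doubled \<Omega>)) (di (free_operad \<Omega>)) \<zeta>"
    and \<zeta>_gen: "\<And>s k. s \<in> symb \<Omega> \<Longrightarrow> k < ar \<Omega> s \<Longrightarrow> \<zeta> (ar \<Omega> s) (generator (doubled \<Omega>) (s, k)) =
        di_tensor (free_operad \<Omega>) (ar \<Omega> s) (generator \<Omega> s) (basis_vec (ar \<Omega> s) k)"
    using \<zeta> by (auto simp: is_zeta_def)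
  obtain c where lin: "linearization (doubled \<Omega>) n f L c"
    by (rule complete_linearizationE[OF L(2) f])
  have Lc: "L \<in> ocarrier (free_operad (doubled \<Omega>)) n"
    by (rule linearization.L_closed[OF lin])
  define Z where "Z = \<zeta> n L"
  have Z: "Z \<in> ocarrier (di (free_operad \<Omega>)) n"
    unfolding Z_def by (rule operad_homD(5)[OF \<zeta>_hom n Lc])
  have Zk: "Z k \<in> ocarrier (free_operad \<Omega>) n" if "k < n" for k
    using Z that by auto
  have di\<pi>: "operad_hom (di (free_operad \<Omega>)) (di P) (di_hom \<pi>)"
    by (rule operad_hom_di_hom[OF operad_closed_free gP(2,3)])
  \<comment> \<open>\<open>F\<close> is the image of \<open>L\<close> in \<open>di P\<close>. On a
    \<open>di P\<close>-algebra everything is decided by how \<open>F\<close> acts.\<close>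
  define F where "F = di_hom \<pi> n Z"
  have F: "F \<in> ocarrier (di P) n" unfolding F_def by (rule operad_homD(5)[OF di\<pi> n Z])
  have Fk: "F k = \<pi> n (Z k)" if "k < n" for k using that by (simp add: F_def di_hom_def)

  have \<rho>\<omega>: "operad_hom (free_operad \<Omega>) R (\<lambda>n x. \<rho> n (\<omega> n x))"
    by (rule operad_hom_comp[OF \<omega> gR(3)])
  have ker: "\<rho> m (\<omega> m x) = \<zero>\<^bsub>ospace R m\<^esub>"
    if "1 \<le> m" "x \<in> ocarrier (free_operad \<Omega>) m" "\<pi> m x = \<zero>\<^bsub>ospace P m\<^esub>" for m x
    using induces that by (auto simp: induces_def)
  have \<omega>\<^sub>P_eq: "\<omega>\<^sub>P = (\<lambda>m y. \<rho> m (\<omega> m (inv_into (ocarrier (free_operad \<Omega>) m) (\<pi> m) y)))"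
    unfolding \<omega>\<^sub>P_def by (intro ext) (rule induced_hom_def)
  have \<omega>P: "operad_hom P R \<omega>\<^sub>P"
    unfolding \<omega>\<^sub>P_eq
    by (rule operad_hom_factor(1)[OF operad_closed_free operad_closed.ospace_vec[OF gR(2)]
          operad_closed.ospace_vec[OF gP(2)] gP(3) \<rho>\<omega> gP(4) ker])
  have \<omega>P\<pi>: "\<omega>\<^sub>P m (\<pi> m x) = \<rho> m (\<omega> m x)" if "1 \<le> m" "x \<in> ocarrier (free_operad \<Omega>) m" for m x
    unfolding \<omega>\<^sub>P_eq
    by (rule operad_hom_factor(2)[OF operad_closed_free operad_closed.ospace_vec[OF gR(2)]
          operad_closed.ospace_vec[OF gP(2)] gP(3) \<rho>\<omega> gP(4) ker that])
  have di\<omega>P: "operad_hom (di P) (di R) (di_hom \<omega>\<^sub>P)"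
    by (rule operad_hom_di_hom[OF gP(2) gR(2) \<omega>P])

  \<comment> \<open>The composite of \<zeta>, \<open>di_hom \<pi>\<close> and \<alpha> takes the
    generators to the operations of the algebra and \<open>L\<close> to the action of
    \<open>F\<close>. Linearization then replaces \<open>L\<close> by \<open>f\<close>.\<close>
  have di_identity: "is_identity (di_operad_alg \<Omega> P \<pi> (A, \<alpha>)) f \<longleftrightarrow> \<alpha> n F = \<zero>\<^bsub>ospace (endo A) n\<^esub>"
    if A: "(A, \<alpha>) \<in> algebras (di P)" for A :: "('k, 'u) module" and \<alpha>
  proof -
    let ?g = "\<lambda>m x. \<alpha> m (di_hom \<pi> m (\<zeta> m x))"
    define ops where "ops = (\<lambda>(s, k). \<alpha> (ar \<Omega> s)
      (di_tensor P (ar \<Omega> s) (\<pi> (ar \<Omega> s) (generator \<Omega> s)) (basis_vec (ar \<Omega> s) k)))"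
    have alg: "di_operad_alg \<Omega> P \<pi> (A, \<alpha>) = (A, ops)"
      by (simp add: di_operad_alg_def ops_def)
    have g: "operad_hom (free_operad (doubled \<Omega>)) (endo A) ?g"
      by (rule operad_hom_comp[OF operad_hom_comp[OF \<zeta>_hom di\<pi>] algebrasD(2)[OF A]])
    have ops_eq: "ops sk = ?g (ar (doubled \<Omega>) sk) (generator (doubled \<Omega>) sk)" if sk: "sk \<in> symb (doubled \<Omega>)" for sk
    proof -
      obtain s k where [simp]: "sk = (s, k)" by (cases sk)
      have s: "s \<in> symb \<Omega>" "k < ar \<Omega> s" "1 \<le> ar \<Omega> s" using sk by (auto simp: doubled_def)
      show ?thesis
        using s \<zeta>_gen[OF s(1,2)] di_hom_tensor[OF operad_closed_free gP(2,3) s(3) generator_closed[OF s(1)]]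
        by (simp add: ops_def doubled_def)
    qed
    note hom = is_language_doubled[OF languages(1)] algebrasD(1)[OF A] g ops_eq
    have "algebra_of_type (doubled \<Omega>) (A, ops)"
      by (rule algebra_of_operad_hom(1)[OF hom])
    moreover have "is_identity (A, ops) L \<longleftrightarrow> ?g n L = \<zero>\<^bsub>ospace (endo A) n\<^esub>"
      by (rule algebra_of_operad_hom(2)[OF hom n Lc])
    ultimately show ?thesis
      unfolding alg by (simp add: linearization.is_identity_iff[OF lin] F_def Z_def)
  qed

  \<comment> \<open>On a special algebra \<open>x\<close> acts as
    \<open>\<rho> n (\<omega> n x)\<close> does in the ambient structure. Conversely, an algebra of
    the variety of \<open>R\<close> restricted along \<open>\<omega>\<^sub>P\<close> is a special
    \<open>P\<close>-algebra, so an identity \<open>x\<close> of the special algebras makes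
    \<open>\<omega> n x\<close> an identity of that variety.\<close>
  have special_iff: "(\<forall>A \<in> ?spec.
      is_identity (operad_alg \<Omega> \<pi> A) x) \<longleftrightarrow> \<rho> n (\<omega> n x) = \<zero>\<^bsub>ospace R n\<^esub>"
    if x: "x \<in> ocarrier (free_operad \<Omega>) n" for x
  proof
    have \<omega>x: "\<omega> n x \<in> ocarrier (free_operad \<Xi>) n" by (rule operad_homD(5)[OF \<omega> n x])
    have \<pi>x: "\<pi> n x \<in> ocarrier P n" by (rule operad_homD(5)[OF gP(3) n x])
    {
      assume id: "\<forall>A \<in> ?spec.
        is_identity (operad_alg \<Omega> \<pi> A) x"
      have "is_identity B (\<omega> n x)" if B: "B \<in> variety \<Xi> S'" for B :: "('k, 'x, 'u) alg"
      proof -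
        obtain A ops where [simp]: "B = (A, ops)" by (cases B)
        have "(A, ops) \<in> variety \<Xi> S'" using B by simp
        then obtain \<beta> where \<beta>: "(A, \<beta>) \<in> algebras R"
          "\<forall>m\<ge>1. \<forall>y\<in>ocarrier (free_operad \<Xi>) m.
            is_identity (A, ops) y \<longleftrightarrow> \<beta> m (\<rho> m y) = \<zero>\<^bsub>ospace (endo A) m\<^esub>"
          by (rule variety_algebra[OF R])
        let ?\<alpha> = "\<lambda>m y. \<beta> m (\<omega>\<^sub>P m y)"
        have A: "(A, ?\<alpha>) \<in> algebras P"
          using operad_hom_comp[OF \<omega>P algebrasD(2)[OF \<beta>(1)]] algebrasD(1)[OF \<beta>(1)] by (simp add: algebras_def)
        then have "(A, ?\<alpha>) \<in> special_algebras P R \<omega>\<^sub>P"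
          using \<beta>(1) unfolding special_algebras_def by blast
        then have "is_identity (operad_alg \<Omega> \<pi> (A, ?\<alpha>)) x" using id by blast
        then show ?thesis
          using is_identity_operad_alg[OF languages(1) gP(3) A n x] \<beta>(2)[rule_format, OF n \<omega>x] \<omega>P\<pi>[OF n x] by simp
      qed
      then show "\<rho> n (\<omega> n x) = \<zero>\<^bsub>ospace R n\<^esub>" using gR(5)[OF n \<omega>x] by blast
    next
      assume zero: "\<rho> n (\<omega> n x) = \<zero>\<^bsub>ospace R n\<^esub>"
      show "\<forall>A \<in> ?spec.
        is_identity (operad_alg \<Omega> \<pi> A) x"
      proof (clarify)
        fix A :: "('k, 'u) module" and \<alpha> assume "(A, \<alpha>) \<in> special_algebras P R \<omega>\<^sub>P"
        then obtain \<beta> where \<beta>: "(A, \<alpha>) \<in> algebras P" "(A, \<beta>) \<in> algebras R"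
          "\<forall>m\<ge>1. \<forall>y\<in>ocarrier P m. \<alpha> m y = \<beta> m (\<omega>\<^sub>P m y)"
          by (rule special_algebrasE)
        show "is_identity (operad_alg \<Omega> \<pi> (A, \<alpha>)) x"
          using is_identity_operad_alg[OF languages(1) gP(3) \<beta>(1) n x] \<beta>(3)[rule_format, OF n \<pi>x] \<omega>P\<pi>[OF n x] zero
            algebra_zero[OF \<beta>(2) gR(2) n] by simp
      qed
    }
  qed

  have algebras_iff: "(\<forall>B \<in> ?di_alg.
      is_identity (di_operad_alg \<Omega> P \<pi> B) f) \<longleftrightarrow> (\<forall>k<n. \<pi> n (Z k) = \<zero>\<^bsub>ospace P n\<^esub>)"
  proof
    assume id: "\<forall>B \<in> ?di_alg.
      is_identity (di_operad_alg \<Omega> P \<pi> B) f"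
    show "\<forall>k<n. \<pi> n (Z k) = \<zero>\<^bsub>ospace P n\<^esub>"
    proof (intro allI impI)
      fix k assume k: "k < n"
      have "is_identity (operad_alg \<Omega> \<pi> (A, \<alpha>)) (Z k)" if A\<alpha>: "(A, \<alpha>) \<in> algebras P" for A :: "('k, 'u) module" and \<alpha>
      proof -
        interpret vec_space A by (rule vec_space.intro[OF algebrasD(1)[OF A\<alpha>]])
        obtain E p q pr where "square A E p q pr" by (rule ex_square[OF inf])
        then interpret double P A E p q pr \<alpha>
          using gP(2) algebrasD(2)[OF A\<alpha>] by (intro double.intro double_axioms.intro)
        have "dbl n F = \<zero>\<^bsub>ospace (endo E) n\<^esub>"
          using id in_algebras di_identity[OF in_algebras] by blast
        from dbl_zeroD[OF n F this k] show ?thesis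
          using is_identity_operad_alg[OF languages(1) gP(3) A\<alpha> n Zk[OF k]] Fk[OF k] by simp
      qed
      then show "\<pi> n (Z k) = \<zero>\<^bsub>ospace P n\<^esub>"
        using identity_of_algebras_iff[OF languages(1) P n Zk[OF k]] by fast
    qed
  next
    assume zero: "\<forall>k<n. \<pi> n (Z k) = \<zero>\<^bsub>ospace P n\<^esub>"
    show "\<forall>B \<in> ?di_alg.
      is_identity (di_operad_alg \<Omega> P \<pi> B) f"
    proof clarify
      fix A :: "('k, 'u) module" and \<alpha> assume A: "(A, \<alpha>) \<in> algebras (di P)"
      show "is_identity (di_operad_alg \<Omega> P \<pi> (A, \<alpha>)) f"
        using di_identity[OF A] di_algebra_zero[OF A gP(2) n F] zero Fk by simp
    qed
  qed

  have di_special_iff: "(\<forall>B \<in> ?di_spec.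
      is_identity (di_operad_alg \<Omega> P \<pi> B) f) \<longleftrightarrow> (\<forall>k<n. \<rho> n (\<omega> n (Z k)) = \<zero>\<^bsub>ospace R n\<^esub>)"
  proof
    assume id: "\<forall>B \<in> ?di_spec.
      is_identity (di_operad_alg \<Omega> P \<pi> B) f"
    show "\<forall>k<n. \<rho> n (\<omega> n (Z k)) = \<zero>\<^bsub>ospace R n\<^esub>"
    proof (intro allI impI)
      fix k assume k: "k < n"
      have "is_identity (operad_alg \<Omega> \<pi> (A, \<alpha>)) (Z k)" if "(A, \<alpha>) \<in> special_algebras P R \<omega>\<^sub>P"
        for A :: "('k, 'u) module" and \<alpha>
      proof -
        obtain \<beta> where A\<alpha>: "(A, \<alpha>) \<in> algebras P" and \<beta>: "(A, \<beta>) \<in> algebras R"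
          and \<alpha>\<beta>: "\<forall>m\<ge>1. \<forall>y\<in>ocarrier P m. \<alpha> m y = \<beta> m (\<omega>\<^sub>P m y)"
          using \<open>(A, \<alpha>) \<in> special_algebras P R \<omega>\<^sub>P\<close> by (rule special_algebrasE)
        interpret vec_space A by (rule vec_space.intro[OF algebrasD(1)[OF A\<alpha>]])
        obtain E p q pr where sq: "square A E p q pr" by (rule ex_square[OF inf])
        \<comment> \<open>Both doublings use the same space \<open>E\<close> with the same
          projections and pairing; only the acting operad differs, so the two structures can be
          compared.\<close>
        interpret DP: double P A E p q pr \<alpha>
          using sq gP(2) algebrasD(2)[OF A\<alpha>] by (intro double.intro double_axioms.intro)
        interpret DR: double R A E p q pr \<beta>
          using sq gR(2) algebrasD(2)[OF \<beta>] by (intro double.intro double_axioms.intro)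
        have "DP.dbl m G = DR.dbl m (di_hom \<omega>\<^sub>P m G)" if m: "1 \<le> m" and G: "G \<in> ocarrier (di P) m" for m G
        proof -
          have "\<alpha> m (G k) = \<beta> m (di_hom \<omega>\<^sub>P m G k)" if "k < m" for k
            using \<alpha>\<beta>[rule_format, OF m, of "G k"] G that by (auto simp: di_hom_def)
          then show ?thesis
            unfolding DP.dbl_def DR.dbl_def DR.act_def
            using DP.act_cong[OF DP.p m G, where \<beta> = \<beta> and G = "di_hom \<omega>\<^sub>P m G"]
              DP.act_cong[OF DP.q m G, where \<beta> = \<beta> and G = "di_hom \<omega>\<^sub>P m G"]
            by (intro restrict_ext) simp
        qed
        then have "(E, DP.dbl) \<in> special_algebras (di P) (di R) (di_hom \<omega>\<^sub>P)"
          using DP.in_algebras DR.in_algebras unfolding special_algebras_def by blast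
        then have "DP.dbl n F = \<zero>\<^bsub>ospace (endo E) n\<^esub>"
          using id di_identity[OF DP.in_algebras] by blast
        from DP.dbl_zeroD[OF n F this k] show ?thesis
          using is_identity_operad_alg[OF languages(1) gP(3) A\<alpha> n Zk[OF k]] Fk[OF k] by simp
      qed
      then show "\<rho> n (\<omega> n (Z k)) = \<zero>\<^bsub>ospace R n\<^esub>"
        using special_iff[OF Zk[OF k]] by fast
    qed
  next
    assume zero: "\<forall>k<n. \<rho> n (\<omega> n (Z k)) = \<zero>\<^bsub>ospace R n\<^esub>"
    show "\<forall>B \<in> ?di_spec.
      is_identity (di_operad_alg \<Omega> P \<pi> B) f"
    proof clarify
      fix A :: "('k, 'u) module" and \<alpha> assume "(A, \<alpha>) \<in> special_algebras (di P) (di R) (di_hom \<omega>\<^sub>P)"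
      then obtain \<beta> where A: "(A, \<alpha>) \<in> algebras (di P)" and \<beta>: "(A, \<beta>) \<in> algebras (di R)"
        and \<alpha>\<beta>: "\<forall>m\<ge>1. \<forall>y\<in>ocarrier (di P) m. \<alpha> m y = \<beta> m (di_hom \<omega>\<^sub>P m y)"
        by (rule special_algebrasE)
      have "\<beta> n (di_hom \<omega>\<^sub>P n F) = \<zero>\<^bsub>ospace (endo A) n\<^esub>"
      proof (rule di_algebra_zero[OF \<beta> gR(2) n operad_homD(5)[OF di\<omega>P n F]])
        show "di_hom \<omega>\<^sub>P n F k = \<zero>\<^bsub>ospace R n\<^esub>" if k: "k < n" for k
          using zero k \<omega>P\<pi>[OF n Zk[OF k]] Fk[OF k] by (simp add: di_hom_def)
      qed
      then show "is_identity (di_operad_alg \<Omega> P \<pi> (A, \<alpha>)) f"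
        using di_identity[OF A] \<alpha>\<beta>[rule_format, OF n F] by simp
    qed
  qed

  let ?V = "ospace (free_operad \<Omega>) n :: ('k, ('k, 'o) npoly) module"
  have V: "vector_space_over TYPE('k) ?V"
    by (rule operad_closed.ospace_vec[OF operad_closed_free n])
  interpret T: vec_space "tensor_space ?V n"
    by (rule vec_space.intro[OF vector_space_tensor_space[OF V]])
  interpret V: vec_space ?V by (rule vec_space.intro[OF V])
  \<comment> \<open>The components in a sum of tensors with distinct basis vectors are unique, so
    below \<open>n\<close> the \<open>fs\<close> asked for in (S2) can only be those of
    \<open>Z\<close>. Both conditions then speak of the same components.\<close>
  have decomposition: "Z = (\<Oplus>\<^bsub>ospace (di (free_operad \<Omega>)) n\<^esub>k\<in>{..<n}. di_tensor (free_operad \<Omega>) n (fs k) (basis_vec n k))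
      \<longleftrightarrow> (\<forall>k<n. fs k = Z k)" if fs: "\<forall>k<n. fs k \<in> ocarrier (free_operad \<Omega>) n" for fs
  proof -
    have G: "restrict fs {..<n} \<in> carrier (tensor_space ?V n)" using fs by auto
    have "(\<Oplus>\<^bsub>tensor_space ?V n\<^esub>k\<in>{..<n}. di_tensor (free_operad \<Omega>) n (fs k) (basis_vec n k)) =
      (\<Oplus>\<^bsub>tensor_space ?V n\<^esub>k\<in>{..<n}. di_tensor (free_operad \<Omega>) n (restrict fs {..<n} k) (basis_vec n k))"
      using fs by (intro T.finsum_cong') (auto intro!: V.tensor_basis_closed simp del: tensor_space_simps)
    also have "\<dots> = restrict fs {..<n}" by (rule tensor_expansion[OF V G, symmetric])
    finally show ?thesis
      using Z by (auto simp: fun_eq_iff PiE_iff extensional_def)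
  qed
  have algebra_iff: "(\<forall>A \<in> ?alg.
      is_identity (operad_alg \<Omega> \<pi> A) (Z k)) \<longleftrightarrow> \<pi> n (Z k) = \<zero>\<^bsub>ospace P n\<^esub>" if "k < n" for k
    by (rule identity_of_algebras_iff[OF languages(1) P n Zk[OF that]])
  show ?thesis (is "?S1 \<longleftrightarrow> (\<exists>fs. ?S2 fs)")
  proof
    assume ?S1
    then have "\<forall>k<n. \<rho> n (\<omega> n (Z k)) = \<zero>\<^bsub>ospace R n\<^esub>"
      and nonzero: "\<exists>k<n. \<pi> n (Z k) \<noteq> \<zero>\<^bsub>ospace P n\<^esub>"
      unfolding algebras_iff di_special_iff by blast+
    then have "\<forall>k<n. \<forall>A \<in> ?spec. is_identity (operad_alg \<Omega> \<pi> A) (Z k)"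
      using special_iff[OF Zk] by blast
    moreover have "\<exists>k<n. \<not> (\<forall>A \<in> ?alg. is_identity (operad_alg \<Omega> \<pi> A) (Z k))"
      using nonzero algebra_iff by blast
    ultimately have "?S2 Z"
      using Zk decomposition[of Z] unfolding Z_def[symmetric] by blast
    then show "\<exists>fs. ?S2 fs" by blast
  next
    assume "\<exists>fs. ?S2 fs"
    then obtain fs where S2: "?S2 fs" by blast
    then have fs: "fs k = Z k" if "k < n" for k
      using decomposition[of fs] that unfolding Z_def by blast
    have "\<forall>k<n. \<rho> n (\<omega> n (Z k)) = \<zero>\<^bsub>ospace R n\<^esub>"
      using S2 fs special_iff[OF Zk] by metis
    moreover have "\<exists>k<n. \<pi> n (Z k) \<noteq> \<zero>\<^bsub>ospace P n\<^esub>"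
      using S2 fs algebra_iff by metis
    ultimately show ?S1
      unfolding algebras_iff di_special_iff by blast
  qed
qed

end
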